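(* Let $p\in[1,\infty)$, let $\alpha,\beta\in(0,1]$, and let $\phi$ be an analytic function of $\mathbb{D}$ into itself. Then the following conditions are equivalent. (G1) $\phi\in\mathscr{F}\big(\Lambda_{\omega_\alpha,\infty}(\mathbb{D})\cap\mathscr{H}(\mathbb{D}),\ \Lambda_{\omega_\beta,p}(\mathbb{D})\cap\mathscr{H}(\mathbb{D})\big)$. (G2) There is a constant $M>0$ such that for all $z\in\mathbb{D}$, $$\left(\int_0^{2\pi}\left(|\phi'(ze^{i\theta})|\big(d_{\mathbb{D}}(\phi(ze^{i\theta}))\big)^{\alpha-1}\right)^p d\theta\right)^{1/p}\le M\big(d_{\mathbb{D}}(z)\big)^{\beta-1}.$$ Furthermore, assume that $\phi$ is continuous in $\overline{\mathbb{D}}$ and $\beta\ne1$. Then (G1) and (G2) are equivalent to each of the conditions (G3)–(G5). (G3) $(d_{\mathbb{D}}(\phi))^\alpha\in\Lambda_{\omega_\beta,p}(\overline{\mathbb{D}})$. (G4) $(d_{\mathbb{D}}(\phi))^\alpha\in\Lambda_{\omega_\beta,p}(\mathbb{T})$ and there is a constant $M>0$ such that for all $r\in(0,1)$, $$\left(\int_0^{2\pi}\left\{(d_{\mathbb{D}}(\phi(re^{i\theta})))^\alpha-(d_{\mathbb{D}}(\phi(e^{i\theta})))^\alpha\right\}_+^p d\theta\right)^{1/p}\le M(d_{\mathbb{D}}(r))^\beta.$$ (G5) $(d_{\mathbb{D}}(\phi))^\alpha\in\Lambda_{\omega_\beta,p}(\mathbb{T})$ and there is a constant $M>0$ such that for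 all $r\in(0,1)$, $$\left(\int_0^{2\pi}\left((d_{\mathbb{D}}(\phi(re^{i\theta})))^\alpha-P[(d_{\mathbb{D}}(\phi))^\alpha](re^{i\theta})\right)^p d\theta\right)^{1/p}\le M(d_{\mathbb{D}}(r))^\beta.$$
   Context: $\mathbb{D}$ is the open unit disk in $\mathbb{C}$, $\mathbb{T}=\partial\mathbb{D}$, $d_{\mathbb{D}}(z)=1-|z|$ (also for $z\in\overline{\mathbb{D}}$), $\{x\}_+=\max\{x,0\}$. For $t\ge0$, $\omega_\alpha(t)=t^\alpha$ and $\omega_\beta(t)=t^\beta$. $\mathscr{H}(\mathbb{D})$ is the set of complex-valued harmonic functions in $\mathbb{D}$. For analytic $\phi:\mathbb{D}\to\mathbb{D}$ the composition operator is $C_\phi(f)(z)=f(\phi(z))$; for $X,Y\subset\mathscr{H}(\mathbb{D})$, $\mathscr{F}(X,Y)$ is the set of all analytic $\phi:\mathbb{D}\to\mathbb{D}$ with $C_\phi(X)\subset Y$. $(d_{\mathbb{D}}(\phi))^\alpha$ is the function $z\mapsto(1-|\phi(z)|)^\alpha$. For $p\in(0,\infty)$ put $\mathcal{L}_p[F](z_1,z_2)=\left(\int_0^{2\pi}|F(e^{i\eta}z_1)-F(e^{i\eta}z_2)|^p\,d\eta\right)^{1/p}$, and $\mathcal{L}_\infty[F](z_1,z_2)=|F(z_1)-F(z_2)|$. For $\Omega=\mathbb{D}$ or $\overline{\mathbb{D}}$, $\Lambda_{\omega,p}(\Omega)$ is the class of Borel functions $F:\Omega\to\mathbb{C}$ for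 which there is $M>0$ with $\mathcal{L}_p[F](z_1,z_2)\le M\omega(|z_1-z_2|)$ for all $z_1,z_2\in\Omega$. $\Lambda_{\omega,p}(\mathbb{T})$ consists of those $F\in L^p(\mathbb{T})$ for which there is $M>0$ with $\mathcal{L}_p[F](\xi_1,\xi_2)\le M\omega(|\xi_1-\xi_2|)$ for all $\xi_1,\xi_2\in\mathbb{T}$. $P[\varphi](z)=\frac1{2\pi}\int_0^{2\pi}\varphi(e^{i\tau})\frac{1-|z|^2}{|e^{i\tau}-z|^2}\,d\tau$ is the Poisson integral; $P[(d_{\mathbb{D}}(\phi))^\alpha]$ is that of the boundary function of $(d_{\mathbb{D}}(\phi))^\alpha$. *)

theory Defs
  imports "HOL-Analysis.Analysis"
begin

text \<open>
  Functions with domain the open disk, the closed disk or the unit circle are total functions on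
  \<^typ>\<open>complex\<close>; every definition below inspects them only on the domain in question.
\<close>

definition dD :: "complex \<Rightarrow> real" where
  "dD z = 1 - cmod z"

definition pow_mod :: "real \<Rightarrow> real \<Rightarrow> real" where
  "pow_mod \<alpha> t = t powr \<alpha>"

text \<open>The power \<open>x\<^sup>a\<close> for \<open>x \<in> [0, \<infinity>]\<close> and \<open>a > 0\<close>.\<close>

definition ennpowr :: "ennreal \<Rightarrow> real \<Rightarrow> ennreal" where
  "ennpowr x a = (if x = \<infinity> then \<infinity> else ennreal (enn2real x powr a))"

text \<open>
  \<open>(\<integral>\<^sub>0\<^bsup>2\<pi>\<^esup> g(\<theta>)\<^sup>p d\<theta>)\<^bsup>1/p\<^esup>\<close> for \<open>g \<ge> 0\<close>. The value lies in \<open>[0, \<infinity>]\<close>, so that a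
  divergent integral does not satisfy any upper bound by a real number.
\<close>

definition circle_norm :: "real \<Rightarrow> (real \<Rightarrow> real) \<Rightarrow> ennreal" where
  "circle_norm p g =
     ennpowr (\<integral>\<^sup>+\<theta>. ennreal (g \<theta> powr p) \<partial>lebesgue_on {0..2*pi}) (1 / p)"

definition Lp_diff :: "ennreal \<Rightarrow> (complex \<Rightarrow> complex) \<Rightarrow> complex \<Rightarrow> complex \<Rightarrow> ennreal" where
  "Lp_diff p F z\<^sub>1 z\<^sub>2 =
     (if p = \<infinity> then ennreal (cmod (F z\<^sub>1 - F z\<^sub>2))
      else circle_norm (enn2real p) (\<lambda>\<eta>. cmod (F (cis \<eta> * z\<^sub>1) - F (cis \<eta> * z\<^sub>2))))"

text \<open>\<open>\<Lambda>\<^sub>\<omega>\<^sub>,\<^sub>p(\<Omega>)\<close> for \<open>\<Omega>\<close> the open or the closed unit disk.\<close>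

definition Lip_disk :: "(real \<Rightarrow> real) \<Rightarrow> ennreal \<Rightarrow> complex set \<Rightarrow> (complex \<Rightarrow> complex) set" where
  "Lip_disk \<omega> p \<Omega> =
     {F. F \<in> borel_measurable (restrict_space borel \<Omega>) \<and>
         (\<exists>M>0. \<forall>z\<^sub>1\<in>\<Omega>. \<forall>z\<^sub>2\<in>\<Omega>. Lp_diff p F z\<^sub>1 z\<^sub>2 \<le> ennreal (M * \<omega> (cmod (z\<^sub>1 - z\<^sub>2))))}"

definition Lp_circle :: "ennreal \<Rightarrow> (complex \<Rightarrow> complex) set" where
  "Lp_circle p =
     {F. (\<lambda>\<theta>. F (cis \<theta>)) \<in> borel_measurable (lebesgue_on {0..2*pi}) \<and>
         (if p = \<infinity> then \<exists>C. AE \<theta> in lebesgue_on {0..2*pi}. cmod (F (cis \<theta>)) \<le> C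
          else circle_norm (enn2real p) (\<lambda>\<theta>. cmod (F (cis \<theta>))) < \<infinity>)}"

text \<open>\<open>\<Lambda>\<^sub>\<omega>\<^sub>,\<^sub>p(\<T>)\<close>; elements of \<open>L\<^sup>p(\<T>)\<close> are represented by functions.\<close>

definition Lip_circle :: "(real \<Rightarrow> real) \<Rightarrow> ennreal \<Rightarrow> (complex \<Rightarrow> complex) set" where
  "Lip_circle \<omega> p =
     {F. F \<in> Lp_circle p \<and>
         (\<exists>M>0. \<forall>\<xi>\<^sub>1\<in>sphere 0 1. \<forall>\<xi>\<^sub>2\<in>sphere 0 1.
            Lp_diff p F \<xi>\<^sub>1 \<xi>\<^sub>2 \<le> ennreal (M * \<omega> (cmod (\<xi>\<^sub>1 - \<xi>\<^sub>2))))}"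

text \<open>
  Complex-valued harmonic functions on the unit disk: \<open>f\<close> is twice continuously differentiable in the
  real sense, with first and second derivatives \<open>f'\<close> and \<open>f''\<close>, and
  \<open>\<Delta>f = f\<^sub>x\<^sub>x + f\<^sub>y\<^sub>y = f''(1, 1) + f''(\<i>, \<i>)\<close> vanishes.
\<close>

definition harmonic_disk :: "(complex \<Rightarrow> complex) set" where
  "harmonic_disk =
     {f. \<exists>(f' :: complex \<Rightarrow> complex \<Rightarrow>\<^sub>L complex)
          (f'' :: complex \<Rightarrow> complex \<Rightarrow>\<^sub>L complex \<Rightarrow>\<^sub>L complex).
          continuous_on (ball 0 1) f'' \<and>
          (\<forall>z\<in>ball 0 1.
             (f has_derivative blinfun_apply (f' z)) (at z) \<and>
             (f' has_derivative blinfun_apply (f'' z)) (at z) \<and>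
             blinfun_apply (blinfun_apply (f'' z) 1) 1 +
             blinfun_apply (blinfun_apply (f'' z) \<i>) \<i> = 0)}"

definition comp_op :: "(complex \<Rightarrow> complex) \<Rightarrow> (complex \<Rightarrow> complex) \<Rightarrow> complex \<Rightarrow> complex" where
  "comp_op \<phi> f = (\<lambda>z. f (\<phi> z))"

definition comp_symbols ::
    "(complex \<Rightarrow> complex) set \<Rightarrow> (complex \<Rightarrow> complex) set \<Rightarrow> (complex \<Rightarrow> complex) set" where
  "comp_symbols X Y =
     {\<phi>. \<phi> holomorphic_on ball 0 1 \<and> \<phi> ` ball 0 1 \<subseteq> ball 0 1 \<and> comp_op \<phi> ` X \<subseteq> Y}"

text \<open>Stated for vector-valued functions in order to cover both real and complex integrands.\<close>

definition poisson_integral ::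
    "(complex \<Rightarrow> 'a::{banach, second_countable_topology}) \<Rightarrow> complex \<Rightarrow> 'a" where
  "poisson_integral \<psi> z =
     (1 / (2 * pi)) *\<^sub>R
       (\<integral>\<tau>. ((1 - (cmod z)\<^sup>2) / (cmod (cis \<tau> - z))\<^sup>2) *\<^sub>R \<psi> (cis \<tau>) \<partial>lebesgue_on {0..2*pi})"

end

theory Submission
  imports Defs "HOL-Complex_Analysis.Complex_Analysis"
begin

text \<open>
  Let \<open>d(w) = 1-|w|\<close> be the distance to the unit circle, \<open>u = d(\<phi>)^\<alpha>\<close> and
  \<open>K = |\<phi>'| d(\<phi>)^(\<alpha>-1)\<close>. The second condition says that the \<open>L^p\<close> means of \<open>K\<close> over the circle of radius \<open>r\<close> grow at most like
  \<open>(1-r)^(\<beta>-1)\<close>, and every other condition is tied to it.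

  Integrating growth. If \<open>|U(a)-U(b)|\<close> is at most a constant times the integral of \<open>K\<close> along the
  segment from \<open>a\<close> to \<open>b\<close>, then \<open>U\<close> has
  \<open>L^p\<close> modulus of continuity \<open>O(t^\<beta>)\<close>: join \<open>z\<^sub>1\<close> to \<open>z\<^sub>2\<close> through \<open>(1-h)z\<^sub>1\<close> and \<open>(1-h)z\<^sub>2\<close> with
  \<open>h = min(1,|z\<^sub>1-z\<^sub>2|)\<close> and apply Minkowski's integral inequality on the three segments
  (\<open>hardy_littlewood_disk\<close>). This covers \<open>U = f\<circ>\<phi>\<close> for every harmonic Hoelder function \<open>f\<close>,
  because such an \<open>f\<close> is \<open>F+cnj G\<close> with \<open>|F'|\<close> and \<open>|G'|\<close> bounded by a multiple of
  \<open>d^(\<alpha>-1)\<close>, and it covers \<open>U = u\<close>; in that case the bound passes to the closed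
  disk by Fatou's lemma.

  From composition operators back to growth. A finite family of lacunary series \<open>f\<^sub>i\<close> lies in the
  Hoelder class of order \<open>\<alpha>\<close>, and at every point of the disk at least one \<open>|f\<^sub>i'|\<close> is bounded
  below by a multiple of \<open>d^(\<alpha>-1)\<close> (\<open>lacunary_test_functions\<close>). Hence \<open>K \<le> C max\<^sub>i |(f\<^sub>i\<circ>\<phi>)'|\<close>, and
  Cauchy's formula turns the \<open>L^p\<close> modulus of continuity of \<open>f\<^sub>i\<circ>\<phi>\<close> into a bound for the means of
  its derivative.

  The boundary conditions. The function \<open>w \<mapsto> (1-|w|)^\<alpha>\<close> is concave, so \<open>u\<close> is superharmonic
  and \<open>u \<ge> P[u]\<close>. The difference between \<open>P[u](re^(i\<theta>))\<close> and \<open>u(e^(i\<theta>))\<close> is at most the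
  Poisson average of \<open>|u(e^(i\<tau>))-u(e^(i\<theta>))|\<close> over \<open>\<tau>\<close>, which by Minkowski is \<open>O((1-r)^\<beta>)\<close> in
  \<open>L^p\<close> as long as \<open>\<beta><1\<close> (\<open>circle_norm_poisson_osc\<close>). This gives the fifth condition from the
  fourth. Finally, by a Schwarz type inequality, if \<open>|\<phi>|\<close> on a circle of radius \<open>\<rho>\<close> about \<open>z\<close> exceeds
  \<open>|\<phi>(z)|\<close> by at most \<open>E\<close>, then \<open>\<rho>|\<phi>'(z)| \<le> 2E\<close>; with concavity,
  \<open>\<rho> K(z)\<close> is at most \<open>2/\<alpha>\<close> times the largest drop \<open>u(z)-u(w)\<close> on the circle. Since
  \<open>u(w)\<ge> P[u](w)\<close> and, by Harnack's inequality, \<open>P[u](w)\<close> differs from \<open>P[u](z)\<close> by no more than a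
  multiple of the same Poisson average, the drop is controlled by \<open>u(z)-P[u](z)\<close> and that average, which
  closes the circle of implications (\<open>poisson_gap_imp_deriv_growth\<close>).
\<close>

section \<open>Powers and \<open>L\<^sup>p\<close> means over the circle\<close>

text \<open>
  The convex function \<open>x^p\<close> lies above its tangent at \<open>c\<close>. Taken at the mean of a function and
  integrated, this is Jensen's inequality, which drives Minkowski's integral inequality below.
\<close>

lemma powr_convex_tangent:
  fixes x c p :: real
  assumes "1 \<le> p" "0 \<le> x" "0 < c"
  shows "p * c powr (p - 1) * x \<le> x powr p + (p - 1) * c powr p"
proof (cases "p = 1 \<or> x = 0")
  case False
  then have x: "x > 0" and p: "p > 1" using assms by auto
  have "(x powr p) powr (1/p) * (c powr p) powr (1 - 1/p) \<le> 1/p * x powr p + (1 - 1/p) * c powr p"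
    using x p assms by (intro Youngs_inequality_0) auto
  moreover have "(x powr p) powr (1/p) = x"
    using x p by (simp add: powr_powr)
  moreover have "(c powr p) powr (1 - 1/p) = c powr (p - 1)"
    using p by (simp add: powr_powr right_diff_distrib)
  ultimately have "p * (x * c powr (p - 1)) \<le> p * (1/p * x powr p + (1 - 1/p) * c powr p)"
    using p by (intro mult_left_mono) auto
  also have "\<dots> = x powr p + (p - 1) * c powr p"
    using p by (simp add: field_simps)
  finally show ?thesis by (simp add: algebra_simps)
qed (use assms in auto)

text \<open>
  The concave function \<open>t^\<alpha>\<close> lies below its tangent at \<open>a\<close>. It is used twice: read from above
  it makes powers of the distance superharmonic, read from below it compares a drop of the power with a
  drop of the distance itself.
\<close>

lemma powr_concave_tangent:
  fixes a b :: real
  assumes "0 < \<alpha>" "\<alpha> \<le> 1" "0 < a" "0 \<le> b"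
  shows "b powr \<alpha> \<le> a powr \<alpha> + \<alpha> * a powr (\<alpha> - 1) * (b - a)"
proof (cases "b = 0")
  case True
  then show ?thesis
    using assms by (simp add: powr_diff mult_le_one)
next
  case False
  then have "b powr \<alpha> * a powr (1 - \<alpha>) \<le> \<alpha> * b + (1 - \<alpha>) * a"
    using assms by (intro Youngs_inequality_0) auto
  then have "(b powr \<alpha> * a powr (1 - \<alpha>)) * a powr (\<alpha> - 1) \<le> (\<alpha> * b + (1 - \<alpha>) * a) * a powr (\<alpha> - 1)"
    by (intro mult_right_mono) auto
  moreover have "(b powr \<alpha> * a powr (1 - \<alpha>)) * a powr (\<alpha> - 1) = b powr \<alpha>"
  proof -
    have "a powr (1 - \<alpha>) * a powr (\<alpha> - 1) = 1"
      using assms by (simp flip: powr_add)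
    then show ?thesis by (simp only: mult.assoc mult_1_right)
  qed
  moreover have "a powr \<alpha> = a * a powr (\<alpha> - 1)"
    using assms by (simp add: powr_diff)
  then have "(\<alpha> * b + (1 - \<alpha>) * a) * a powr (\<alpha> - 1) = a powr \<alpha> + \<alpha> * a powr (\<alpha> - 1) * (b - a)"
    by (simp add: algebra_simps)
  ultimately show ?thesis by (simp only:)
qed

lemma powr_add_le:
  fixes a b p :: real
  assumes "0 \<le> a" "0 \<le> b" "0 < p"
  shows "(a + b) powr p \<le> 2 powr p * (a powr p + b powr p)"
proof -
  have "(a + b) powr p \<le> (2 * max a b) powr p"
    using assms by (intro powr_mono2) auto
  also have "\<dots> = 2 powr p * max a b powr p"
    using assms by (simp add: powr_mult)
  also have "\<dots> \<le> 2 powr p * (a powr p + b powr p)"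
    by (intro mult_left_mono) (auto simp: max_def)
  finally show ?thesis .
qed

text \<open>
  Bounds for the norm become bounds for an integral over \<open>lborel\<close>, where Tonelli's theorem and
  measurability of continuous functions are available; the completion has the same nonnegative
  integrals.
\<close>

lemma circle_norm_le_iff:
  assumes "0 < p" "0 \<le> c"
  shows "circle_norm p g \<le> ennreal c \<longleftrightarrow>
    (\<integral>\<^sup>+\<theta>\<in>{0..2*pi}. ennreal (g \<theta> powr p) \<partial>lborel) \<le> ennreal (c powr p)"
proof -
  have eq: "(\<integral>\<^sup>+\<theta>. ennreal (g \<theta> powr p) \<partial>lebesgue_on {0..2*pi}) =
      (\<integral>\<^sup>+\<theta>\<in>{0..2*pi}. ennreal (g \<theta> powr p) \<partial>lborel)"
    by (subst nn_integral_restrict_space) (auto simp: nn_integral_completion)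
  show ?thesis
  proof (cases "(\<integral>\<^sup>+\<theta>\<in>{0..2*pi}. ennreal (g \<theta> powr p) \<partial>lborel)" rule: ennreal_cases)
    case (real x)
    have "x powr (1/p) \<le> c \<longleftrightarrow> x \<le> c powr p"
    proof
      assume "x powr (1/p) \<le> c"
      then have "(x powr (1/p)) powr p \<le> c powr p"
        using assms by (intro powr_mono2) auto
      then show "x \<le> c powr p" using assms real by (simp add: powr_powr)
    next
      assume "x \<le> c powr p"
      then have "x powr (1/p) \<le> (c powr p) powr (1/p)"
        using assms real by (intro powr_mono2) auto
      then show "x powr (1/p) \<le> c" using assms by (simp add: powr_powr)
    qed
    then show ?thesis
      using real assms by (simp add: circle_norm_def ennpowr_def eq ennreal_le_iff)
  next
    case top
    then show ?thesis
      by (simp add: circle_norm_def ennpowr_def eq top_unique)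
  qed
qed

lemma circle_norm_mono:
  assumes "circle_norm p g \<le> ennreal c" "0 < p" "0 \<le> c"
    and "\<And>\<theta>. 0 \<le> \<theta> \<Longrightarrow> \<theta> \<le> 2 * pi \<Longrightarrow> 0 \<le> f \<theta> \<and> f \<theta> \<le> g \<theta>"
  shows "circle_norm p f \<le> ennreal c"
proof -
  have "(\<integral>\<^sup>+\<theta>\<in>{0..2*pi}. ennreal (f \<theta> powr p) \<partial>lborel)
      \<le> (\<integral>\<^sup>+\<theta>\<in>{0..2*pi}. ennreal (g \<theta> powr p) \<partial>lborel)"
    using assms by (intro nn_integral_mono) (auto simp: indicator_def intro!: ennreal_leI powr_mono2)
  then show ?thesis
    using assms by (simp add: circle_norm_le_iff)
qed

lemma circle_norm_cmult:
  assumes "circle_norm p g \<le> ennreal c" "0 < p" "0 \<le> c" "0 \<le> a" "g \<in> borel_measurable borel"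
    and "\<And>\<theta>. 0 \<le> \<theta> \<Longrightarrow> \<theta> \<le> 2 * pi \<Longrightarrow> 0 \<le> g \<theta>"
  shows "circle_norm p (\<lambda>\<theta>. a * g \<theta>) \<le> ennreal (a * c)"
proof -
  have "(\<integral>\<^sup>+\<theta>\<in>{0..2*pi}. ennreal ((a * g \<theta>) powr p) \<partial>lborel)
      = (\<integral>\<^sup>+\<theta>. ennreal (a powr p) * (ennreal (g \<theta> powr p) * indicator {0..2*pi} \<theta>) \<partial>lborel)"
    using assms by (intro nn_integral_cong) (auto simp: indicator_def powr_mult ennreal_mult)
  also have "\<dots> = ennreal (a powr p) * (\<integral>\<^sup>+\<theta>\<in>{0..2*pi}. ennreal (g \<theta> powr p) \<partial>lborel)"
    using assms by (intro nn_integral_cmult) auto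
  also have "\<dots> \<le> ennreal (a powr p) * ennreal (c powr p)"
    using assms by (intro mult_left_mono) (auto simp: circle_norm_le_iff)
  also have "\<dots> = ennreal ((a * c) powr p)"
    using assms by (simp add: powr_mult ennreal_mult)
  finally show ?thesis
    using assms by (simp add: circle_norm_le_iff)
qed

text \<open>
  The factor 4 replaces the sharp triangle inequality: it follows from
  \<open>(a+b)^p \<le> 2^p(a^p+b^p)\<close> alone, and every constant in the theorem is free.
\<close>

lemma circle_norm_add:
  assumes f: "circle_norm p f \<le> ennreal c" and g: "circle_norm p g \<le> ennreal d"
    and p: "1 \<le> p" and cd: "0 \<le> c" "0 \<le> d"
    and [measurable]: "f \<in> borel_measurable borel" "g \<in> borel_measurable borel"
    and nn: "\<And>\<theta>. 0 \<le> \<theta> \<Longrightarrow> \<theta> \<le> 2 * pi \<Longrightarrow> 0 \<le> f \<theta> \<and> 0 \<le> g \<theta>"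
  shows "circle_norm p (\<lambda>\<theta>. f \<theta> + g \<theta>) \<le> ennreal (4 * (c + d))"
proof -
  let ?I = "\<lambda>h. \<integral>\<^sup>+\<theta>\<in>{0..2*pi}. ennreal (h \<theta> powr p) \<partial>lborel"
  have "?I (\<lambda>\<theta>. f \<theta> + g \<theta>) \<le>
      (\<integral>\<^sup>+\<theta>. ennreal (2 powr p) * (ennreal (f \<theta> powr p) * indicator {0..2*pi} \<theta>
                            + ennreal (g \<theta> powr p) * indicator {0..2*pi} \<theta>) \<partial>lborel)"
    using nn p by (intro nn_integral_mono)
      (auto simp: indicator_def simp flip: ennreal_mult ennreal_plus intro!: ennreal_leI powr_add_le)
  also have "\<dots> = ennreal (2 powr p) * (?I f + ?I g)"
    by (subst nn_integral_cmult, simp, subst nn_integral_add) auto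
  also have "\<dots> \<le> ennreal (2 powr p) * (ennreal (c powr p) + ennreal (d powr p))"
    using f g p cd by (intro mult_left_mono add_mono) (auto simp: circle_norm_le_iff)
  also have "\<dots> = ennreal (2 powr p * (c powr p + d powr p))"
    by (simp add: ennreal_mult flip: ennreal_plus)
  also have "\<dots> \<le> ennreal ((4 * (c + d)) powr p)"
  proof (rule ennreal_leI)
    have "c powr p \<le> (c + d) powr p" "d powr p \<le> (c + d) powr p"
      using cd p by (auto intro!: powr_mono2)
    then have "2 powr p * (c powr p + d powr p) \<le> 2 powr p * (2 * (c + d) powr p)"
      by (intro mult_left_mono) auto
    also have "\<dots> \<le> 2 powr p * (2 powr p * (c + d) powr p)"
      using p powr_mono[of 1 p 2] by (intro mult_left_mono mult_right_mono) auto
    also have "\<dots> = (4 * (c + d)) powr p"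
      using cd by (simp add: powr_mult[symmetric] mult.assoc[symmetric])
    finally show "2 powr p * (c powr p + d powr p) \<le> (4 * (c + d)) powr p" .
  qed
  finally show ?thesis
    using p cd by (subst circle_norm_le_iff) auto
qed

section \<open>Minkowski's integral inequality\<close>

text \<open>
  Minkowski's inequality
  \<open>\<parallel> \<integral> G(t,\<cdot>) dt \<parallel>_p \<le> \<integral> \<parallel>G(t,\<cdot>)\<parallel>_p dt\<close> when a bound \<open>w(t)\<close> for the inner norms is
  known. Jensen's inequality for the probability measure \<open>w dt/W\<close> gives
  \<open>v^p \<le> W^(p-1)\<integral> w^(1-p)G^p dt\<close> pointwise, and Tonelli's theorem integrates this in the second
  variable. The weight stands for the norms
  themselves because it is measurable by hypothesis and explicit in every application.
\<close>

lemma minkowski_integral_weighted: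
  fixes G :: "'a \<times> 'b \<Rightarrow> real"
  assumes p: "1 \<le> p" and M: "sigma_finite_measure M" and N: "sigma_finite_measure N"
    and S[measurable]: "S \<in> sets M"
    and G[measurable]: "G \<in> borel_measurable (M \<Otimes>\<^sub>M N)" and G0: "\<And>x. 0 \<le> G x"
    and w[measurable]: "w \<in> borel_measurable M" and w0: "\<And>t. t \<in> S \<Longrightarrow> 0 < w t"
    and W: "0 < W" "(\<integral>\<^sup>+t\<in>S. ennreal (w t) \<partial>M) \<le> ennreal W"
    and Gw: "\<And>t. t \<in> S \<Longrightarrow> (\<integral>\<^sup>+y. ennreal (G (t, y) powr p) \<partial>N) \<le> ennreal (w t powr p)"
    and v0: "\<And>y. 0 \<le> v y"
    and v: "\<And>y. y \<in> space N \<Longrightarrow> ennreal (v y) \<le> (\<integral>\<^sup>+t\<in>S. ennreal (G (t, y)) \<partial>M)"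
  shows "(\<integral>\<^sup>+y. ennreal (v y powr p) \<partial>N) \<le> ennreal (W powr p)"
proof -
  interpret MN: pair_sigma_finite M N using M N by (simp add: pair_sigma_finite_def)
  define H where "H = (\<lambda>(t, y). ennreal (w t powr (1 - p) * G (t, y) powr p) * indicator S t)"
  have Hm[measurable]: "H \<in> borel_measurable (M \<Otimes>\<^sub>M N)"
    unfolding H_def by measurable
  have key: "ennreal (v y powr p) \<le> ennreal (W powr (p - 1)) * (\<integral>\<^sup>+t. H (t, y) \<partial>M)"
    if y: "y \<in> space N" for y
  proof (cases "v y = 0")
    case False
    with v0[of y] have vy: "v y > 0" by simp
    \<comment> \<open>Jensen's inequality by the tangent at the mean: the mean of \<open>G/w\<close> with respect to \<open>w dt/W\<close> is
      at least \<open>c\<close>.\<close>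
    define c where "c = v y / W"
    have c: "c > 0" using vy W by (simp add: c_def)
    have Gy[measurable]: "(\<lambda>t. G (t, y)) \<in> borel_measurable M"
      using y by measurable
    have Hy[measurable]: "(\<lambda>t. H (t, y)) \<in> borel_measurable M"
      using y by measurable
    have pt: "ennreal (p * c powr (p - 1)) * (ennreal (G (t, y)) * indicator S t)
        \<le> H (t, y) + ennreal ((p - 1) * c powr p) * (ennreal (w t) * indicator S t)" for t
    proof (cases "t \<in> S")
      case True
      have wt: "w t > 0" by (rule w0) fact
      have "w t * (p * c powr (p - 1) * (G (t, y) / w t)) \<le>
            w t * ((G (t, y) / w t) powr p + (p - 1) * c powr p)"
        using wt p c G0 by (intro mult_left_mono powr_convex_tangent) auto
      also have "\<dots> = w t powr (1 - p) * G (t, y) powr p + (p - 1) * c powr p * w t"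
        using wt G0 by (simp add: powr_divide powr_diff algebra_simps)
      also have "w t * (p * c powr (p - 1) * (G (t, y) / w t)) = p * c powr (p - 1) * G (t, y)"
        using wt by simp
      finally have "ennreal (p * c powr (p - 1) * G (t, y)) \<le>
          ennreal (w t powr (1 - p) * G (t, y) powr p + (p - 1) * c powr p * w t)"
        by (rule ennreal_leI)
      then show ?thesis
        using True p G0[of "(t, y)"] wt by (simp add: H_def ennreal_mult ennreal_plus)
    qed simp
    have "ennreal (p * c powr (p - 1) * v y) = ennreal (p * c powr (p - 1)) * ennreal (v y)"
      using p v0 by (simp add: ennreal_mult)
    also have "\<dots> \<le> ennreal (p * c powr (p - 1)) * (\<integral>\<^sup>+t\<in>S. ennreal (G (t, y)) \<partial>M)"
      using v[OF y] by (intro mult_left_mono) auto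
    also have "\<dots> = (\<integral>\<^sup>+t. ennreal (p * c powr (p - 1)) * (ennreal (G (t, y)) * indicator S t) \<partial>M)"
      by (rule nn_integral_cmult[symmetric]) simp
    also have "\<dots> \<le> (\<integral>\<^sup>+t. H (t, y) + ennreal ((p - 1) * c powr p) * (ennreal (w t) * indicator S t) \<partial>M)"
      by (intro nn_integral_mono pt)
    also have "\<dots> = (\<integral>\<^sup>+t. H (t, y) \<partial>M) + ennreal ((p - 1) * c powr p) * (\<integral>\<^sup>+t\<in>S. ennreal (w t) \<partial>M)"
      by (subst nn_integral_add) (auto simp: nn_integral_cmult)
    also have "\<dots> \<le> (\<integral>\<^sup>+t. H (t, y) \<partial>M) + ennreal ((p - 1) * c powr p) * ennreal W"
      using W by (intro add_left_mono mult_left_mono) auto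
    also have "\<dots> = (\<integral>\<^sup>+t. H (t, y) \<partial>M) + ennreal ((p - 1) * c powr p * W)"
      using p W by (simp add: ennreal_mult)
    finally have *: "ennreal (p * c powr (p - 1) * v y) \<le>
        (\<integral>\<^sup>+t. H (t, y) \<partial>M) + ennreal ((p - 1) * c powr p * W)" .
    have cW: "c powr (p - 1) * v y = c powr p * W"
    proof -
      have "v y = c * W" using W by (simp add: c_def)
      moreover have "c powr (p - 1) * c = c powr p" using c by (simp add: powr_diff)
      ultimately show ?thesis by (metis mult.assoc)
    qed
    have "ennreal (c powr p * W) \<le> (\<integral>\<^sup>+t. H (t, y) \<partial>M)"
    proof (cases "(\<integral>\<^sup>+t. H (t, y) \<partial>M)" rule: ennreal_cases)
      case (real x)
      have "ennreal (p * (c powr p * W)) \<le> ennreal (x + (p - 1) * c powr p * W)"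
        using * cW p W real by (simp add: ennreal_plus[symmetric] mult.assoc del: ennreal_plus)
      then have "p * (c powr p * W) \<le> x + (p - 1) * c powr p * W"
        using p W real by (subst (asm) ennreal_le_iff) auto
      then show ?thesis using real by (simp add: algebra_simps ennreal_leI)
    qed simp
    then have "ennreal (W powr (p - 1)) * ennreal (c powr p * W) \<le>
        ennreal (W powr (p - 1)) * (\<integral>\<^sup>+t. H (t, y) \<partial>M)"
      by (rule mult_left_mono) simp
    moreover have "W powr (p - 1) * (c powr p * W) = v y powr p"
      using W vy by (simp add: c_def powr_divide powr_diff abs_of_pos)
    ultimately show ?thesis
      using W by (simp add: ennreal_mult[symmetric] del: ennreal_mult)
  qed (use p in simp)
  have wM: "(\<integral>\<^sup>+y. H (t, y) \<partial>N) \<le> ennreal (w t) * indicator S t" if t: "t \<in> space M" for t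
  proof (cases "t \<in> S")
    case True
    have [measurable]: "(\<lambda>y. G (t, y)) \<in> borel_measurable N" using t by measurable
    have "(\<integral>\<^sup>+y. H (t, y) \<partial>N) = ennreal (w t powr (1 - p)) * (\<integral>\<^sup>+y. ennreal (G (t, y) powr p) \<partial>N)"
      using True by (simp add: H_def ennreal_mult nn_integral_cmult)
    also have "\<dots> \<le> ennreal (w t powr (1 - p)) * ennreal (w t powr p)"
      using Gw[OF True] by (intro mult_left_mono) auto
    also have "\<dots> = ennreal (w t)"
      using w0[OF True] by (simp add: ennreal_mult[symmetric] powr_add[symmetric])
    finally show ?thesis using True by simp
  qed (simp add: H_def)
  have "(\<integral>\<^sup>+y. ennreal (v y powr p) \<partial>N) \<le> (\<integral>\<^sup>+y. ennreal (W powr (p - 1)) * (\<integral>\<^sup>+t. H (t, y) \<partial>M) \<partial>N)"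
    by (intro nn_integral_mono key)
  also have "\<dots> = ennreal (W powr (p - 1)) * (\<integral>\<^sup>+y. (\<integral>\<^sup>+t. H (t, y) \<partial>M) \<partial>N)"
    by (rule nn_integral_cmult) measurable
  also have "(\<integral>\<^sup>+y. (\<integral>\<^sup>+t. H (t, y) \<partial>M) \<partial>N) = (\<integral>\<^sup>+t. (\<integral>\<^sup>+y. H (t, y) \<partial>N) \<partial>M)"
    by (rule MN.Fubini) simp
  also have "\<dots> \<le> (\<integral>\<^sup>+t\<in>S. ennreal (w t) \<partial>M)"
    by (intro nn_integral_mono wM)
  also have "\<dots> \<le> ennreal W" by fact
  also have "ennreal (W powr (p - 1)) * ennreal W = ennreal (W powr p)"
    using W by (simp add: ennreal_mult[symmetric] powr_diff)
  finally show ?thesis by (simp add: mult_left_mono)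
qed

text \<open>
  The inequality for a parameter in a Borel set of reals, with integrands that are continuous there;
  the interval may be open, so that weights such as \<open>t^(\<beta>-1)\<close> are admitted.
\<close>

lemma circle_norm_integral_le:
  fixes G :: "real \<Rightarrow> real \<Rightarrow> real"
  assumes p: "1 \<le> p" and S: "S \<in> sets borel"
    and G: "continuous_on (S \<times> UNIV) (\<lambda>(t, \<theta>). G t \<theta>)"
    and G0: "\<And>t \<theta>. t \<in> S \<Longrightarrow> 0 \<le> G t \<theta>"
    and w: "continuous_on S w" and w0: "\<And>t. t \<in> S \<Longrightarrow> 0 < w t"
    and W: "0 < W" "(\<integral>\<^sup>+t\<in>S. ennreal (w t) \<partial>lborel) \<le> ennreal W"
    and Gw: "\<And>t. t \<in> S \<Longrightarrow> circle_norm p (G t) \<le> ennreal (w t)"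
    and v: "\<And>\<theta>. 0 \<le> \<theta> \<Longrightarrow> \<theta> \<le> 2 * pi \<Longrightarrow> 0 \<le> v \<theta> \<and> ennreal (v \<theta>) \<le> (\<integral>\<^sup>+t\<in>S. ennreal (G t \<theta>) \<partial>lborel)"
  shows "circle_norm p v \<le> ennreal W"
proof -
  let ?I = "{0..2*pi}"
  define G' where "G' = (\<lambda>x. indicator (S \<times> ?I) x *\<^sub>R (case x of (t, \<theta>) \<Rightarrow> G t \<theta>))"
  define w' where "w' = (\<lambda>t. indicator S t *\<^sub>R w t)"
  have meas: "S \<times> ?I \<in> sets (borel :: (real \<times> real) measure)"
    using S by (subst borel_prod[symmetric]) auto
  have G'm: "G' \<in> borel_measurable (borel \<Otimes>\<^sub>M borel)"
    unfolding G'_def borel_prod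
    by (rule borel_measurable_continuous_on_indicator[OF meas])
       (rule continuous_on_subset[OF G], auto)
  have w'm: "w' \<in> borel_measurable borel"
    unfolding w'_def by (rule borel_measurable_continuous_on_indicator[OF S w])
  have eqI: "(\<integral>\<^sup>+y. ennreal ((indicator ?I y * f y) powr p) \<partial>lborel) = (\<integral>\<^sup>+y\<in>?I. ennreal (f y powr p) \<partial>lborel)"
    for f :: "real \<Rightarrow> real"
    using p by (intro nn_integral_cong) (auto simp: indicator_def)
  have "(\<integral>\<^sup>+y. ennreal ((indicator ?I y * v y) powr p) \<partial>lborel) \<le> ennreal (W powr p)"
  proof (rule minkowski_integral_weighted[where M=lborel and N=lborel and S=S and G=G' and w=w'])
    show "G' \<in> borel_measurable (lborel \<Otimes>\<^sub>M lborel)"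
      using G'm by (simp cong: measurable_cong_sets sets_pair_measure_cong)
    show "(\<integral>\<^sup>+t\<in>S. ennreal (w' t) \<partial>lborel) \<le> ennreal W"
      using W(2) by (rule order_trans[rotated]) (intro nn_integral_mono, auto simp: w'_def indicator_def)
    show "(\<integral>\<^sup>+y. ennreal (G' (t, y) powr p) \<partial>lborel) \<le> ennreal (w' t powr p)" if "t \<in> S" for t
    proof -
      have "(\<integral>\<^sup>+y. ennreal (G' (t, y) powr p) \<partial>lborel) = (\<integral>\<^sup>+y\<in>?I. ennreal (G t y powr p) \<partial>lborel)"
        using p that by (intro nn_integral_cong) (auto simp: indicator_def G'_def)
      also have "\<dots> \<le> ennreal (w t powr p)"
        using Gw[OF that] w0[OF that] p by (subst (asm) circle_norm_le_iff) auto
      finally show ?thesis using that by (simp add: w'_def)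
    qed
    show "ennreal (indicator ?I y * v y) \<le> (\<integral>\<^sup>+t\<in>S. ennreal (G' (t, y)) \<partial>lborel)" for y
    proof (cases "y \<in> ?I")
      case True
      then have "ennreal (indicator ?I y * v y) \<le> (\<integral>\<^sup>+t\<in>S. ennreal (G t y) \<partial>lborel)"
        using v[of y] by simp
      also have "\<dots> = (\<integral>\<^sup>+t\<in>S. ennreal (G' (t, y)) \<partial>lborel)"
        using True by (intro nn_integral_cong) (auto simp: indicator_def G'_def)
      finally show ?thesis .
    qed simp
    show "0 \<le> indicator ?I y * v y" for y
      using v[of y] by (auto simp: indicator_def)
  qed (use p S w'm w0 G0 W in \<open>auto simp: w'_def G'_def indicator_def lborel.sigma_finite_measure_axioms\<close>)
  then show ?thesis
    using p W by (simp add: circle_norm_le_iff eqI)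
qed

section \<open>Rotations and intervals\<close>

lemma nn_integral_periodic_shift:
  fixes f :: "real \<Rightarrow> ennreal"
  assumes f[measurable]: "f \<in> borel_measurable borel" and per: "\<And>x. f (x + 2 * pi) = f x"
  shows "(\<integral>\<^sup>+x\<in>{0..2*pi}. f (x + a) \<partial>lborel) = (\<integral>\<^sup>+x\<in>{0..2*pi}. f x \<partial>lborel)"
proof -
  have perz: "f (x + 2 * pi * of_int k) = f x" for x k
  proof -
    have n: "f (x + 2 * pi * of_nat m) = f x" for x m
    proof (induction m)
      case (Suc m)
      have "f (x + 2 * pi * of_nat (Suc m)) = f ((x + 2 * pi * of_nat m) + 2 * pi)"
        by (simp add: algebra_simps)
      then show ?case using per Suc by simp
    qed simp
    show ?thesis
    proof (cases k rule: int_cases2)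
      case (nonneg m) then show ?thesis using n[of x m] by simp
    next
      case (nonpos m) then show ?thesis using n[of "x - 2 * pi * of_nat m" m] by simp
    qed
  qed
  have closed: "(\<integral>\<^sup>+x\<in>{0..2*pi}. g x \<partial>lborel) = (\<integral>\<^sup>+x\<in>{0..<2*pi}. g x \<partial>lborel)" for g :: "real \<Rightarrow> ennreal"
  proof (rule nn_integral_cong_AE, rule eventually_mono[OF AE_lborel_singleton[of "2*pi"]])
    fix x :: real assume "x \<noteq> 2 * pi"
    then have "x \<in> {0..2*pi} \<longleftrightarrow> x \<in> {0..<2*pi}"
      unfolding atLeastAtMost_iff atLeastLessThan_iff by linarith
    then show "g x * indicator {0..2*pi} x = g x * indicator {0..<2*pi} x"
      unfolding indicator_def by (simp only:)
  qed
  define k where "k = \<lfloor>a / (2 * pi)\<rfloor>"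
  define b where "b = a - 2 * pi * of_int k"
  have "of_int k \<le> a / (2*pi)" "a / (2*pi) < of_int k + 1" unfolding k_def by linarith+
  then have "of_int k * (2*pi) \<le> a" "a < (of_int k + 1) * (2*pi)"
    by (simp_all only: pos_le_divide_eq pos_divide_less_eq pi_gt_zero zero_less_mult_iff zero_less_numeral simp_thms)
  then have b: "0 \<le> b" "b < 2 * pi"
    unfolding b_def mult.commute[of "2 * pi"] by (simp_all add: distrib_right)
  have fb: "f (x + a) = f (x + b)" for x
  proof -
    have "x + a = x + b + 2 * pi * of_int k" by (simp add: b_def)
    then show ?thesis using perz[of "x + b" k] by (simp only:)
  qed
  have "(\<integral>\<^sup>+x\<in>{0..<2*pi}. f (x + a) \<partial>lborel) = (\<integral>\<^sup>+x. f (b + 1 * x) * indicator {b..<b+2*pi} (b + 1 * x) \<partial>lborel)"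
    by (intro nn_integral_cong) (auto simp: fb indicator_def add.commute)
  also have "\<dots> = (\<integral>\<^sup>+x. f x * indicator {b..<b+2*pi} x \<partial>lborel)"
    by (subst nn_integral_real_affine[of "\<lambda>x. f x * indicator {b..<b+2*pi} x" 1 b]) auto
  also have "\<dots> = (\<integral>\<^sup>+x. f x * indicator {b..<2*pi} x + f x * indicator {2*pi..<b+2*pi} x \<partial>lborel)"
    using b by (intro nn_integral_cong) (auto simp: indicator_def)
  also have "\<dots> = (\<integral>\<^sup>+x\<in>{b..<2*pi}. f x \<partial>lborel) + (\<integral>\<^sup>+x\<in>{2*pi..<b+2*pi}. f x \<partial>lborel)"
    by (rule nn_integral_add) auto
  also have "(\<integral>\<^sup>+x\<in>{2*pi..<b+2*pi}. f x \<partial>lborel) = (\<integral>\<^sup>+x. f (2*pi + 1 * x) * indicator {2*pi..<b+2*pi} (2*pi + 1 * x) \<partial>lborel)"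
    by (subst nn_integral_real_affine[of "\<lambda>x. f x * indicator {2*pi..<b+2*pi} x" 1 "2*pi"]) auto
  also have "\<dots> = (\<integral>\<^sup>+x\<in>{0..<b}. f x \<partial>lborel)"
    using per by (intro nn_integral_cong) (auto simp: indicator_def add.commute)
  also have "(\<integral>\<^sup>+x\<in>{b..<2*pi}. f x \<partial>lborel) + (\<integral>\<^sup>+x\<in>{0..<b}. f x \<partial>lborel)
      = (\<integral>\<^sup>+x. f x * indicator {b..<2*pi} x + f x * indicator {0..<b} x \<partial>lborel)"
    by (rule nn_integral_add[symmetric]) auto
  also have "\<dots> = (\<integral>\<^sup>+x\<in>{0..<2*pi}. f x \<partial>lborel)"
    using b by (intro nn_integral_cong) (auto simp: indicator_def)
  finally show ?thesis by (simp add: closed)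
qed

lemma cis_add_2pi: "cis (x + 2 * pi) = cis x"
  by (simp add: complex_eq_iff)

lemma circle_norm_rotate:
  assumes "(\<lambda>\<theta>. g (cis \<theta>)) \<in> borel_measurable borel" "0 < p" "0 \<le> c"
  shows "circle_norm p (\<lambda>\<theta>. g (cis \<psi> * cis \<theta>)) \<le> ennreal c \<longleftrightarrow> circle_norm p (\<lambda>\<theta>. g (cis \<theta>)) \<le> ennreal c"
proof -
  have m: "(\<lambda>\<theta>. ennreal (g (cis \<theta>) powr p)) \<in> borel_measurable borel"
    using assms(1) by measurable
  have "(\<integral>\<^sup>+\<theta>\<in>{0..2*pi}. ennreal (g (cis \<psi> * cis \<theta>) powr p) \<partial>lborel)
      = (\<integral>\<^sup>+\<theta>\<in>{0..2*pi}. ennreal (g (cis (\<theta> + \<psi>)) powr p) \<partial>lborel)"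
    by (simp only: cis_mult add.commute)
  also have "\<dots> = (\<integral>\<^sup>+\<theta>\<in>{0..2*pi}. ennreal (g (cis \<theta>) powr p) \<partial>lborel)"
    by (rule nn_integral_periodic_shift[OF m, of \<psi>]) (simp only: cis_add_2pi)
  finally show ?thesis
    using assms(2,3) by (simp only: circle_norm_le_iff)
qed

lemma nn_integral_continuous_interval:
  fixes g :: "real \<Rightarrow> real"
  assumes g: "continuous_on {a..b} g" and g0: "\<And>t. t \<in> {a..b} \<Longrightarrow> 0 \<le> g t"
  shows "(\<integral>\<^sup>+t\<in>{a..b}. ennreal (g t) \<partial>lborel) = ennreal (integral {a..b} g)"
proof -
  let ?g = "\<lambda>t. indicator {a..b} t *\<^sub>R g t"
  have "?g \<in> borel_measurable borel"
    by (rule borel_measurable_continuous_on_indicator[OF _ g]) simp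
  moreover have "?g = (\<lambda>t. if t \<in> {a..b} then g t else 0)" by (auto simp: indicator_def)
  moreover have "((\<lambda>t. if t \<in> {a..b} then g t else 0) has_integral integral {a..b} g) UNIV"
    unfolding has_integral_restrict_UNIV using integrable_continuous_interval[OF g] by (rule integrable_integral)
  ultimately have "(\<integral>\<^sup>+x. ennreal (?g x) \<partial>lborel) = ennreal (integral {a..b} g)"
    using g0 by (intro nn_integral_has_integral_lborel) (auto simp: indicator_def)
  moreover have "(\<integral>\<^sup>+x. ennreal (?g x) \<partial>lborel) = (\<integral>\<^sup>+t\<in>{a..b}. ennreal (g t) \<partial>lborel)"
    by (intro nn_integral_cong) (auto simp: indicator_def)
  ultimately show ?thesis by simp
qed

lemma nn_integral_open_interval:
  fixes g :: "real \<Rightarrow> ennreal"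
  shows "(\<integral>\<^sup>+t\<in>{a<..<b}. g t \<partial>lborel) = (\<integral>\<^sup>+t\<in>{a..b}. g t \<partial>lborel)"
proof (rule nn_integral_cong_AE)
  show "AE t in lborel. g t * indicator {a<..<b} t = g t * indicator {a..b} t"
    using AE_lborel_singleton[of a] AE_lborel_singleton[of b]
  proof eventually_elim
    case (elim t)
    then have "t \<in> {a<..<b} \<longleftrightarrow> t \<in> {a..b}" by auto
    then show ?case unfolding indicator_def by (simp only:)
  qed
qed

section \<open>Holomorphic functions on circles\<close>

text \<open>
  The Fourier coefficients of a holomorphic function on a circle with indices \<open>0\<close>, \<open>1\<close> and \<open>-1\<close>: the
  value at the centre, the derivative there, and \<open>0\<close>. The vanishing of the last one is what separates a
  holomorphic function from the conjugate of another.
\<close>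

lemma circle_has_integral:
  assumes F: "continuous_on (cball z \<rho>) F" "F holomorphic_on ball z \<rho>" and \<rho>: "0 < \<rho>"
  shows "((\<lambda>\<tau>. F (z + of_real \<rho> * cis \<tau>)) has_integral of_real (2 * pi) * F z) {0..2*pi}"
    and "((\<lambda>\<tau>. F (z + of_real \<rho> * cis \<tau>) * cis (- \<tau>)) has_integral of_real (2 * pi * \<rho>) * deriv F z) {0..2*pi}"
    and "((\<lambda>\<tau>. F (z + of_real \<rho> * cis \<tau>) * cis \<tau>) has_integral 0) {0..2*pi}"
proof -
  have cp: "circlepath z \<rho> = part_circlepath z \<rho> 0 (2 * pi)"
    by (simp add: circlepath_def)
  have iff: "(f has_contour_integral I) (circlepath z \<rho>) \<longleftrightarrow>
      ((\<lambda>\<tau>. f (z + of_real \<rho> * cis \<tau>) * of_real \<rho> * \<i> * cis \<tau>) has_integral I) {0..2*pi}" for f I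
    unfolding cp by (subst has_contour_integral_part_circlepath_iff) auto
  have zb: "z \<in> ball z \<rho>" using \<rho> by simp
  have "((\<lambda>u. F u / (u - z)) has_contour_integral (2 * of_real pi * \<i> * F z)) (circlepath z \<rho>)"
    by (rule Cauchy_integral_circlepath[OF F]) (use \<rho> in simp)
  then have "((\<lambda>\<tau>. \<i> * F (z + of_real \<rho> * cis \<tau>)) has_integral \<i> * (of_real (2 * pi) * F z)) {0..2*pi}"
    unfolding iff using \<rho> by (simp add: algebra_simps)
  from has_integral_mult_right[OF this, of "-\<i>"]
  show "((\<lambda>\<tau>. F (z + of_real \<rho> * cis \<tau>)) has_integral of_real (2 * pi) * F z) {0..2*pi}"
    by (simp add: mult.assoc[symmetric])
  have "((\<lambda>u. F u / (u - z) ^ (Suc 1)) has_contour_integral ((2 * pi * \<i>) / (fact 1) * (deriv ^^ 1) F z)) (circlepath z \<rho>)"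
    by (rule Cauchy_has_contour_integral_higher_derivative_circlepath[OF F zb])
  moreover have "F u / (of_real \<rho> * cis \<tau>) ^ Suc 1 * of_real \<rho> * \<i> * cis \<tau> = \<i> / of_real \<rho> * (F u * cis (- \<tau>))" for u \<tau>
    using \<rho> by (simp add: power2_eq_square divide_simps cis_neq_zero) (simp add: cis_mult flip: mult.assoc)
  ultimately have "((\<lambda>\<tau>. \<i> / of_real \<rho> * (F (z + of_real \<rho> * cis \<tau>) * cis (- \<tau>))) has_integral 2 * pi * \<i> * deriv F z) {0..2*pi}"
    unfolding iff by simp
  from has_integral_mult_right[OF this, of "-\<i> * of_real \<rho>"]
  show "((\<lambda>\<tau>. F (z + of_real \<rho> * cis \<tau>) * cis (- \<tau>)) has_integral of_real (2 * pi * \<rho>) * deriv F z) {0..2*pi}"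
  proof (elim has_integral_eq_rhs[OF has_integral_eq, rotated])
    show "- \<i> * of_real \<rho> * (\<i> / of_real \<rho> * x) = x" for x :: complex
      using \<rho> by simp
    show "of_real (2 * pi * \<rho>) * deriv F z = - \<i> * of_real \<rho> * (2 * pi * \<i> * deriv F z)"
      by simp
  qed
  have "(F has_contour_integral 0) (circlepath z \<rho>)"
    by (rule Cauchy_theorem_disc[of "{}", OF _ F(1)])
       (use F(2) \<rho> in \<open>auto simp: holomorphic_on_imp_differentiable_at\<close>)
  then have "((\<lambda>\<tau>. \<i> * of_real \<rho> * (F (z + of_real \<rho> * cis \<tau>) * cis \<tau>)) has_integral 0) {0..2*pi}"
    unfolding iff by (simp add: mult_ac)
  from has_integral_mult_right[OF this, of "-\<i> / of_real \<rho>"]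
  show "((\<lambda>\<tau>. F (z + of_real \<rho> * cis \<tau>) * cis \<tau>) has_integral 0) {0..2*pi}"
    using \<rho> by (simp add: mult.assoc[symmetric])
qed

lemma cis_has_integral_0: "((\<lambda>\<tau>. cis \<tau>) has_integral 0) {0..2*pi}"
  using circle_has_integral(3)[of 0 1 "\<lambda>_. 1"] by simp

lemma cnj_has_integral: "(f has_integral I) S \<Longrightarrow> ((\<lambda>x. cnj (f x)) has_integral cnj I) S"
  using has_integral_linear[OF _ bounded_linear_cnj, of f I S] by (simp add: o_def)

text \<open>
  The conjugate of \<open>G\<close> has no Fourier coefficient of index \<open>1\<close>, nor has a constant, so that the
  coefficient of \<open>F+cnj G-c\<close> is \<open>\<rho> F'(z)\<close>.
\<close>

lemma harmonic_deriv_bound: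
  assumes F: "continuous_on (cball z \<rho>) F" "F holomorphic_on ball z \<rho>"
    and G: "continuous_on (cball z \<rho>) G" "G holomorphic_on ball z \<rho>"
    and \<rho>: "0 < \<rho>"
    and E: "\<And>w. w \<in> sphere z \<rho> \<Longrightarrow> cmod (F w + cnj (G w) - c) \<le> E"
  shows "\<rho> * cmod (deriv F z) \<le> E"
proof -
  let ?w = "\<lambda>\<tau>. z + of_real \<rho> * cis \<tau>"
  have "((\<lambda>\<tau>. F (?w \<tau>) * cis (- \<tau>) + cnj (G (?w \<tau>) * cis \<tau>) - c * cnj (cis \<tau>)) has_integral
      of_real (2 * pi * \<rho>) * deriv F z + cnj 0 - c * cnj 0) {0..2*pi}"
    by (intro has_integral_add has_integral_diff circle_has_integral(2)[OF F \<rho>] cnj_has_integral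
         circle_has_integral(3)[OF G \<rho>] has_integral_mult_right cis_has_integral_0)
  then have I: "((\<lambda>\<tau>. (F (?w \<tau>) + cnj (G (?w \<tau>)) - c) * cis (- \<tau>)) has_integral
      of_real (2 * pi * \<rho>) * deriv F z) (cbox 0 (2*pi))"
    by (simp add: algebra_simps cis_cnj)
  have "cmod (of_real (2 * pi * \<rho>) * deriv F z) \<le> E * Henstock_Kurzweil_Integration.content (cbox 0 (2 * pi))"
  proof (rule has_integral_bound[OF _ I])
    have "z + of_real \<rho> \<in> sphere z \<rho>" using \<rho> by (simp add: dist_norm)
    from E[OF this] show "0 \<le> E" using norm_ge_zero order_trans by blast
    show "cmod ((F (?w \<tau>) + cnj (G (?w \<tau>)) - c) * cis (- \<tau>)) \<le> E" for \<tau>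
      using E[of "?w \<tau>"] \<rho> by (simp add: norm_mult dist_norm)
  qed
  then show ?thesis using \<rho> by (simp add: norm_mult)
qed

text \<open>
  Rotate so that \<open>f(z)\<ge> 0\<close>. Then \<open>H = |f(z)|+E-cf\<close> has nonnegative real part on the circle and
  \<open>H(z)=E\<close>. Adding the vanishing coefficient of index \<open>-1\<close>, conjugated, to the one of index \<open>1\<close> shows
  \<open>\<rho> H'(z) = 1/(2\<pi>) \<integral> 2 Re H e^(-i\<tau>)d\<tau>\<close>, whose modulus is at most twice the
  mean of \<open>Re H\<close>, that is \<open>2E\<close>.
\<close>

lemma deriv_bound_of_modulus_growth:
  assumes f: "continuous_on (cball z \<rho>) f" "f holomorphic_on ball z \<rho>" and \<rho>: "0 < \<rho>"
    and E: "\<And>w. w \<in> sphere z \<rho> \<Longrightarrow> cmod (f w) \<le> cmod (f z) + E"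
  shows "\<rho> * cmod (deriv f z) \<le> 2 * E"
proof -
  let ?w = "\<lambda>\<tau>. z + of_real \<rho> * cis \<tau>"
  obtain c where c: "cmod c = 1" "c * f z = of_real (cmod (f z))"
  proof (cases "f z = 0")
    case False
    then show ?thesis
      by (intro that[of "cnj (f z) / of_real (cmod (f z))"])
         (simp_all add: norm_divide complex_norm_square[symmetric] power2_eq_square mult.commute flip: complex_norm_square)
  qed (use that[of 1] in simp)
  define H where "H = (\<lambda>w. of_real (cmod (f z) + E) - c * f w)"
  have H: "continuous_on (cball z \<rho>) H" "H holomorphic_on ball z \<rho>"
    unfolding H_def using f by (auto intro!: continuous_intros holomorphic_intros)
  have zb: "z \<in> ball z \<rho>" using \<rho> by simp
  have fd: "f field_differentiable at z"
    using f(2) zb holomorphic_on_imp_differentiable_at by blast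
  have dH: "deriv H z = - c * deriv f z"
    unfolding H_def using fd by (subst deriv_diff) (auto intro!: derivative_intros field_differentiable_mult)
  have Hz: "H z = of_real E" using c by (simp add: H_def)
  have Re0: "0 \<le> Re (H (?w \<tau>))" for \<tau>
  proof -
    have "Re (c * f (?w \<tau>)) \<le> cmod (c * f (?w \<tau>))" by (rule complex_Re_le_cmod)
    also have "\<dots> \<le> cmod (f z) + E"
      using E[of "?w \<tau>"] c \<rho> by (simp add: norm_mult dist_norm)
    finally show ?thesis by (simp add: H_def)
  qed
  have "((\<lambda>\<tau>. H (?w \<tau>) * cis (- \<tau>) + cnj (H (?w \<tau>) * cis \<tau>)) has_integral
      of_real (2 * pi * \<rho>) * deriv H z + cnj 0) {0..2*pi}"
    by (intro has_integral_add circle_has_integral(2)[OF H \<rho>] cnj_has_integral circle_has_integral(3)[OF H \<rho>])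
  then have I1: "((\<lambda>\<tau>. of_real (2 * Re (H (?w \<tau>))) * cis (- \<tau>)) has_integral
      of_real (2 * pi * \<rho>) * deriv H z) {0..2*pi}"
    unfolding complex_add_cnj[symmetric] by (simp add: cis_cnj distrib_right)
  have I2: "((\<lambda>\<tau>. 2 * Re (H (?w \<tau>))) has_integral 2 * (2 * pi * E)) {0..2*pi}"
    using has_integral_mult_right[OF has_integral_linear[OF circle_has_integral(1)[OF H \<rho>] bounded_linear_Re], of 2]
    by (simp add: o_def Hz)
  have "cmod (integral {0..2*pi} (\<lambda>\<tau>. of_real (2 * Re (H (?w \<tau>))) * cis (- \<tau>)))
      \<le> integral {0..2*pi} (\<lambda>\<tau>. 2 * Re (H (?w \<tau>)))"
    using I1 I2 Re0 by (intro integral_norm_bound_integral) (auto simp: norm_mult)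
  then have "cmod (of_real (2 * pi * \<rho>) * deriv H z) \<le> 2 * (2 * pi * E)"
    unfolding integral_unique[OF I1] integral_unique[OF I2] .
  then show ?thesis using \<rho> by (simp add: dH norm_mult c)
qed

section \<open>The Poisson integral\<close>

definition poisson_kernel :: "complex \<Rightarrow> real \<Rightarrow> real" where
  "poisson_kernel z \<tau> = (1 - (cmod z)\<^sup>2) / (cmod (cis \<tau> - z))\<^sup>2"

lemma cis_neq_ball: "cmod z < 1 \<Longrightarrow> cis \<tau> \<noteq> z"
  by (metis less_irrefl norm_cis)

lemma poisson_kernel_nonneg: "cmod z < 1 \<Longrightarrow> 0 \<le> poisson_kernel z \<tau>"
  by (auto simp: poisson_kernel_def abs_square_le_1 intro!: divide_nonneg_nonneg)

lemma poisson_kernel_pos: "cmod z < 1 \<Longrightarrow> 0 < poisson_kernel z \<tau>"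
  using cis_neq_ball[of z \<tau>]
  by (auto simp: poisson_kernel_def abs_square_less_1 intro!: divide_pos_pos)

lemma continuous_on_poisson_kernel [continuous_intros]:
  assumes "cmod z < 1"
  shows "continuous_on A (poisson_kernel z)"
  unfolding poisson_kernel_def using cis_neq_ball[OF assms]
  by (auto intro!: continuous_intros)

text \<open>
  Cauchy's formula for \<open>g(\<zeta>) = f(\<zeta>)(1-|z|^2)/(1-cnj z \<zeta>)\<close>, which equals \<open>f\<close> at \<open>z\<close>: on the
  unit circle \<open>1-cnj z \<zeta> = \<zeta> cnj (\<zeta>-z)\<close>, and the Cauchy kernel becomes the Poisson
  kernel.
\<close>

lemma poisson_formula:
  assumes f: "continuous_on (cball 0 1) f" "f holomorphic_on ball 0 1" and z: "cmod z < 1"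
  shows "((\<lambda>\<tau>. poisson_kernel z \<tau> *\<^sub>R f (cis \<tau>)) has_integral of_real (2 * pi) * f z) {0..2*pi}"
proof -
  define g where "g = (\<lambda>\<zeta>. of_real (1 - (cmod z)\<^sup>2) * f \<zeta> / (1 - cnj z * \<zeta>))"
  have nz: "1 - cnj z * \<zeta> \<noteq> 0" if "\<zeta> \<in> cball 0 1" for \<zeta>
  proof
    assume "1 - cnj z * \<zeta> = 0"
    then have "cmod (cnj z * \<zeta>) = 1" by (metis eq_iff_diff_eq_0 norm_one)
    moreover have "cmod z * cmod \<zeta> \<le> cmod z * 1" using that by (intro mult_left_mono) auto
    ultimately show False using z by (simp add: norm_mult)
  qed
  have g: "continuous_on (cball 0 1) g" "g holomorphic_on ball 0 1"
    unfolding g_def using f nz by (auto intro!: continuous_intros holomorphic_intros)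
  have gz: "g z = f z"
  proof -
    have "1 - cnj z * z = of_real (1 - (cmod z)\<^sup>2)"
      by (simp add: mult.commute flip: complex_norm_square)
    then show ?thesis using nz[of z] z by (simp add: g_def)
  qed
  have "((\<lambda>u. g u / (u - z)) has_contour_integral (2 * of_real pi * \<i> * g z)) (circlepath 0 1)"
    by (rule Cauchy_integral_circlepath[OF g]) (use z in simp)
  then have "((\<lambda>\<tau>. \<i> * (g (cis \<tau>) * cis \<tau> / (cis \<tau> - z))) has_integral 2 * of_real pi * \<i> * f z) {0..2*pi}"
    unfolding circlepath_def gz by (subst (asm) has_contour_integral_part_circlepath_iff) (auto simp: mult_ac)
  from has_integral_mult_right[OF this, of "-\<i>"]
  have I: "((\<lambda>\<tau>. g (cis \<tau>) * cis \<tau> / (cis \<tau> - z)) has_integral of_real (2 * pi) * f z) {0..2*pi}"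
  proof (elim has_integral_eq_rhs[OF has_integral_eq, rotated])
    show "- \<i> * (\<i> * x) = x" for x :: complex by simp
    show "of_real (2 * pi) * f z = - \<i> * (2 * of_real pi * \<i> * f z)" by simp
  qed
  have "g (cis \<tau>) * cis \<tau> / (cis \<tau> - z) = poisson_kernel z \<tau> *\<^sub>R f (cis \<tau>)" for \<tau>
  proof -
    have ne: "cis \<tau> - z \<noteq> 0" using cis_neq_ball[OF z, of \<tau>] by simp
    have "1 - cnj z * cis \<tau> = cnj (cis \<tau> - z) * cis \<tau>"
      by (simp add: algebra_simps cis_cnj cis_mult)
    then have *: "(1 - cnj z * cis \<tau>) * (cis \<tau> - z) = cis \<tau> * of_real ((cmod (cis \<tau> - z))\<^sup>2)"
      by (simp only: complex_norm_square mult_ac)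
    have "g (cis \<tau>) * cis \<tau> / (cis \<tau> - z) =
       of_real (1 - (cmod z)\<^sup>2) * f (cis \<tau>) * cis \<tau> / ((1 - cnj z * cis \<tau>) * (cis \<tau> - z))"
      by (simp add: g_def)
    also have "\<dots> = of_real (1 - (cmod z)\<^sup>2) * f (cis \<tau>) / of_real ((cmod (cis \<tau> - z))\<^sup>2)"
      unfolding * by (simp add: cis_neq_zero)
    finally show ?thesis by (simp add: poisson_kernel_def scaleR_conv_of_real)
  qed
  then show ?thesis using I by simp
qed

lemma poisson_kernel_has_integral:
  "cmod z < 1 \<Longrightarrow> (poisson_kernel z has_integral 2 * pi) {0..2*pi}"
  using has_integral_linear[OF poisson_formula[of "\<lambda>_. 1" z] bounded_linear_Re]
  by (simp add: o_def)

lemma poisson_integral_eq: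
  fixes U :: "complex \<Rightarrow> real"
  assumes "continuous_on UNIV (\<lambda>\<tau>. U (cis \<tau>))" "cmod z < 1"
  shows "poisson_integral U z = integral {0..2*pi} (\<lambda>\<tau>. poisson_kernel z \<tau> * U (cis \<tau>)) / (2 * pi)"
proof -
  have "continuous_on {0..2*pi} (\<lambda>\<tau>. poisson_kernel z \<tau> * U (cis \<tau>))"
    using assms by (intro continuous_intros) (auto elim: continuous_on_subset)
  then have "integrable (lebesgue_on {0..2*pi}) (\<lambda>\<tau>. poisson_kernel z \<tau> * U (cis \<tau>))"
    by (rule continuous_imp_integrable_real)
  from lebesgue_integral_eq_integral[OF this] show ?thesis
    by (simp add: poisson_integral_def poisson_kernel_def)
qed

text \<open>
  The mean distance of the boundary values from \<open>c\<close> with respect to harmonic measure at \<open>z\<close>. It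
  bounds both the distance from \<open>P[U](z)\<close> to \<open>c\<close> and the variation of \<open>P[U]\<close> near \<open>z\<close>.
\<close>

definition poisson_osc :: "(complex \<Rightarrow> real) \<Rightarrow> complex \<Rightarrow> real \<Rightarrow> real" where
  "poisson_osc U z c = integral {0..2*pi} (\<lambda>\<tau>. poisson_kernel z \<tau> * \<bar>U (cis \<tau>) - c\<bar>) / (2 * pi)"

lemma poisson_osc_bound:
  fixes U :: "complex \<Rightarrow> real"
  assumes U: "continuous_on UNIV (\<lambda>\<tau>. U (cis \<tau>))" and z: "cmod z < 1"
    and w: "cmod w < 1" and A: "\<And>\<tau>. poisson_kernel w \<tau> \<le> A * poisson_kernel z \<tau>"
  shows "\<bar>poisson_integral U w - c\<bar> \<le> A * poisson_osc U z c"
proof -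
  have U': "continuous_on {0..2*pi} (\<lambda>\<tau>. U (cis \<tau>))" using U by (rule continuous_on_subset) simp
  have c1: "continuous_on {0..2*pi} (\<lambda>\<tau>. poisson_kernel w \<tau> * U (cis \<tau>))"
    and c2: "continuous_on {0..2*pi} (\<lambda>\<tau>. poisson_kernel w \<tau> * (U (cis \<tau>) - c))"
    and c3: "continuous_on {0..2*pi} (\<lambda>\<tau>. A * (poisson_kernel z \<tau> * \<bar>U (cis \<tau>) - c\<bar>))"
    using U' z w by (auto intro!: continuous_intros)
  have "((\<lambda>\<tau>. poisson_kernel w \<tau> * U (cis \<tau>) - poisson_kernel w \<tau> * c) has_integral
      integral {0..2*pi} (\<lambda>\<tau>. poisson_kernel w \<tau> * U (cis \<tau>)) - 2 * pi * c) {0..2*pi}"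
    by (intro has_integral_diff integrable_integral integrable_continuous_interval c1
         has_integral_mult_left poisson_kernel_has_integral w)
  then have *: "integral {0..2*pi} (\<lambda>\<tau>. poisson_kernel w \<tau> * (U (cis \<tau>) - c)) =
      integral {0..2*pi} (\<lambda>\<tau>. poisson_kernel w \<tau> * U (cis \<tau>)) - 2 * pi * c"
    by (simp add: right_diff_distrib integral_unique)
  have "\<bar>poisson_integral U w - c\<bar> = \<bar>integral {0..2*pi} (\<lambda>\<tau>. poisson_kernel w \<tau> * (U (cis \<tau>) - c))\<bar> / (2 * pi)"
  proof -
    have "X / (2 * pi) - c = (X - 2 * pi * c) / (2 * pi)" for X by (simp add: field_simps)
    then show ?thesis
      unfolding poisson_integral_eq[OF U w] using * by simp
  qed
  also have "\<bar>integral {0..2*pi} (\<lambda>\<tau>. poisson_kernel w \<tau> * (U (cis \<tau>) - c))\<bar> \<le>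
      integral {0..2*pi} (\<lambda>\<tau>. A * (poisson_kernel z \<tau> * \<bar>U (cis \<tau>) - c\<bar>))"
    unfolding real_norm_def[symmetric]
  proof (rule integral_norm_bound_integral)
    fix \<tau>
    have "norm (poisson_kernel w \<tau> * (U (cis \<tau>) - c)) = poisson_kernel w \<tau> * \<bar>U (cis \<tau>) - c\<bar>"
      using poisson_kernel_nonneg[OF w, of \<tau>] by (simp add: abs_mult)
    also have "\<dots> \<le> A * poisson_kernel z \<tau> * \<bar>U (cis \<tau>) - c\<bar>"
      by (intro mult_right_mono A) auto
    finally show "norm (poisson_kernel w \<tau> * (U (cis \<tau>) - c)) \<le> A * (poisson_kernel z \<tau> * norm (U (cis \<tau>) - c))"
      by (simp add: mult.assoc)
  qed (use c2 c3 in \<open>auto intro: integrable_continuous_interval\<close>)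
  finally show ?thesis by (simp add: poisson_osc_def divide_right_mono)
qed

text \<open>
  On the disk about \<open>z\<close> that reaches half way to the boundary the denominator loses at most a factor
  \<open>4\<close> and the numerator gains at most a factor \<open>3\<close>.
\<close>

lemma poisson_kernel_harnack:
  assumes z: "cmod z < 1" and w: "cmod (w - z) \<le> (1 - cmod z) / 2"
  shows "poisson_kernel w \<tau> \<le> 12 * poisson_kernel z \<tau>"
proof -
  have wz: "cmod w \<le> cmod z + cmod (w - z)" by (metis add.commute diff_add_cancel norm_triangle_ineq)
  have zw: "cmod z \<le> cmod w + cmod (w - z)" by (metis add.commute norm_minus_commute diff_add_cancel norm_triangle_ineq)
  have w1: "cmod w < 1" using wz w z by argo
  have a: "1 - cmod z \<le> cmod (cis \<tau> - z)"
    using norm_triangle_ineq2[of "cis \<tau>" z] by simp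
  have "cmod (cis \<tau> - z) \<le> cmod (cis \<tau> - w) + cmod (w - z)"
    using norm_triangle_ineq[of "cis \<tau> - w" "w - z"] by simp
  then have b: "cmod (cis \<tau> - z) / 2 \<le> cmod (cis \<tau> - w)" using a w by argo
  have pz: "0 < cmod (cis \<tau> - z)" using a z by linarith
  have "1 - (cmod w)\<^sup>2 = (1 - cmod w) * (1 + cmod w)" by (simp add: power2_eq_square algebra_simps)
  also have "\<dots> \<le> (3/2 * (1 - cmod z)) * 2"
    using zw w w1 by (intro mult_mono) auto
  also have "\<dots> \<le> 3 * ((1 - cmod z) * (1 + cmod z))"
  proof -
    have "(1 - cmod z) * 1 \<le> (1 - cmod z) * (1 + cmod z)"
      using z by (intro mult_left_mono) auto
    then show ?thesis by linarith
  qed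
  also have "\<dots> = 3 * (1 - (cmod z)\<^sup>2)" by (simp add: power2_eq_square algebra_simps)
  finally have num: "1 - (cmod w)\<^sup>2 \<le> 3 * (1 - (cmod z)\<^sup>2)" .
  have den: "(cmod (cis \<tau> - z) / 2)\<^sup>2 \<le> (cmod (cis \<tau> - w))\<^sup>2"
    by (intro power_mono b) auto
  have "poisson_kernel w \<tau> \<le> 3 * (1 - (cmod z)\<^sup>2) / (cmod (cis \<tau> - z) / 2)\<^sup>2"
    unfolding poisson_kernel_def using num den pz w1 z
    by (intro frac_le) (auto simp: abs_square_le_1)
  then show ?thesis by (simp add: poisson_kernel_def power_divide)
qed

text \<open>
  By concavity the sine lies above its chord \<open>2x/\<pi>\<close>, and \<open>2/\<pi> \<ge> 1/3\<close>.
\<close>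

lemma sin_ge_third:
  fixes x :: real
  assumes "0 \<le> x" "x \<le> pi / 2"
  shows "x / 3 \<le> sin x"
proof -
  have "convex_on {0..pi/2} (\<lambda>x. - sin x)"
  proof (rule convex_on_realI[where f' = "\<lambda>x. - cos x"])
    show "- cos x \<le> - cos y" if "x \<in> {0..pi/2}" "y \<in> {0..pi/2}" "x \<le> y" for x y
      using that by (auto intro: cos_monotone_0_pi_le)
  qed (auto intro!: derivative_eq_intros)
  then have "- sin ((1 - x / (pi/2)) *\<^sub>R 0 + (x / (pi/2)) *\<^sub>R (pi/2)) \<le>
      (1 - x / (pi/2)) * - sin 0 + (x / (pi/2)) * - sin (pi/2)"
    using assms by (intro convex_onD) auto
  then have "x / (pi/2) \<le> sin x" using pi_gt_zero by simp
  moreover have "x / 3 \<le> x / (pi/2)"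
    using assms pi_less_4 by (intro divide_left_mono) auto
  ultimately show ?thesis by linarith
qed

text \<open>
  With \<open>\<delta>=1-r\<close> and \<open>m\<close> the distance of \<open>\<tau>\<close> from \<open>0\<close> modulo \<open>2\<pi>\<close>, one has
  \<open>|e^(i\<tau>)-r| \<ge> (\<delta>+m)/12\<close>, hence the integrand is at most
  \<open>576 \<delta>(\<delta>+m)^(\<beta>-2)\<close>. The integral of the last expression is \<open>O(\<delta>^\<beta>)\<close> exactly because
  \<open>\<beta><1\<close>; for \<open>\<beta>=1\<close> a logarithm appears.
\<close>

lemma poisson_weight_integral_le:
  assumes \<beta>: "0 < \<beta>" "\<beta> < 1" and r: "0 < r" "r < 1"
  shows "integral {0..2*pi} (\<lambda>\<tau>. poisson_kernel (of_real r) \<tau> * cmod (cis \<tau> - 1) powr \<beta>)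
    \<le> 1152 / (1 - \<beta>) * (1 - r) powr \<beta>"
proof -
  define \<delta> where "\<delta> = 1 - r"
  have \<delta>: "0 < \<delta>" "\<delta> < 1" using r by (auto simp: \<delta>_def)
  \<comment> \<open>The two functions dominate \<open>(\<delta>+m)^(\<beta>-2)\<close> on the two halves of the circle and have explicit
    antiderivatives on all of it.\<close>
  define f1 where "f1 = (\<lambda>\<tau>. (\<delta> + \<tau>) powr (\<beta> - 2))"
  define f2 where "f2 = (\<lambda>\<tau>. (\<delta> + (2 * pi - \<tau>)) powr (\<beta> - 2))"
  have I1: "(f1 has_integral (\<delta> + 2 * pi) powr (\<beta> - 1) / (\<beta> - 1) - (\<delta> + 0) powr (\<beta> - 1) / (\<beta> - 1)) {0..2*pi}"
    unfolding f1_def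
  proof (rule fundamental_theorem_of_calculus)
    show "((\<lambda>\<tau>. (\<delta> + \<tau>) powr (\<beta> - 1) / (\<beta> - 1)) has_vector_derivative (\<delta> + \<tau>) powr (\<beta> - 2)) (at \<tau> within {0..2*pi})"
      if "\<tau> \<in> {0..2*pi}" for \<tau>
      unfolding has_real_derivative_iff_has_vector_derivative[symmetric]
      using that \<delta> \<beta> by (auto intro!: derivative_eq_intros)
  qed simp
  have I2: "(f2 has_integral - ((\<delta> + (2 * pi - 2 * pi)) powr (\<beta> - 1) / (\<beta> - 1)) - - ((\<delta> + (2 * pi - 0)) powr (\<beta> - 1) / (\<beta> - 1))) {0..2*pi}"
    unfolding f2_def
  proof (rule fundamental_theorem_of_calculus)
    show "((\<lambda>\<tau>. - ((\<delta> + (2 * pi - \<tau>)) powr (\<beta> - 1) / (\<beta> - 1))) has_vector_derivative (\<delta> + (2 * pi - \<tau>)) powr (\<beta> - 2)) (at \<tau> within {0..2*pi})"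
      if "\<tau> \<in> {0..2*pi}" for \<tau>
      unfolding has_real_derivative_iff_has_vector_derivative[symmetric]
      using that \<delta> \<beta> by (auto intro!: derivative_eq_intros)
  qed simp
  have le: "- (\<delta> powr (\<beta> - 1) / (\<beta> - 1)) + (\<delta> + 2 * pi) powr (\<beta> - 1) / (\<beta> - 1) \<le> \<delta> powr (\<beta> - 1) / (1 - \<beta>)"
  proof -
    have "(\<delta> + 2 * pi) powr (\<beta> - 1) / (\<beta> - 1) \<le> 0" using \<beta> by (intro divide_nonneg_neg) auto
    moreover have "- (\<delta> powr (\<beta> - 1) / (\<beta> - 1)) = \<delta> powr (\<beta> - 1) / (1 - \<beta>)"
      by (metis minus_diff_eq minus_divide_right)
    ultimately show ?thesis by linarith
  qed
  have pt: "poisson_kernel (of_real r) \<tau> * cmod (cis \<tau> - 1) powr \<beta> \<le> 576 * \<delta> * (f1 \<tau> + f2 \<tau>)"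
    if \<tau>: "\<tau> \<in> {0..2*pi}" for \<tau>
  proof -
    define m where "m = min \<tau> (2 * pi - \<tau>)"
    define L where "L = cmod (cis \<tau> - of_real r)"
    have m: "0 \<le> m" "m \<le> pi" using \<tau> by (auto simp: m_def)
    have "cis \<tau> - 1 = cis (\<tau> / 2) * (2 * \<i> * of_real (sin (\<tau> / 2)))"
    proof -
      have "cis \<tau> = cis (\<tau>/2) * cis (\<tau>/2)" "1 = cis (\<tau>/2) * cis (- (\<tau>/2))"
        by (simp_all add: cis_mult)
      moreover have "cis (\<tau>/2) - cis (- (\<tau>/2)) = 2 * \<i> * of_real (sin (\<tau> / 2))"
        by (simp add: complex_eq_iff)
      ultimately show ?thesis by (metis right_diff_distrib)
    qed
    then have c1: "cmod (cis \<tau> - 1) = 2 * \<bar>sin (\<tau> / 2)\<bar>" by (simp add: norm_mult)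
    have "m / 6 \<le> sin (\<tau> / 2)"
    proof (cases "\<tau> \<le> pi")
      case True
      then show ?thesis using sin_ge_third[of "\<tau>/2"] \<tau> by (simp add: m_def)
    next
      case False
      have "sin (\<tau> / 2) = sin ((2 * pi - \<tau>) / 2)"
        by (simp add: diff_divide_distrib sin_diff)
      then show ?thesis using sin_ge_third[of "(2 * pi - \<tau>)/2"] \<tau> False by (simp add: m_def)
    qed
    then have mc: "m / 3 \<le> cmod (cis \<tau> - 1)" using c1 by linarith
    have L\<delta>: "\<delta> \<le> L" unfolding L_def \<delta>_def
      using norm_triangle_ineq2[of "cis \<tau>" "of_real r"] r by simp
    have cL: "cmod (cis \<tau> - 1) \<le> 2 * L"
    proof -
      have "cmod (cis \<tau> - 1) \<le> cmod (cis \<tau> - of_real r) + cmod (of_real r - 1)"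
        using norm_triangle_ineq[of "cis \<tau> - of_real r" "of_real r - 1"] by simp
      moreover have "cmod (of_real r - 1) = \<delta>"
        using r by (metis \<delta>_def abs_minus_commute abs_of_pos diff_gt_0_iff_gt norm_of_real of_real_1 of_real_diff)
      ultimately show ?thesis using L\<delta> unfolding L_def by linarith
    qed
    have Lm: "(\<delta> + m) / 12 \<le> L" using mc cL L\<delta> \<delta> m by argo
    have L0: "0 < L" using L\<delta> \<delta> by linarith
    have "1 - r\<^sup>2 \<le> 2 * \<delta>"
    proof -
      have "1 - r\<^sup>2 = \<delta> * (1 + r)" by (simp add: \<delta>_def power2_eq_square algebra_simps)
      also have "\<dots> \<le> \<delta> * 2" using r \<delta> by (intro mult_left_mono) auto
      finally show ?thesis by simp
    qed
    then have "poisson_kernel (of_real r) \<tau> * cmod (cis \<tau> - 1) powr \<beta> \<le> (2 * \<delta> / L\<^sup>2) * (2 * L) powr \<beta>"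
      unfolding poisson_kernel_def L_def[symmetric] using r cL L0 \<beta> \<delta>
      by (intro mult_mono powr_mono2 divide_right_mono) auto
    also have "\<dots> = 2 * \<delta> * 2 powr \<beta> * L powr (\<beta> - 2)"
      using L0 by (simp add: powr_mult powr_diff flip: powr_numeral)
    also have "\<dots> \<le> 2 * \<delta> * 2 * ((\<delta> + m) / 12) powr (\<beta> - 2)"
      using \<delta> \<beta> m Lm L0 powr_mono[of \<beta> 1 2] by (intro mult_mono powr_mono2') auto
    also have "((\<delta> + m) / 12) powr (\<beta> - 2) \<le> 144 * (\<delta> + m) powr (\<beta> - 2)"
    proof -
      have "(1/12::real) powr (\<beta> - 2) = 12 powr (2 - \<beta>)"
        by (simp add: powr_divide powr_minus_divide[symmetric])
      also have "\<dots> \<le> 12 powr 2" using \<beta> by (intro powr_mono) auto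
      also have "\<dots> = 144" by simp
      finally have "(1/12::real) powr (\<beta> - 2) * (\<delta> + m) powr (\<beta> - 2) \<le> 144 * (\<delta> + m) powr (\<beta> - 2)"
        by (intro mult_right_mono) auto
      moreover have "((\<delta> + m) / 12) powr (\<beta> - 2) = (1/12) powr (\<beta> - 2) * (\<delta> + m) powr (\<beta> - 2)"
        using \<delta> m by (simp add: powr_mult[symmetric])
      ultimately show ?thesis by simp
    qed
    also have "(\<delta> + m) powr (\<beta> - 2) \<le> f1 \<tau> + f2 \<tau>"
      unfolding m_def f1_def f2_def by (auto simp: min_def)
    finally show ?thesis using \<delta> by (simp add: mult_ac)
  qed
  have "continuous_on {0..2*pi} (\<lambda>\<tau>. poisson_kernel (of_real r) \<tau> * cmod (cis \<tau> - 1) powr \<beta>)"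
    using r \<beta> by (auto intro!: continuous_intros continuous_on_powr')
  then have "integral {0..2*pi} (\<lambda>\<tau>. poisson_kernel (of_real r) \<tau> * cmod (cis \<tau> - 1) powr \<beta>)
      \<le> integral {0..2*pi} (\<lambda>\<tau>. 576 * \<delta> * (f1 \<tau> + f2 \<tau>))"
    by (intro integral_le pt has_integral_integrable[OF has_integral_mult_right[OF has_integral_add[OF I1 I2]]]
         integrable_continuous_interval)
  also have "\<dots> = 576 * \<delta> * (2 * (- (\<delta> powr (\<beta> - 1) / (\<beta> - 1)) + (\<delta> + 2 * pi) powr (\<beta> - 1) / (\<beta> - 1)))"
    using integral_unique[OF has_integral_mult_right[OF has_integral_add[OF I1 I2], of "576 * \<delta>"]] by simp
  also have "\<dots> \<le> 576 * \<delta> * (2 * (\<delta> powr (\<beta> - 1) / (1 - \<beta>)))"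
    using le \<delta> by (intro mult_left_mono) auto
  also have "\<dots> = 1152 / (1 - \<beta>) * \<delta> powr \<beta>"
    using \<delta> by (simp add: powr_diff)
  finally show ?thesis by (simp add: \<delta>_def)
qed

lemma poisson_kernel_rotate: "poisson_kernel (of_real r * cis \<theta>) (\<tau> + \<theta>) = poisson_kernel (of_real r) \<tau>"
proof -
  have "cis (\<tau> + \<theta>) - of_real r * cis \<theta> = (cis \<tau> - of_real r) * cis \<theta>"
    by (simp add: cis_mult[symmetric] algebra_simps)
  then show ?thesis by (simp add: poisson_kernel_def norm_mult)
qed

lemma poisson_osc_nonneg: "continuous_on UNIV (\<lambda>\<tau>. U (cis \<tau>)) \<Longrightarrow> cmod z < 1 \<Longrightarrow> 0 \<le> poisson_osc U z c"
  unfolding poisson_osc_def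
  by (intro divide_nonneg_pos Henstock_Kurzweil_Integration.integral_nonneg integrable_continuous_interval
       mult_nonneg_nonneg poisson_kernel_nonneg continuous_intros)
     (auto elim: continuous_on_subset)

text \<open>
  Rotating the circle by \<open>\<theta>\<close> moves the dependence on \<open>\<theta>\<close> from the kernel to the function, so
  that Minkowski's inequality applies with a fixed weight.
\<close>

lemma poisson_osc_eq_rotated:
  fixes U :: "complex \<Rightarrow> real"
  assumes U: "continuous_on UNIV (\<lambda>\<tau>. U (cis \<tau>))" and r: "0 < r" "r < 1"
  shows "ennreal (poisson_osc U (of_real r * cis \<theta>) c) =
    (\<integral>\<^sup>+\<tau>\<in>{0..2*pi}. ennreal (poisson_kernel (of_real r) \<tau> / (2 * pi) * \<bar>U (cis \<theta> * cis \<tau>) - c\<bar>) \<partial>lborel)"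
proof -
  let ?z = "of_real r * cis \<theta>"
  have z: "cmod ?z < 1" using r by (simp add: norm_mult)
  have Uc: "continuous_on A (\<lambda>\<tau>. U (cis \<tau>))" for A using U by (rule continuous_on_subset) simp
  define f where "f = (\<lambda>\<tau>. poisson_kernel ?z \<tau> / (2 * pi) * \<bar>U (cis \<tau>) - c\<bar>)"
  have fc: "continuous_on A f" for A
    unfolding f_def using Uc[of A] z by (intro continuous_intros) auto
  have f0: "0 \<le> f \<tau>" for \<tau> unfolding f_def using poisson_kernel_nonneg[OF z] by simp
  have fm: "(\<lambda>\<tau>. ennreal (f \<tau>)) \<in> borel_measurable borel"
    using borel_measurable_continuous_onI[OF fc] by measurable
  have per: "f (x + 2 * pi) = f x" for x
    by (simp only: f_def poisson_kernel_def cis_add_2pi)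
  have "f = (\<lambda>\<tau>. poisson_kernel ?z \<tau> * \<bar>U (cis \<tau>) - c\<bar> * (1 / (2 * pi)))"
    by (simp add: f_def)
  then have "integral {0..2*pi} f = poisson_osc U ?z c"
    by (simp only: poisson_osc_def integral_mult_left) simp
  then have "ennreal (poisson_osc U ?z c) = (\<integral>\<^sup>+\<tau>\<in>{0..2*pi}. ennreal (f \<tau>) \<partial>lborel)"
    using nn_integral_continuous_interval[OF fc f0] by simp
  also have "\<dots> = (\<integral>\<^sup>+\<tau>\<in>{0..2*pi}. ennreal (f (\<tau> + \<theta>)) \<partial>lborel)"
    by (rule nn_integral_periodic_shift[OF fm, symmetric]) (simp only: per)
  also have "\<dots> = (\<integral>\<^sup>+\<tau>\<in>{0..2*pi}. ennreal (poisson_kernel (of_real r) \<tau> / (2 * pi) * \<bar>U (cis \<theta> * cis \<tau>) - c\<bar>) \<partial>lborel)"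
    by (simp only: f_def poisson_kernel_rotate cis_mult add.commute)
  finally show ?thesis .
qed

text \<open>
  The rotated integral is a superposition over \<open>\<tau>\<close> of the differences
  \<open>|U(e^(i(\<theta>+\<tau>)))-U(e^(i\<theta>))|\<close>, whose norms are at most \<open>M|e^(i\<tau>)-1|^\<beta>\<close>; Minkowski's
  inequality reduces the claim to the weighted integral of the Poisson kernel.
\<close>

lemma circle_norm_poisson_osc:
  fixes U :: "complex \<Rightarrow> real"
  assumes p: "1 \<le> p" and \<beta>: "0 < \<beta>" "\<beta> < 1" and r: "0 < r" "r < 1" and M: "0 < M"
    and U: "continuous_on UNIV (\<lambda>\<tau>. U (cis \<tau>))"
    and lip: "\<And>\<tau>. circle_norm p (\<lambda>\<eta>. \<bar>U (cis \<eta> * cis \<tau>) - U (cis \<eta>)\<bar>) \<le> ennreal (M * cmod (cis \<tau> - 1) powr \<beta>)"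
  shows "circle_norm p (\<lambda>\<theta>. poisson_osc U (of_real r * cis \<theta>) (U (cis \<theta>))) \<le> ennreal (M * (192 / (1 - \<beta>)) * (1 - r) powr \<beta>)"
proof (rule circle_norm_integral_le[where S = "{0<..<2*pi}"
    and G = "\<lambda>\<tau> \<theta>. poisson_kernel (of_real r) \<tau> / (2 * pi) * \<bar>U (cis \<theta> * cis \<tau>) - U (cis \<theta>)\<bar>"
    and w = "\<lambda>\<tau>. poisson_kernel (of_real r) \<tau> / (2 * pi) * (M * cmod (cis \<tau> - 1) powr \<beta>)"])
  have rz: "cmod (of_real r) < 1" using r by simp
  have Uf: "continuous_on A (\<lambda>x. U (cis (g x)))" if "continuous_on A g" for A :: "'b::topological_space set" and g
    using continuous_on_compose2[OF U that] by auto
  have pf: "continuous_on A (\<lambda>x. poisson_kernel (of_real r) (g x))" if "continuous_on A g" for A :: "'b::topological_space set" and g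
    using continuous_on_compose2[OF continuous_on_poisson_kernel[OF rz, of UNIV] that] by auto
  show "continuous_on ({0<..<2*pi} \<times> UNIV) (\<lambda>(\<tau>, \<theta>). poisson_kernel (of_real r) \<tau> / (2 * pi) * \<bar>U (cis \<theta> * cis \<tau>) - U (cis \<theta>)\<bar>)"
    unfolding case_prod_unfold cis_mult by (intro continuous_intros Uf pf) auto
  show "continuous_on {0<..<2*pi} (\<lambda>\<tau>. poisson_kernel (of_real r) \<tau> / (2 * pi) * (M * cmod (cis \<tau> - 1) powr \<beta>))"
    using rz \<beta> by (intro continuous_intros continuous_on_powr' ) auto
  show "0 < poisson_kernel (of_real r) \<tau> / (2 * pi) * (M * cmod (cis \<tau> - 1) powr \<beta>)" if "\<tau> \<in> {0<..<2*pi}" for \<tau>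
  proof -
    have "cis \<tau> \<noteq> 1"
    proof
      assume "cis \<tau> = 1"
      then have "cos \<tau> = 1" by (simp add: complex_eq_iff)
      then obtain n :: int where "\<tau> = of_int n * 2 * pi" by (auto simp: cos_one_2pi_int)
      then show False using that by (auto simp: zero_less_mult_iff)
    qed
    then show ?thesis using poisson_kernel_pos[OF rz] M by simp
  qed
  show "(\<integral>\<^sup>+\<tau>\<in>{0<..<2*pi}. ennreal (poisson_kernel (of_real r) \<tau> / (2 * pi) * (M * cmod (cis \<tau> - 1) powr \<beta>)) \<partial>lborel)
      \<le> ennreal (M * (192 / (1 - \<beta>)) * (1 - r) powr \<beta>)"
  proof -
    let ?g = "\<lambda>\<tau>. poisson_kernel (of_real r) \<tau> / (2 * pi) * (M * cmod (cis \<tau> - 1) powr \<beta>)"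
    have "continuous_on {0..2*pi} ?g"
      using rz \<beta> by (intro continuous_intros continuous_on_powr') auto
    then have "(\<integral>\<^sup>+\<tau>\<in>{0<..<2*pi}. ennreal (?g \<tau>) \<partial>lborel) = ennreal (integral {0..2*pi} ?g)"
      unfolding nn_integral_open_interval
      using poisson_kernel_nonneg[OF rz] M by (intro nn_integral_continuous_interval) auto
    also have "integral {0..2*pi} ?g = integral {0..2*pi} (\<lambda>\<tau>. M / (2 * pi) * (poisson_kernel (of_real r) \<tau> * cmod (cis \<tau> - 1) powr \<beta>))"
      by (intro integral_cong) simp
    also have "\<dots> = M / (2 * pi) * integral {0..2*pi} (\<lambda>\<tau>. poisson_kernel (of_real r) \<tau> * cmod (cis \<tau> - 1) powr \<beta>)"
      by (rule integral_mult_right)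
    also have "\<dots> \<le> M / (2 * pi) * (1152 / (1 - \<beta>) * (1 - r) powr \<beta>)"
      using poisson_weight_integral_le[OF \<beta> r] M by (intro mult_left_mono) auto
    also have "\<dots> \<le> M / 6 * (1152 / (1 - \<beta>) * (1 - r) powr \<beta>)"
      using M \<beta> pi_gt3 by (intro mult_right_mono divide_left_mono) auto
    also have "\<dots> = M * (192 / (1 - \<beta>)) * (1 - r) powr \<beta>" by simp
    finally show ?thesis by (simp add: ennreal_leI)
  qed
  show "circle_norm p (\<lambda>\<theta>. poisson_kernel (of_real r) \<tau> / (2 * pi) * \<bar>U (cis \<theta> * cis \<tau>) - U (cis \<theta>)\<bar>)
      \<le> ennreal (poisson_kernel (of_real r) \<tau> / (2 * pi) * (M * cmod (cis \<tau> - 1) powr \<beta>))" for \<tau>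
  proof -
    have "continuous_on UNIV (\<lambda>\<theta>. \<bar>U (cis \<theta> * cis \<tau>) - U (cis \<theta>)\<bar>)"
      unfolding cis_mult by (intro continuous_intros Uf)
    then show ?thesis
      using lip[of \<tau>] p M poisson_kernel_nonneg[OF rz, of \<tau>]
      by (intro circle_norm_cmult) (auto intro: borel_measurable_continuous_onI)
  qed
  fix \<theta> :: real
  have "cmod (of_real r * cis \<theta>) < 1" using r by (simp add: norm_mult)
  then show "0 \<le> poisson_osc U (of_real r * cis \<theta>) (U (cis \<theta>)) \<and>
      ennreal (poisson_osc U (of_real r * cis \<theta>) (U (cis \<theta>))) \<le>
      (\<integral>\<^sup>+\<tau>\<in>{0<..<2*pi}. ennreal (poisson_kernel (of_real r) \<tau> / (2 * pi) * \<bar>U (cis \<theta> * cis \<tau>) - U (cis \<theta>)\<bar>) \<partial>lborel)"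
    unfolding nn_integral_open_interval poisson_osc_eq_rotated[OF U r] by (simp add: poisson_osc_nonneg[OF U])
qed (use p M \<beta> r poisson_kernel_nonneg in \<open>auto simp: poisson_kernel_nonneg\<close>)

section \<open>Integrating the growth of a derivative\<close>

lemma segment_in_ball:
  assumes "a \<in> ball 0 (1::real)" "b \<in> ball 0 1" "0 \<le> t" "t \<le> 1"
  shows "a + of_real t * (b - a) \<in> ball (0::complex) 1"
proof -
  have "(1 - t) *\<^sub>R a + t *\<^sub>R b \<in> ball 0 1"
    using assms by (intro convexD) auto
  then show ?thesis by (simp add: scaleR_conv_of_real algebra_simps)
qed

lemma cball_half_distance_subset:
  assumes "cmod z < 1"
  shows "cball z ((1 - cmod z) / 2) \<subseteq> ball 0 1"
proof
  fix w assume "w \<in> cball z ((1 - cmod z) / 2)"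
  then have "cmod (w - z) \<le> (1 - cmod z) / 2" by (simp add: dist_norm norm_minus_commute)
  moreover have "cmod w \<le> cmod z + cmod (w - z)" using norm_triangle_ineq[of z "w - z"] by simp
  ultimately show "w \<in> ball 0 1" using assms by simp
qed

text \<open>
  All rotations of the segment \<open>[a,b]\<close> are treated at once: the difference along the rotated segment is
  an integral over the parameter \<open>t\<close> of means of \<open>K\<close> over concentric circles.
\<close>

lemma circle_norm_segment:
  fixes U :: "complex \<Rightarrow> complex" and K :: "complex \<Rightarrow> real"
  assumes p: "1 \<le> p" and C: "0 \<le> C"
    and K: "continuous_on (ball 0 1) K" "\<And>z. z \<in> ball 0 1 \<Longrightarrow> 0 \<le> K z"
    and KM: "\<And>z. z \<in> ball 0 1 \<Longrightarrow> circle_norm p (\<lambda>\<theta>. K (cis \<theta> * z)) \<le> ennreal (M * (1 - cmod z) powr (\<beta> - 1))"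
    and M: "0 < M"
    and UK: "\<And>a b. a \<in> ball 0 1 \<Longrightarrow> b \<in> ball 0 1 \<Longrightarrow>
        cmod (U a - U b) \<le> C * cmod (b - a) * integral {0..1} (\<lambda>t. K (a + of_real t * (b - a)))"
    and ab: "a \<in> ball 0 1" "b \<in> ball 0 1"
    and w: "continuous_on {0<..<1} w" "\<And>t. 0 < t \<Longrightarrow> t < 1 \<Longrightarrow> 0 < w t"
      "\<And>t. 0 < t \<Longrightarrow> t < 1 \<Longrightarrow> C * cmod (b - a) * (M * (1 - cmod (a + of_real t * (b - a))) powr (\<beta> - 1)) \<le> w t"
    and W: "0 < W" "(\<integral>\<^sup>+t\<in>{0<..<1}. ennreal (w t) \<partial>lborel) \<le> ennreal W"
  shows "circle_norm p (\<lambda>\<theta>. cmod (U (cis \<theta> * a) - U (cis \<theta> * b))) \<le> ennreal W"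
proof (rule circle_norm_integral_le[where S = "{0<..<1}" and w = w
    and G = "\<lambda>t \<theta>. C * cmod (b - a) * K (cis \<theta> * (a + of_real t * (b - a)))"])
  have inb: "a + of_real t * (b - a) \<in> ball 0 1" if "0 \<le> t" "t \<le> 1" for t
    using segment_in_ball[OF ab that] .
  have inb': "cis \<theta> * (a + of_real t * (b - a)) \<in> ball 0 1" if "0 \<le> t" "t \<le> 1" for t \<theta>
    using inb[OF that] by (simp add: norm_mult)
  have Kf: "continuous_on A (\<lambda>x. K (g x))" if "continuous_on A g" "g ` A \<subseteq> ball 0 1" for A :: "'b::topological_space set" and g
    using continuous_on_compose2[OF K(1) that] .
  show "continuous_on ({0<..<1} \<times> UNIV) (\<lambda>(t, \<theta>). C * cmod (b - a) * K (cis \<theta> * (a + of_real t * (b - a))))"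
    unfolding case_prod_unfold using inb' by (intro continuous_intros Kf) auto
  show "0 \<le> C * cmod (b - a) * K (cis \<theta> * (a + of_real t * (b - a)))" if "t \<in> {0<..<1}" for t \<theta>
    using that C K(2)[OF inb'[of t \<theta>]] by simp
  show "circle_norm p (\<lambda>\<theta>. C * cmod (b - a) * K (cis \<theta> * (a + of_real t * (b - a)))) \<le> ennreal (w t)" if t: "t \<in> {0<..<1}" for t
  proof -
    have "continuous_on UNIV (\<lambda>\<theta>. K (cis \<theta> * (a + of_real t * (b - a))))"
      using inb' t by (intro continuous_intros Kf) auto
    then have "circle_norm p (\<lambda>\<theta>. C * cmod (b - a) * K (cis \<theta> * (a + of_real t * (b - a)))) \<le>
        ennreal (C * cmod (b - a) * (M * (1 - cmod (a + of_real t * (b - a))) powr (\<beta> - 1)))"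
      using KM[OF inb, of t] t p C M K(2)[OF inb']
      by (intro circle_norm_cmult) (auto intro: borel_measurable_continuous_onI)
    also have "\<dots> \<le> ennreal (w t)" using w(3)[of t] t by (intro ennreal_leI) auto
    finally show ?thesis .
  qed
  fix \<theta> :: real
  have ab': "cis \<theta> * a \<in> ball 0 1" "cis \<theta> * b \<in> ball 0 1" using ab by (auto simp: norm_mult)
  have "cmod (U (cis \<theta> * a) - U (cis \<theta> * b)) \<le>
      C * cmod (cis \<theta> * b - cis \<theta> * a) * integral {0..1} (\<lambda>t. K (cis \<theta> * a + of_real t * (cis \<theta> * b - cis \<theta> * a)))"
    by (rule UK[OF ab'])
  also have "(\<lambda>t. K (cis \<theta> * a + of_real t * (cis \<theta> * b - cis \<theta> * a))) = (\<lambda>t. K (cis \<theta> * (a + of_real t * (b - a))))"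
    by (simp add: algebra_simps)
  also have "cmod (cis \<theta> * b - cis \<theta> * a) = cmod (b - a)"
    by (simp add: norm_mult flip: right_diff_distrib)
  also have "C * cmod (b - a) * integral {0..1} (\<lambda>t. K (cis \<theta> * (a + of_real t * (b - a)))) =
      integral {0..1} (\<lambda>t. C * cmod (b - a) * K (cis \<theta> * (a + of_real t * (b - a))))"
    by (rule integral_mult_right[symmetric])
  finally have "ennreal (cmod (U (cis \<theta> * a) - U (cis \<theta> * b))) \<le> ennreal \<dots>"
    by (rule ennreal_leI)
  also have "\<dots> = (\<integral>\<^sup>+t\<in>{0<..<1}. ennreal (C * cmod (b - a) * K (cis \<theta> * (a + of_real t * (b - a)))) \<partial>lborel)"
    unfolding nn_integral_open_interval
    using inb' C K(2)[OF inb'] by (intro nn_integral_continuous_interval[symmetric] continuous_intros Kf) auto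
  finally show "0 \<le> cmod (U (cis \<theta> * a) - U (cis \<theta> * b)) \<and> ennreal (cmod (U (cis \<theta> * a) - U (cis \<theta> * b))) \<le>
      (\<integral>\<^sup>+t\<in>{0<..<1}. ennreal (C * cmod (b - a) * K (cis \<theta> * (a + of_real t * (b - a)))) \<partial>lborel)"
    by simp
qed (use p w W in auto)

lemma nn_integral_powr_unit:
  assumes "0 < \<beta>" "0 \<le> A"
  shows "(\<integral>\<^sup>+t\<in>{0<..<1}. ennreal (A * t powr (\<beta> - 1)) \<partial>lborel) = ennreal (A / \<beta>)"
proof -
  have I: "((\<lambda>t. if t \<in> {0..1} then A * t powr (\<beta> - 1) else 0) has_integral A * (1 / \<beta>)) UNIV"
    unfolding has_integral_restrict_UNIV
    using has_integral_powr_from_0[of "\<beta> - 1" 1] assms by (intro has_integral_mult_right) simp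
  have "(\<integral>\<^sup>+t\<in>{0<..<1}. ennreal (A * t powr (\<beta> - 1)) \<partial>lborel) = (\<integral>\<^sup>+t. ennreal (if t \<in> {0..1} then A * t powr (\<beta> - 1) else 0) \<partial>lborel)"
    unfolding nn_integral_open_interval by (intro nn_integral_cong) auto
  also have "\<dots> = ennreal (A * (1 / \<beta>))"
    by (rule nn_integral_has_integral_lborel[OF _ _ I]) (use assms in auto)
  finally show ?thesis by simp
qed

text \<open>
  The theorem of Hardy and Littlewood. The path from \<open>z\<^sub>1\<close> to \<open>z\<^sub>2\<close> first moves towards the centre by
  the relative distance \<open>h=min(1,|z\<^sub>1-z\<^sub>2|)\<close>, where the growth \<open>(1-r)^(\<beta>-1)\<close> integrates to
  \<open>h^\<beta>/\<beta>\<close>; the chord between the two new points stays in the disk of radius \<open>1-h\<close> and has length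
  at most \<open>h\<close>, so it contributes a multiple of \<open>h\<cdot> h^(\<beta>-1)\<close>.
\<close>

lemma hardy_littlewood_disk:
  fixes U :: "complex \<Rightarrow> complex" and K :: "complex \<Rightarrow> real"
  assumes p: "1 \<le> p" and \<beta>: "0 < \<beta>" "\<beta> \<le> 1" and C: "0 < C"
    and K: "continuous_on (ball 0 1) K" "\<And>z. z \<in> ball 0 1 \<Longrightarrow> 0 \<le> K z"
    and KM: "\<And>z. z \<in> ball 0 1 \<Longrightarrow> circle_norm p (\<lambda>\<theta>. K (cis \<theta> * z)) \<le> ennreal (M * (1 - cmod z) powr (\<beta> - 1))"
    and M: "0 < M"
    and U: "continuous_on (ball 0 1) U"
    and UK: "\<And>a b. a \<in> ball 0 1 \<Longrightarrow> b \<in> ball 0 1 \<Longrightarrow>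
        cmod (U a - U b) \<le> C * cmod (b - a) * integral {0..1} (\<lambda>t. K (a + of_real t * (b - a)))"
    and z: "z1 \<in> ball 0 1" "z2 \<in> ball 0 1"
  shows "circle_norm p (\<lambda>\<theta>. cmod (U (cis \<theta> * z1) - U (cis \<theta> * z2))) \<le> ennreal (48 * C * M / \<beta> * cmod (z1 - z2) powr \<beta>)"
proof (cases "z1 = z2")
  case True
  then show ?thesis using p by (simp add: circle_norm_def ennpowr_def)
next
  case False
  note seg = circle_norm_segment[OF p less_imp_le[OF C] K KM M UK]
  define h where "h = min 1 (cmod (z1 - z2))"
  have h: "0 < h" "h \<le> 1" "h \<le> cmod (z1 - z2)" using False by (auto simp: h_def)
  define X where "X = C * M * h powr \<beta>"
  have X: "0 < X" using C M h by (simp add: X_def)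
  have inb: "of_real (1 - s * h) * z \<in> ball 0 1" if "z \<in> ball 0 1" "0 \<le> s" "s \<le> 1" for z :: complex and s :: real
  proof -
    have "s * h \<le> 1" using that h by (simp add: mult_le_one)
    then have "cmod (of_real (1 - s * h) * z) \<le> 1 * cmod z"
      using that h unfolding norm_mult norm_of_real by (intro mult_right_mono) auto
    then show ?thesis using that by simp
  qed
  have rad: "circle_norm p (\<lambda>\<theta>. cmod (U (cis \<theta> * z) - U (cis \<theta> * (of_real (1 - h) * z)))) \<le> ennreal (X / \<beta>)"
    if zb: "z \<in> ball 0 1" for z
  proof (rule seg[where w = "\<lambda>t. X * t powr (\<beta> - 1)"])
    show "of_real (1 - h) * z \<in> ball 0 1" using inb[OF zb, of 1] by simp
    show "C * cmod (of_real (1 - h) * z - z) * (M * (1 - cmod (z + of_real t * (of_real (1 - h) * z - z))) powr (\<beta> - 1))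
        \<le> X * t powr (\<beta> - 1)" if t: "0 < t" "t < 1" for t
    proof -
      have th: "0 < t * h" "t * h \<le> 1" using t h by (auto simp: mult_le_one)
      have "of_real (1 - h) * z - z = - (of_real h * z)" by (simp add: algebra_simps)
      then have 1: "cmod (of_real (1 - h) * z - z) \<le> h"
        using h zb by (simp add: norm_mult mult_le_one mult_left_le)
      have "z + of_real t * (of_real (1 - h) * z - z) = of_real (1 - t * h) * z" by (simp add: algebra_simps)
      then have "cmod (z + of_real t * (of_real (1 - h) * z - z)) = (1 - t * h) * cmod z"
        using th by (simp only: norm_mult norm_of_real abs_of_nonneg diff_ge_0_iff_ge)
      also have "\<dots> \<le> (1 - t * h) * 1" using zb th by (intro mult_left_mono) auto
      finally have 2: "t * h \<le> 1 - cmod (z + of_real t * (of_real (1 - h) * z - z))" by simp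
      have "C * cmod (of_real (1 - h) * z - z) * (M * (1 - cmod (z + of_real t * (of_real (1 - h) * z - z))) powr (\<beta> - 1))
          \<le> C * h * (M * (t * h) powr (\<beta> - 1))"
        using C M h 1 2 th \<beta> by (intro mult_mono powr_mono2') auto
      also have "\<dots> = X * t powr (\<beta> - 1)"
        using h t by (simp add: X_def powr_mult powr_diff)
      finally show ?thesis .
    qed
    show "(\<integral>\<^sup>+t\<in>{0<..<1}. ennreal (X * t powr (\<beta> - 1)) \<partial>lborel) \<le> ennreal (X / \<beta>)"
      using nn_integral_powr_unit[of \<beta> X] \<beta> X by simp
  qed (use zb X \<beta> in \<open>auto intro!: continuous_intros\<close>)
  have chord: "circle_norm p (\<lambda>\<theta>. cmod (U (cis \<theta> * (of_real (1 - h) * z1)) - U (cis \<theta> * (of_real (1 - h) * z2)))) \<le> ennreal X"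
  proof (rule seg[where w = "\<lambda>t. X"])
    let ?a = "of_real (1 - h) * z1" and ?b = "of_real (1 - h) * z2"
    show "?a \<in> ball 0 1" "?b \<in> ball 0 1" using inb[OF z(1), of 1] inb[OF z(2), of 1] by simp_all
    show "C * cmod (?b - ?a) * (M * (1 - cmod (?a + of_real t * (?b - ?a))) powr (\<beta> - 1)) \<le> X" if t: "0 < t" "t < 1" for t
    proof -
      \<comment> \<open>For \<open>h=1\<close> the chord degenerates to a point; otherwise \<open>h=|z\<^sub>1-z\<^sub>2|\<close>.\<close>
      have "cmod (?b - ?a) = (1 - h) * cmod (z1 - z2)"
        using h by (metis abs_of_nonneg diff_ge_0_iff_ge norm_minus_commute norm_mult norm_of_real right_diff_distrib')
      also have "\<dots> \<le> h"
      proof (cases "h = 1")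
        case False
        then have "h = cmod (z1 - z2)" unfolding h_def by linarith
        then show ?thesis using h by (simp add: mult_left_le_one_le)
      qed simp
      finally have 1: "cmod (?b - ?a) \<le> h" .
      have "?a + of_real t * (?b - ?a) = of_real (1 - h) * (z1 + of_real t * (z2 - z1))" by (simp add: algebra_simps)
      moreover have "cmod (z1 + of_real t * (z2 - z1)) \<le> 1"
        using segment_in_ball[OF z, of t] t by simp
      ultimately have "cmod (?a + of_real t * (?b - ?a)) \<le> (1 - h) * 1"
        using h unfolding norm_mult norm_of_real by (metis abs_of_nonneg diff_ge_0_iff_ge mult_left_mono norm_mult norm_of_real)
      then have 2: "h \<le> 1 - cmod (?a + of_real t * (?b - ?a))" by simp
      have "C * cmod (?b - ?a) * (M * (1 - cmod (?a + of_real t * (?b - ?a))) powr (\<beta> - 1))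
          \<le> C * h * (M * h powr (\<beta> - 1))"
        using C M h 1 2 \<beta> by (intro mult_mono powr_mono2') auto
      also have "\<dots> = X" using h by (simp add: X_def powr_diff)
      finally show ?thesis .
    qed
    show "(\<integral>\<^sup>+t\<in>{0<..<1::real}. ennreal X \<partial>lborel) \<le> ennreal X"
      by (subst nn_integral_cmult_indicator) auto
  qed (use X in auto)
  let ?f1 = "\<lambda>\<theta>. cmod (U (cis \<theta> * z1) - U (cis \<theta> * (of_real (1 - h) * z1)))"
  let ?f2 = "\<lambda>\<theta>. cmod (U (cis \<theta> * z2) - U (cis \<theta> * (of_real (1 - h) * z2)))"
  let ?f3 = "\<lambda>\<theta>. cmod (U (cis \<theta> * (of_real (1 - h) * z1)) - U (cis \<theta> * (of_real (1 - h) * z2)))"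
  have Um: "(\<lambda>\<theta>. U (cis \<theta> * z)) \<in> borel_measurable borel" if "z \<in> ball 0 1" for z
    using that by (intro borel_measurable_continuous_onI continuous_on_compose2[OF U] continuous_intros) (auto simp: norm_mult)
  have meas: "?f1 \<in> borel_measurable borel" "?f2 \<in> borel_measurable borel" "?f3 \<in> borel_measurable borel"
    using Um[OF z(1)] Um[OF z(2)] Um[OF inb[OF z(1), of 1]] Um[OF inb[OF z(2), of 1]]
    by (auto intro!: borel_measurable_diff borel_measurable_norm)
  have X\<beta>: "X \<le> X / \<beta>" using X \<beta> by (simp add: pos_le_divide_eq mult_left_le)
  have "circle_norm p (\<lambda>\<theta>. (?f1 \<theta> + ?f2 \<theta>) + ?f3 \<theta>) \<le> ennreal (4 * (4 * (X / \<beta> + X / \<beta>) + X))"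
    by (intro circle_norm_add[OF circle_norm_add[OF rad[OF z(1)] rad[OF z(2)] p] chord p])
       (use meas X \<beta> in \<open>auto intro!: borel_measurable_add\<close>)
  also have "\<dots> \<le> ennreal (48 * C * M / \<beta> * cmod (z1 - z2) powr \<beta>)"
  proof (rule ennreal_leI)
    have "4 * (4 * (X / \<beta> + X / \<beta>) + X) \<le> 48 * (X / \<beta>)" using X\<beta> X \<beta> by simp
    also have "\<dots> = 48 * C * M / \<beta> * h powr \<beta>" by (simp add: X_def)
    also have "\<dots> \<le> 48 * C * M / \<beta> * cmod (z1 - z2) powr \<beta>"
      using C M \<beta> h by (intro mult_left_mono powr_mono2) auto
    finally show "4 * (4 * (X / \<beta> + X / \<beta>) + X) \<le> 48 * C * M / \<beta> * cmod (z1 - z2) powr \<beta>" .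
  qed
  finally have "circle_norm p (\<lambda>\<theta>. (?f1 \<theta> + ?f2 \<theta>) + ?f3 \<theta>) \<le> ennreal (48 * C * M / \<beta> * cmod (z1 - z2) powr \<beta>)" .
  then show ?thesis
  proof (rule circle_norm_mono)
    fix \<theta> :: real
    have "cmod (a - b) \<le> cmod (a - c) + cmod (b - d) + cmod (c - d)" for a b c d :: complex
      using norm_triangle_ineq[of "a - c" "c - d"] norm_triangle_ineq[of "a - d" "d - b"] norm_minus_commute[of d b]
      by simp
    then show "0 \<le> cmod (U (cis \<theta> * z1) - U (cis \<theta> * z2)) \<and> cmod (U (cis \<theta> * z1) - U (cis \<theta> * z2)) \<le> ?f1 \<theta> + ?f2 \<theta> + ?f3 \<theta>"
      by simp
  qed (use p C M \<beta> in auto)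
qed

text \<open>
  Contract both points by a factor tending to \<open>1\<close> and apply Fatou's lemma.
\<close>

lemma circle_norm_le_closed_disk:
  fixes U :: "complex \<Rightarrow> complex"
  assumes p: "1 \<le> p" and \<beta>: "0 < \<beta>" and A: "0 \<le> A" and U: "continuous_on (cball 0 1) U"
    and le: "\<And>z1 z2. z1 \<in> ball 0 1 \<Longrightarrow> z2 \<in> ball 0 1 \<Longrightarrow>
      circle_norm p (\<lambda>\<theta>. cmod (U (cis \<theta> * z1) - U (cis \<theta> * z2))) \<le> ennreal (A * cmod (z1 - z2) powr \<beta>)"
    and z: "z1 \<in> cball 0 1" "z2 \<in> cball 0 1"
  shows "circle_norm p (\<lambda>\<theta>. cmod (U (cis \<theta> * z1) - U (cis \<theta> * z2))) \<le> ennreal (A * cmod (z1 - z2) powr \<beta>)"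
proof -
  define r where "r = (\<lambda>n. 1 - inverse (real (Suc n)))"
  have r: "0 \<le> r n" "r n < 1" for n by (auto simp: r_def inverse_eq_divide)
  have rlim: "r \<longlonglongrightarrow> 1"
    unfolding r_def using tendsto_diff[OF tendsto_const LIMSEQ_inverse_real_of_nat, of 1] by simp
  let ?f = "\<lambda>z1 z2 \<theta>. cmod (U (cis \<theta> * z1) - U (cis \<theta> * z2))"
  let ?g = "\<lambda>n \<theta>. ennreal (?f (of_real (r n) * z1) (of_real (r n) * z2) \<theta> powr p) * indicator {0..2*pi} \<theta>"
  have inb: "of_real (r n) * z \<in> ball 0 1" if "z \<in> cball 0 1" for z :: complex and n
  proof -
    have "cmod (of_real (r n) * z) \<le> r n * 1" unfolding norm_mult using that r[of n] by (intro mult_mono) auto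
    then show ?thesis using r(2)[of n] by simp
  qed
  have lim: "(\<lambda>n. ?g n \<theta>) \<longlonglongrightarrow> ennreal (?f z1 z2 \<theta> powr p) * indicator {0..2*pi} \<theta>" for \<theta>
  proof -
    have Ul: "(\<lambda>n. U (cis \<theta> * (of_real (r n) * z))) \<longlonglongrightarrow> U (cis \<theta> * z)" if "z \<in> cball 0 1" for z
    proof (rule continuous_on_tendsto_compose[OF U])
      have "(\<lambda>n. cis \<theta> * (of_real (r n) * z)) \<longlonglongrightarrow> cis \<theta> * (of_real 1 * z)"
        by (intro tendsto_intros rlim)
      then show "(\<lambda>n. cis \<theta> * (of_real (r n) * z)) \<longlonglongrightarrow> cis \<theta> * z" by simp
      show "cis \<theta> * z \<in> cball 0 1" using that by (simp add: norm_mult)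
      show "\<forall>\<^sub>F n in sequentially. cis \<theta> * (of_real (r n) * z) \<in> cball 0 1"
        using inb[OF that] by (auto simp: norm_mult less_imp_le)
    qed
    have "(\<lambda>n. ?f (of_real (r n) * z1) (of_real (r n) * z2) \<theta> powr p) \<longlonglongrightarrow> ?f z1 z2 \<theta> powr p"
      using p by (intro tendsto_powr2 tendsto_intros Ul z) auto
    then show ?thesis
      by (intro ennreal_tendsto_cmult tendsto_ennrealI tendsto_mult_ennreal tendsto_const) (auto simp: indicator_def)
  qed
  have gm: "?g n \<in> borel_measurable lborel" for n
  proof -
    have "(\<lambda>\<theta>. U (cis \<theta> * (of_real (r n) * z))) \<in> borel_measurable borel" if "z \<in> cball 0 1" for z
      using inb[OF that, of n] by (intro borel_measurable_continuous_onI continuous_on_compose2[OF U] continuous_intros) (auto simp: norm_mult)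
    from this[OF z(1)] this[OF z(2)] show ?thesis by measurable
  qed
  have "(\<integral>\<^sup>+\<theta>\<in>{0..2*pi}. ennreal (?f z1 z2 \<theta> powr p) \<partial>lborel) = (\<integral>\<^sup>+\<theta>. liminf (\<lambda>n. ?g n \<theta>) \<partial>lborel)"
    by (intro nn_integral_cong lim_imp_Liminf[OF _ lim, symmetric]) simp
  also have "\<dots> \<le> liminf (\<lambda>n. \<integral>\<^sup>+\<theta>. ?g n \<theta> \<partial>lborel)"
    by (rule nn_integral_liminf[OF gm])
  also have "\<dots> \<le> liminf (\<lambda>n. ennreal ((A * cmod (z1 - z2) powr \<beta>) powr p))"
  proof (rule Liminf_mono, rule always_eventually, rule allI)
    fix n
    have "cmod (of_real (r n) * z1 - of_real (r n) * z2) = r n * cmod (z1 - z2)"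
      using r(1)[of n] by (metis abs_of_nonneg norm_mult norm_of_real right_diff_distrib')
    also have "\<dots> \<le> 1 * cmod (z1 - z2)" using r[of n] by (intro mult_right_mono) auto
    finally have "A * cmod (of_real (r n) * z1 - of_real (r n) * z2) powr \<beta> \<le> A * cmod (z1 - z2) powr \<beta>"
      using A \<beta> by (intro mult_left_mono powr_mono2) auto
    then have "circle_norm p (?f (of_real (r n) * z1) (of_real (r n) * z2)) \<le> ennreal (A * cmod (z1 - z2) powr \<beta>)"
      using le[OF inb[OF z(1), of n] inb[OF z(2), of n]] by (meson ennreal_leI order_trans)
    then show "(\<integral>\<^sup>+\<theta>. ?g n \<theta> \<partial>lborel) \<le> ennreal ((A * cmod (z1 - z2) powr \<beta>) powr p)"
      using p A by (subst (asm) circle_norm_le_iff) auto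
  qed
  also have "\<dots> = ennreal ((A * cmod (z1 - z2) powr \<beta>) powr p)" by (simp add: Liminf_const)
  finally show ?thesis using p A by (subst circle_norm_le_iff) auto
qed

section \<open>Differences along segments\<close>

lemma norm_diff_le_integral_deriv:
  fixes g :: "real \<Rightarrow> 'a::banach"
  assumes g: "\<And>t. 0 \<le> t \<Longrightarrow> t \<le> 1 \<Longrightarrow> (g has_vector_derivative g' t) (at t within {0..1})"
    and k: "continuous_on {0..1} k" and gk: "\<And>t. 0 \<le> t \<Longrightarrow> t \<le> 1 \<Longrightarrow> norm (g' t) \<le> k t"
  shows "norm (g 1 - g 0) \<le> integral {0..1} k"
proof -
  have I: "(g' has_integral g 1 - g 0) {0..1}"
    by (rule fundamental_theorem_of_calculus) (use g in auto)
  have "norm (integral {0..1} g') \<le> integral {0..1} k"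
    by (rule integral_norm_bound_integral)
       (use I k gk in \<open>auto intro: integrable_continuous_interval has_integral_integrable\<close>)
  then show ?thesis by (simp add: integral_unique[OF I])
qed

lemma segment_has_vector_derivative:
  assumes "\<phi> holomorphic_on ball 0 1" "a \<in> ball 0 1" "b \<in> ball 0 1" "0 \<le> t" "t \<le> 1"
  shows "((\<lambda>t. \<phi> (a + of_real t * (b - a))) has_vector_derivative (b - a) * deriv \<phi> (a + of_real t * (b - a))) (at t within A)"
proof -
  let ?\<gamma> = "\<lambda>t::real. a + of_real t * (b - a)"
  have "(?\<gamma> has_vector_derivative (b - a)) (at t within A)"
    unfolding has_vector_derivative_def by (auto intro!: derivative_eq_intros simp: scaleR_conv_of_real)
  moreover have "(\<phi> has_field_derivative deriv \<phi> (?\<gamma> t)) (at (?\<gamma> t))"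
    using assms segment_in_ball[OF assms(2-5)] by (intro holomorphic_derivI) auto
  ultimately have "((\<phi> \<circ> ?\<gamma>) has_vector_derivative (b - a) * deriv \<phi> (?\<gamma> t)) (at t within A)"
    using field_vector_diff_chain_within has_field_derivative_at_within by blast
  then show ?thesis by (simp add: o_def)
qed

lemma harmonic_diff_le_integral:
  assumes F: "F holomorphic_on ball 0 1" and G: "G holomorphic_on ball 0 1"
    and f: "\<And>z. z \<in> ball 0 1 \<Longrightarrow> f z = F z + cnj (G z)"
    and K: "continuous_on (ball 0 1) K"
    and le: "\<And>z. z \<in> ball 0 1 \<Longrightarrow> cmod (deriv F z) + cmod (deriv G z) \<le> C * K z"
    and a: "a \<in> ball 0 1" and b: "b \<in> ball 0 1"
  shows "cmod (f a - f b) \<le> C * cmod (b - a) * integral {0..1} (\<lambda>t. K (a + of_real t * (b - a)))"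
proof -
  let ?\<gamma> = "\<lambda>t::real. a + of_real t * (b - a)"
  have \<gamma>: "?\<gamma> t \<in> ball 0 1" if "0 \<le> t" "t \<le> 1" for t using segment_in_ball[OF a b that] .
  have Kc: "continuous_on {0..1} (\<lambda>t. K (?\<gamma> t))"
    using \<gamma> by (intro continuous_on_compose2[OF K] continuous_intros) auto
  have "cmod ((F (?\<gamma> 1) + cnj (G (?\<gamma> 1))) - (F (?\<gamma> 0) + cnj (G (?\<gamma> 0)))) \<le> integral {0..1} (\<lambda>t. C * cmod (b - a) * K (?\<gamma> t))"
  proof (rule norm_diff_le_integral_deriv)
    fix t :: real assume t: "0 \<le> t" "t \<le> 1"
    show "((\<lambda>t. F (?\<gamma> t) + cnj (G (?\<gamma> t))) has_vector_derivative (b - a) * deriv F (?\<gamma> t) + cnj ((b - a) * deriv G (?\<gamma> t))) (at t within {0..1})"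
      by (intro has_vector_derivative_add segment_has_vector_derivative F G a b t
           bounded_linear.has_vector_derivative[OF bounded_linear_cnj])
    have "cmod ((b - a) * deriv F (?\<gamma> t) + cnj ((b - a) * deriv G (?\<gamma> t))) \<le>
        cmod ((b - a) * deriv F (?\<gamma> t)) + cmod (cnj ((b - a) * deriv G (?\<gamma> t)))"
      by (rule norm_triangle_ineq)
    also have "\<dots> = cmod (b - a) * (cmod (deriv F (?\<gamma> t)) + cmod (deriv G (?\<gamma> t)))"
      by (simp only: complex_mod_cnj norm_mult distrib_left)
    also have "\<dots> \<le> cmod (b - a) * (C * K (?\<gamma> t))"
      using le[OF \<gamma>[OF t]] by (intro mult_left_mono) auto
    finally show "cmod ((b - a) * deriv F (?\<gamma> t) + cnj ((b - a) * deriv G (?\<gamma> t))) \<le> C * cmod (b - a) * K (?\<gamma> t)"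
      by (simp only: mult_ac)
  qed (use Kc in \<open>auto intro!: continuous_intros\<close>)
  moreover have "integral {0..1} (\<lambda>t. C * cmod (b - a) * K (?\<gamma> t)) = C * cmod (b - a) * integral {0..1} (\<lambda>t. K (?\<gamma> t))"
    by (rule integral_mult_right)
  ultimately show ?thesis
    using f[OF a] f[OF b] by (simp add: norm_minus_commute)
qed

text \<open>
  Formally the gradient of \<open>(1-|w|)^\<alpha>\<close> has length \<open>\<alpha>(1-|w|)^(\<alpha>-1)\<close>. Since the modulus is
  not differentiable at \<open>0\<close>, it is replaced by \<open>s=sqrt(|w|^2+\<epsilon>^2)\<close> and the distance by
  \<open>1+\<epsilon>-s\<close>. As \<open>s\<le>|w|+\<epsilon>\<close>, the new distance is at least \<open>1-|w|\<close>, so the smoothed function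
  obeys the same gradient bound for every \<open>\<epsilon>\<close>, and \<open>\<epsilon>\<close> may tend to \<open>0\<close>.
\<close>

lemma dist_power_diff_le_integral:
  assumes \<alpha>: "0 < \<alpha>" "\<alpha> \<le> 1" and \<phi>: "\<phi> holomorphic_on ball 0 1" "\<phi> ` ball 0 1 \<subseteq> ball 0 1"
    and a: "a \<in> ball 0 1" and b: "b \<in> ball 0 1"
  shows "\<bar>dD (\<phi> a) powr \<alpha> - dD (\<phi> b) powr \<alpha>\<bar> \<le>
    cmod (b - a) * integral {0..1} (\<lambda>t. cmod (deriv \<phi> (a + of_real t * (b - a))) * dD (\<phi> (a + of_real t * (b - a))) powr (\<alpha> - 1))"
proof -
  let ?\<gamma> = "\<lambda>t::real. a + of_real t * (b - a)"
  have \<gamma>: "?\<gamma> t \<in> ball 0 1" if "0 \<le> t" "t \<le> 1" for t using segment_in_ball[OF a b that] .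
  have \<phi>b: "cmod (\<phi> z) < 1" if "z \<in> ball 0 1" for z using \<phi>(2) that by (auto simp: image_subset_iff)
  let ?K = "\<lambda>t. cmod (deriv \<phi> (?\<gamma> t)) * dD (\<phi> (?\<gamma> t)) powr (\<alpha> - 1)"
  have Kc: "continuous_on {0..1} ?K"
  proof -
    have c1: "continuous_on (ball 0 1) \<phi>" "continuous_on (ball 0 1) (deriv \<phi>)"
      using \<phi> by (auto intro: holomorphic_on_imp_continuous_on holomorphic_deriv)
    show ?thesis unfolding dD_def
      using \<gamma> \<phi>b by (intro continuous_intros continuous_on_compose2[OF c1(1)] continuous_on_compose2[OF c1(2)] continuous_on_powr)
         (fastforce dest: \<phi>b[OF \<gamma>])+
  qed
  define u where "u = (\<lambda>\<epsilon> w. (1 + \<epsilon> - sqrt ((cmod w)\<^sup>2 + \<epsilon>\<^sup>2)) powr \<alpha>)"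
  have approx: "\<bar>u \<epsilon> (\<phi> a) - u \<epsilon> (\<phi> b)\<bar> \<le> cmod (b - a) * integral {0..1} ?K" if \<epsilon>: "0 < \<epsilon>" for \<epsilon>
  proof -
    define \<psi> where "\<psi> = (\<lambda>t. \<phi> (?\<gamma> t))"
    define \<psi>' where "\<psi>' = (\<lambda>t. (b - a) * deriv \<phi> (?\<gamma> t))"
    define s where "s = (\<lambda>t. sqrt ((Re (\<psi> t))\<^sup>2 + (Im (\<psi> t))\<^sup>2 + \<epsilon>\<^sup>2))"
    define D where "D = (\<lambda>t. \<alpha> * (1 + \<epsilon> - s t) powr (\<alpha> - 1) * - ((Re (\<psi> t) * Re (\<psi>' t) + Im (\<psi> t) * Im (\<psi>' t)) / s t))"
    have "norm ((1 + \<epsilon> - s 1) powr \<alpha> - (1 + \<epsilon> - s 0) powr \<alpha>) \<le> integral {0..1} (\<lambda>t. cmod (b - a) * ?K t)"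
    proof (rule norm_diff_le_integral_deriv[where g' = D and g = "\<lambda>t. (1 + \<epsilon> - s t) powr \<alpha>"])
      fix t :: real assume t: "0 \<le> t" "t \<le> 1"
      have \<psi>t: "cmod (\<psi> t) < 1" unfolding \<psi>_def using \<phi>b[OF \<gamma>[OF t]] .
      have spos: "0 < s t" unfolding s_def using \<epsilon> by (simp add: add_nonneg_pos)
      have s2: "(s t)\<^sup>2 = (cmod (\<psi> t))\<^sup>2 + \<epsilon>\<^sup>2" unfolding s_def by (simp add: cmod_power2)
      have sle: "s t \<le> cmod (\<psi> t) + \<epsilon>"
        by (rule power2_le_imp_le) (use s2 \<epsilon> in \<open>auto simp: power2_sum\<close>)
      have \<psi>s: "cmod (\<psi> t) \<le> s t"
        by (rule power2_le_imp_le) (use s2 spos in auto)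
      have base: "0 < 1 - cmod (\<psi> t)" "1 - cmod (\<psi> t) \<le> 1 + \<epsilon> - s t" using \<psi>t sle by auto
      have dv: "(\<psi> has_vector_derivative \<psi>' t) (at t within {0..1})"
        unfolding \<psi>_def \<psi>'_def by (rule segment_has_vector_derivative[OF \<phi>(1) a b t])
      have dR: "((\<lambda>t. Re (\<psi> t)) has_real_derivative Re (\<psi>' t)) (at t within {0..1})"
        and dI: "((\<lambda>t. Im (\<psi> t)) has_real_derivative Im (\<psi>' t)) (at t within {0..1})"
        unfolding has_real_derivative_iff_has_vector_derivative
        using bounded_linear.has_vector_derivative[OF bounded_linear_Re dv]
              bounded_linear.has_vector_derivative[OF bounded_linear_Im dv] by auto
      have chain: "((\<lambda>t. (1 + \<epsilon> - sqrt ((R t)\<^sup>2 + (J t)\<^sup>2 + \<epsilon>\<^sup>2)) powr \<alpha>) has_real_derivative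
          \<alpha> * (1 + \<epsilon> - s t) powr (\<alpha> - 1) * - ((R t * R' + J t * J') / s t)) (at t within {0..1})"
        if "(R has_real_derivative R') (at t within {0..1})" "(J has_real_derivative J') (at t within {0..1})"
          and st: "s t = sqrt ((R t)\<^sup>2 + (J t)\<^sup>2 + \<epsilon>\<^sup>2)" for R J :: "real \<Rightarrow> real" and R' J'
      proof -
        have "0 < (R t)\<^sup>2 + (J t)\<^sup>2 + \<epsilon>\<^sup>2" using \<epsilon> by (simp add: add_nonneg_pos)
        then show ?thesis
          using base spos unfolding st
          by (auto intro!: derivative_eq_intros that(1,2) simp: field_simps)
      qed
      have "((\<lambda>t. (1 + \<epsilon> - s t) powr \<alpha>) has_real_derivative D t) (at t within {0..1})"
        unfolding D_def using chain[OF dR dI] by (simp only: s_def)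
      then show "((\<lambda>t. (1 + \<epsilon> - s t) powr \<alpha>) has_vector_derivative D t) (at t within {0..1})"
        by (simp add: has_real_derivative_iff_has_vector_derivative)
      have "\<bar>Re (\<psi> t) * Re (\<psi>' t) + Im (\<psi> t) * Im (\<psi>' t)\<bar> = \<bar>\<psi> t \<bullet> \<psi>' t\<bar>"
        by (simp add: inner_complex_def)
      also have "\<dots> \<le> cmod (\<psi> t) * cmod (\<psi>' t)" by (rule Cauchy_Schwarz_ineq2)
      also have "\<dots> \<le> s t * cmod (\<psi>' t)" using \<psi>s by (intro mult_right_mono) auto
      finally have "\<bar>(Re (\<psi> t) * Re (\<psi>' t) + Im (\<psi> t) * Im (\<psi>' t)) / s t\<bar> \<le> cmod (\<psi>' t)"
        using spos by (simp add: pos_divide_le_eq mult.commute)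
      then have "norm (D t) \<le> 1 * (1 + \<epsilon> - s t) powr (\<alpha> - 1) * cmod (\<psi>' t)"
        unfolding D_def real_norm_def abs_mult abs_minus_cancel using \<alpha>
        by (intro mult_mono) auto
      also have "\<dots> \<le> 1 * (1 - cmod (\<psi> t)) powr (\<alpha> - 1) * cmod (\<psi>' t)"
        using \<alpha> base by (intro mult_mono powr_mono2') auto
      also have "\<dots> = cmod (b - a) * ?K t"
        by (simp add: \<psi>_def \<psi>'_def dD_def norm_mult)
      finally show "norm (D t) \<le> cmod (b - a) * ?K t" .
    qed (intro continuous_intros Kc)
    moreover have "integral {0..1} (\<lambda>t. cmod (b - a) * ?K t) = cmod (b - a) * integral {0..1} ?K"
      by (rule integral_mult_right)
    moreover have "(1 + \<epsilon> - s 1) powr \<alpha> = u \<epsilon> (\<phi> b)" "(1 + \<epsilon> - s 0) powr \<alpha> = u \<epsilon> (\<phi> a)"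
      by (simp_all add: u_def s_def \<psi>_def cmod_power2)
    ultimately show ?thesis by (simp add: abs_minus_commute)
  qed
  have lim: "((\<lambda>\<epsilon>. u \<epsilon> (\<phi> z)) \<longlongrightarrow> dD (\<phi> z) powr \<alpha>) (at_right 0)" if "z \<in> ball 0 1" for z
  proof -
    have "((\<lambda>\<epsilon>. u \<epsilon> (\<phi> z)) \<longlongrightarrow> (1 + 0 - sqrt ((cmod (\<phi> z))\<^sup>2 + 0\<^sup>2)) powr \<alpha>) (at_right 0)"
      unfolding u_def using \<phi>b[OF that] by (intro tendsto_intros) auto
    then show ?thesis by (simp add: dD_def)
  qed
  show ?thesis
  proof (rule tendsto_upperbound)
    show "((\<lambda>\<epsilon>. \<bar>u \<epsilon> (\<phi> a) - u \<epsilon> (\<phi> b)\<bar>) \<longlongrightarrow> \<bar>dD (\<phi> a) powr \<alpha> - dD (\<phi> b) powr \<alpha>\<bar>) (at_right 0)"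
      by (intro tendsto_intros lim a b)
    show "\<forall>\<^sub>F \<epsilon> in at_right 0. \<bar>u \<epsilon> (\<phi> a) - u \<epsilon> (\<phi> b)\<bar> \<le> cmod (b - a) * integral {0..1} ?K"
      using approx by (auto simp: eventually_at_right_field intro!: exI[of _ 1])
  qed simp
qed

section \<open>Harmonic functions as sums of holomorphic and antiholomorphic functions\<close>

text \<open>
  The second difference of \<open>f\<close> over the parallelogram spanned by \<open>sa\<close> and \<open>sb\<close> is symmetric in the two
  directions; the mean value inequality evaluates it as \<open>s^2L(a)(b)\<close> and as \<open>s^2L(b)(a)\<close> up to errors
  that are \<open>o(s^2)\<close>.
\<close>

lemma second_derivative_symmetric:
  fixes f :: "'a::real_normed_vector \<Rightarrow> 'b::banach"
    and f' :: "'a \<Rightarrow> 'a \<Rightarrow>\<^sub>L 'b" and L :: "'a \<Rightarrow>\<^sub>L 'a \<Rightarrow>\<^sub>L 'b"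
  assumes S: "open S" "z \<in> S"
    and f: "\<And>w. w \<in> S \<Longrightarrow> (f has_derivative blinfun_apply (f' w)) (at w)"
    and f': "(f' has_derivative blinfun_apply L) (at z)"
  shows "blinfun_apply (blinfun_apply L a) b = blinfun_apply (blinfun_apply L b) a"
proof -
  define c where "c = norm a + norm b + 1"
  have c: "0 < c" by (simp add: c_def add_nonneg_pos)
  have eps: "norm (L a b - L b a) \<le> 4 * \<epsilon> * c\<^sup>2" if \<epsilon>: "0 < \<epsilon>" for \<epsilon>
  proof -
    obtain d1 where d1: "0 < d1" "ball z d1 \<subseteq> S" using S openE by blast
    have nearS: "z + v \<in> S" if "norm v < d1" for v
      using subsetD[OF d1(2), of "z + v"] that by (simp add: dist_norm)
    obtain d2 where d2: "0 < d2" "\<And>y. norm (y - z) < d2 \<Longrightarrow> norm (f' y - f' z - L (y - z)) \<le> \<epsilon> * norm (y - z)"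
      using f' \<epsilon> unfolding has_derivative_at_alt by blast
    define s where "s = min d1 d2 / (2 * c)"
    have s: "0 < s" using d1 d2 c by (simp add: s_def)
    have sc: "s * c < d1" "s * c < d2" using d1 d2 c by (auto simp: s_def min_def)
    define \<Delta> where "\<Delta> = f (z + s *\<^sub>R a + s *\<^sub>R b) - f (z + s *\<^sub>R a) - f (z + s *\<^sub>R b) + f z"
    \<comment> \<open>The difference of \<open>f\<close> in direction \<open>y\<close> is differentiated along direction \<open>x\<close>.\<close>
    have half: "norm (f (z + s *\<^sub>R y + s *\<^sub>R x) - f (z + s *\<^sub>R x) - f (z + s *\<^sub>R y) + f z - (s * s) *\<^sub>R L y x) \<le> 2 * \<epsilon> * (s * c)\<^sup>2"
      if xy: "norm x + norm y \<le> c" for x y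
    proof -
      have pt: "norm (r *\<^sub>R y + t *\<^sub>R x) \<le> s * c" if "0 \<le> r" "r \<le> s" "0 \<le> t" "t \<le> s" for r t
      proof -
        have "norm (r *\<^sub>R y + t *\<^sub>R x) \<le> r * norm y + t * norm x"
          using norm_triangle_ineq[of "r *\<^sub>R y" "t *\<^sub>R x"] that by simp
        also have "\<dots> \<le> s * norm y + s * norm x" using that by (intro add_mono mult_right_mono) auto
        also have "\<dots> = s * (norm x + norm y)" by (simp add: algebra_simps)
        also have "\<dots> \<le> s * c" using xy s by (intro mult_left_mono) auto
        finally show ?thesis .
      qed
      let ?g = "\<lambda>t. f (z + (s *\<^sub>R y + (t * s) *\<^sub>R x)) - f (z + (0 *\<^sub>R y + (t * s) *\<^sub>R x)) - (t * (s * s)) *\<^sub>R L y x"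
      let ?g' = "\<lambda>t. f' (z + (s *\<^sub>R y + (t * s) *\<^sub>R x)) (s *\<^sub>R x) - f' (z + (0 *\<^sub>R y + (t * s) *\<^sub>R x)) (s *\<^sub>R x) - (s * s) *\<^sub>R L y x"
      have "norm (?g 1 - ?g 0) \<le> integral {0..1::real} (\<lambda>_. 2 * \<epsilon> * (s * c)\<^sup>2)"
      proof (rule norm_diff_le_integral_deriv[where g = ?g and g' = ?g' and k = "\<lambda>_. 2 * \<epsilon> * (s * c)\<^sup>2"])
        fix t :: real assume t: "0 \<le> t" "t \<le> 1"
        then have ts: "0 \<le> t * s" "t * s \<le> s" using s by (auto simp: mult_left_le_one_le)
        have inS: "z + (r *\<^sub>R y + (t * s) *\<^sub>R x) \<in> S" if "0 \<le> r" "r \<le> s" for r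
          by (rule nearS, rule le_less_trans[OF pt[OF that ts] sc(1)])
        have path: "((\<lambda>t. f (z + (r *\<^sub>R y + (t * s) *\<^sub>R x))) has_vector_derivative f' (z + (r *\<^sub>R y + (t * s) *\<^sub>R x)) (s *\<^sub>R x)) (at t within {0..1})"
          if r: "0 \<le> r" "r \<le> s" for r
        proof -
          have "((\<lambda>t. z + (r *\<^sub>R y + (t * s) *\<^sub>R x)) has_vector_derivative s *\<^sub>R x) (at t within {0..1})"
            unfolding has_vector_derivative_def by (auto intro!: derivative_eq_intros)
          from vector_derivative_diff_chain_within[OF this has_derivative_at_withinI[OF f[OF inS[OF r]]]]
          show ?thesis by (simp add: o_def)
        qed
        have lin: "((\<lambda>t. (t * (s * s)) *\<^sub>R L y x) has_vector_derivative (s * s) *\<^sub>R L y x) (at t within {0..1})"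
          unfolding has_vector_derivative_def by (auto intro!: derivative_eq_intros)
        show "(?g has_vector_derivative ?g' t) (at t within {0..1})"
          using s by (intro has_vector_derivative_diff path lin) auto
        define y1 where "y1 = s *\<^sub>R y + (t * s) *\<^sub>R x"
        define y2 where "y2 = 0 *\<^sub>R y + (t * s) *\<^sub>R x"
        have "norm y1 \<le> s * c" unfolding y1_def by (rule pt) (use ts s in auto)
        moreover have "norm y2 \<le> s * c" unfolding y2_def by (rule pt) (use ts s in auto)
        moreover have "norm (f' (z + v) - f' z - L v) \<le> \<epsilon> * (s * c)" if "norm v \<le> s * c" for v
          using d2(2)[of "z + v"] that sc(2) \<epsilon> by (auto elim!: order_trans)
        ultimately have "norm (f' (z + y1) - f' z - L y1) \<le> \<epsilon> * (s * c)" "norm (f' (z + y2) - f' z - L y2) \<le> \<epsilon> * (s * c)"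
          by blast+
        then have "norm ((f' (z + y1) - f' z - L y1) - (f' (z + y2) - f' z - L y2)) \<le> 2 * \<epsilon> * (s * c)"
          using norm_triangle_ineq4[of "f' (z + y1) - f' z - L y1" "f' (z + y2) - f' z - L y2"] by linarith
        moreover have "norm (s *\<^sub>R x) \<le> s * c"
        proof -
          have "norm x \<le> c" using xy norm_ge_zero[of y] by linarith
          then show ?thesis using s by simp
        qed
        ultimately have "norm (((f' (z + y1) - f' z - L y1) - (f' (z + y2) - f' z - L y2)) (s *\<^sub>R x)) \<le> 2 * \<epsilon> * (s * c) * (s * c)"
          using s c \<epsilon> by (intro order_trans[OF norm_blinfun mult_mono]) auto
        moreover have "((f' (z + y1) - f' z - L y1) - (f' (z + y2) - f' z - L y2)) (s *\<^sub>R x) = ?g' t"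
          unfolding y1_def y2_def
          by (simp add: blinfun.bilinear_simps scaleR_right_diff_distrib)
        ultimately show "norm (?g' t) \<le> 2 * \<epsilon> * (s * c)\<^sup>2" by (simp add: power2_eq_square mult.assoc)
      qed simp
      then show ?thesis by (simp add: algebra_simps)
    qed
    have "norm (\<Delta> - (s * s) *\<^sub>R L a b) \<le> 2 * \<epsilon> * (s * c)\<^sup>2"
      using half[of b a] by (simp add: \<Delta>_def c_def algebra_simps)
    moreover have "norm (\<Delta> - (s * s) *\<^sub>R L b a) \<le> 2 * \<epsilon> * (s * c)\<^sup>2"
      using half[of a b] by (simp add: \<Delta>_def c_def algebra_simps)
    ultimately have "norm ((\<Delta> - (s * s) *\<^sub>R L b a) - (\<Delta> - (s * s) *\<^sub>R L a b)) \<le> 4 * \<epsilon> * (s * c)\<^sup>2"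
      using norm_triangle_ineq4[of "\<Delta> - (s * s) *\<^sub>R L b a" "\<Delta> - (s * s) *\<^sub>R L a b"] by linarith
    moreover have "(\<Delta> - (s * s) *\<^sub>R L b a) - (\<Delta> - (s * s) *\<^sub>R L a b) = (s * s) *\<^sub>R (L a b - L b a)"
      by (simp add: scaleR_right_diff_distrib)
    ultimately have "(s * s) * norm (L a b - L b a) \<le> (s * s) * (4 * \<epsilon> * c\<^sup>2)"
      by (simp add: power_mult_distrib power2_eq_square mult_ac)
    then show ?thesis using s by (subst (asm) mult_le_cancel_left_pos) auto
  qed
  have lim: "norm (L a b - L b a) \<le> 0 + \<epsilon>" if "0 < \<epsilon>" for \<epsilon>
    using eps[of "\<epsilon> / (4 * c\<^sup>2)"] that c by simp
  then show ?thesis using field_le_epsilon[of "norm (L a b - L b a)" 0] by simp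
qed

text \<open>
  By harmonicity and symmetry of the second derivative \<open>f_z=(f_x-if_y)/2\<close> satisfies the Cauchy--Riemann
  equations, so it has a holomorphic primitive \<open>F\<close> on the disk. The remainder \<open>f-F\<close> has vanishing
  \<open>z\<close>-derivative, which makes its conjugate holomorphic.
\<close>

lemma harmonic_disk_decompose:
  assumes "f \<in> harmonic_disk"
  obtains F G where "F holomorphic_on ball 0 1" "G holomorphic_on ball 0 1"
    "\<And>z. z \<in> ball 0 1 \<Longrightarrow> f z = F z + cnj (G z)"
proof -
  obtain f' :: "complex \<Rightarrow> complex \<Rightarrow>\<^sub>L complex" and f'' :: "complex \<Rightarrow> complex \<Rightarrow>\<^sub>L complex \<Rightarrow>\<^sub>L complex" where
    f': "\<And>z. z \<in> ball 0 1 \<Longrightarrow> (f has_derivative blinfun_apply (f' z)) (at z)" and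
    f'': "\<And>z. z \<in> ball 0 1 \<Longrightarrow> (f' has_derivative blinfun_apply (f'' z)) (at z)" and
    lap: "\<And>z. z \<in> ball 0 1 \<Longrightarrow> blinfun_apply (blinfun_apply (f'' z) 1) 1 + blinfun_apply (blinfun_apply (f'' z) \<i>) \<i> = 0"
    using assms unfolding harmonic_disk_def by blast
  have xy: "h = Re h *\<^sub>R 1 + Im h *\<^sub>R \<i>" for h :: complex
    by (simp add: complex_eq_iff)
  define P where "P = (\<lambda>z. (f' z 1 - \<i> * f' z \<i>) / 2)"
  have dP: "\<exists>D. (P has_field_derivative D) (at z)" if z: "z \<in> ball 0 1" for z
  proof -
    have sym: "f'' z \<i> 1 = f'' z 1 \<i>"
      by (rule second_derivative_symmetric[OF open_ball z f' f''[OF z]])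
    have lap': "f'' z \<i> \<i> = - f'' z 1 1" using lap[OF z] by (simp add: eq_neg_iff_add_eq_0 add.commute)
    have ap: "((\<lambda>w. f' w v) has_derivative (\<lambda>h. f'' z h v)) (at z)" for v
      using bounded_linear.has_derivative[OF blinfun.bounded_linear_left f''[OF z]] .
    have d: "(P has_derivative (\<lambda>h. (f'' z h 1 - \<i> * f'' z h \<i>) / 2)) (at z)"
      unfolding P_def
      by (rule bounded_linear.has_derivative[OF bounded_linear_divide has_derivative_diff[OF ap has_derivative_mult_right[OF ap]]])
    have eq: "(f'' z h 1 - \<i> * f'' z h \<i>) / 2 = (f'' z 1 1 - \<i> * f'' z 1 \<i>) / 2 * h" for h
    proof -
      have e: "f'' z h v = Re h *\<^sub>R f'' z 1 v + Im h *\<^sub>R f'' z \<i> v" for v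
        by (subst xy[of h], simp only: blinfun.bilinear_simps)
      have h: "h = of_real (Re h) + \<i> * of_real (Im h)" by (simp add: complex_eq_iff)
      show ?thesis
        by (subst (3) h) (simp add: e sym lap' scaleR_conv_of_real algebra_simps flip: diff_divide_distrib add_divide_distrib)
    qed
    have "(P has_field_derivative (f'' z 1 1 - \<i> * f'' z 1 \<i>) / 2) (at z)"
      unfolding has_field_derivative_def by (rule has_derivative_eq_rhs[OF d ext[OF eq]])
    then show ?thesis ..
  qed
  then have "P holomorphic_on ball 0 1"
    by (auto simp: holomorphic_on_open)
  then obtain F where F: "\<And>z. z \<in> ball 0 1 \<Longrightarrow> (F has_field_derivative P z) (at z)"
    using holomorphic_convex_primitive'[OF convex_ball open_ball] by (metis at_within_open open_ball)
  define G where "G = (\<lambda>z. cnj (f z - F z))"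
  have "(G has_field_derivative cnj ((f' z 1 + \<i> * f' z \<i>) / 2)) (at z)" if z: "z \<in> ball 0 1" for z
  proof -
    have "((\<lambda>w. f w - F w) has_derivative (\<lambda>h. f' z h - P z * h)) (at z)"
      using has_derivative_diff[OF f'[OF z] F[OF z, unfolded has_field_derivative_def]] .
    from bounded_linear.has_derivative[OF bounded_linear_cnj this]
    have "(G has_derivative (\<lambda>h. cnj (f' z h - P z * h))) (at z)" unfolding G_def .
    moreover have "cnj (f' z h - P z * h) = cnj ((f' z 1 + \<i> * f' z \<i>) / 2) * h" for h
    proof -
      have e: "f' z h = of_real (Re h) * f' z 1 + of_real (Im h) * f' z \<i>"
        unfolding scaleR_conv_of_real[symmetric] by (subst xy[of h], simp only: blinfun.bilinear_simps)
      have h: "h = of_real (Re h) + \<i> * of_real (Im h)" "cnj h = of_real (Re h) - \<i> * of_real (Im h)"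
        by (simp_all add: complex_eq_iff)
      have "f' z h - P z * h = (f' z 1 + \<i> * f' z \<i>) / 2 * cnj h"
        unfolding e P_def h(2) by (subst (3) h(1)) (simp add: field_simps)
      then show ?thesis by (simp only: complex_cnj_mult complex_cnj_cnj)
    qed
    ultimately show ?thesis unfolding has_field_derivative_def by (simp only:)
  qed
  then have "G holomorphic_on ball 0 1" unfolding holomorphic_on_open[OF open_ball] by blast
  moreover have "F holomorphic_on ball 0 1" using F unfolding holomorphic_on_open[OF open_ball] by blast
  ultimately show ?thesis by (intro that[of F G]) (auto simp: G_def)
qed

lemma harmonic_disk_holomorphic_sum:
  assumes F: "F holomorphic_on ball 0 1" and G: "G holomorphic_on ball 0 1"
    and f: "\<And>z. z \<in> ball 0 1 \<Longrightarrow> f z = F z + cnj (G z)"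
  shows "f \<in> harmonic_disk"
proof -
  let ?mul = "blinfun_mult_right :: complex \<Rightarrow> complex \<Rightarrow>\<^sub>L complex"
  define cj :: "complex \<Rightarrow>\<^sub>L complex" where "cj = Blinfun cnj"
  have cj: "blinfun_apply cj = cnj" unfolding cj_def by (rule bounded_linear_Blinfun_apply[OF bounded_linear_cnj])
  define cm where "cm = (\<lambda>x. cj o\<^sub>L ?mul x)"
  have blm: "bounded_linear ?mul" by (rule bounded_linear_blinfun_mult_right)
  have blc: "bounded_linear cm" unfolding cm_def
    by (rule bounded_linear_compose[OF bounded_bilinear.bounded_linear_right[OF bounded_bilinear_blinfun_compose] blm])
  have mul: "blinfun_apply (?mul x) h = x * h" for x h by (simp add: blinfun_mult_right.rep_eq)
  have cm: "blinfun_apply (cm x) h = cnj (x * h)" for x h by (simp add: cm_def cj mul)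
  define f' where "f' = (\<lambda>z. ?mul (deriv F z) + cm (deriv G z))"
  define f'' where "f'' = (\<lambda>z. (Blinfun ?mul o\<^sub>L ?mul (deriv (deriv F) z)) + (Blinfun cm o\<^sub>L ?mul (deriv (deriv G) z)))"
  have F1: "deriv F holomorphic_on ball 0 1" and G1: "deriv G holomorphic_on ball 0 1"
    using F G by (auto intro: holomorphic_deriv)
  have F2: "deriv (deriv F) holomorphic_on ball 0 1" and G2: "deriv (deriv G) holomorphic_on ball 0 1"
    using F1 G1 by (auto intro: holomorphic_deriv)
  have app: "blinfun_apply (blinfun_apply (f'' z) h) k = deriv (deriv F) z * h * k + cnj (deriv (deriv G) z * h * k)" for z h k
    unfolding f''_def by (simp add: blinfun.bilinear_simps bounded_linear_Blinfun_apply[OF blm] bounded_linear_Blinfun_apply[OF blc] mul cm)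
  have cont: "continuous_on (ball 0 1) f''"
    unfolding f''_def
    by (intro continuous_intros bounded_linear.continuous_on[OF blm] holomorphic_on_imp_continuous_on F2 G2
        bounded_bilinear.continuous_on[OF bounded_bilinear_blinfun_compose])
  have "(f has_derivative blinfun_apply (f' z)) (at z) \<and> (f' has_derivative blinfun_apply (f'' z)) (at z) \<and>
      blinfun_apply (blinfun_apply (f'' z) 1) 1 + blinfun_apply (blinfun_apply (f'' z) \<i>) \<i> = 0" if z: "z \<in> ball 0 1" for z
  proof (intro conjI)
    have "((\<lambda>z. F z + cnj (G z)) has_derivative (\<lambda>h. deriv F z * h + cnj (deriv G z * h))) (at z)"
      using holomorphic_derivI[OF F open_ball z] holomorphic_derivI[OF G open_ball z]
      unfolding has_field_derivative_def
      by (intro has_derivative_add bounded_linear.has_derivative[OF bounded_linear_cnj])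
    then have "(f has_derivative (\<lambda>h. deriv F z * h + cnj (deriv G z * h))) (at z)"
      by (rule has_derivative_transform_within_open[OF _ open_ball z]) (simp add: f)
    moreover have "blinfun_apply (f' z) = (\<lambda>h. deriv F z * h + cnj (deriv G z * h))"
      by (auto simp: f'_def blinfun.bilinear_simps mul cm)
    ultimately show "(f has_derivative blinfun_apply (f' z)) (at z)" by simp
    have "(f' has_derivative (\<lambda>h. ?mul (deriv (deriv F) z * h) + cm (deriv (deriv G) z * h))) (at z)"
      using holomorphic_derivI[OF F1 open_ball z] holomorphic_derivI[OF G1 open_ball z]
      unfolding has_field_derivative_def f'_def
      by (intro has_derivative_add bounded_linear.has_derivative[OF blm] bounded_linear.has_derivative[OF blc])
    moreover have "blinfun_apply (f'' z) = (\<lambda>h. ?mul (deriv (deriv F) z * h) + cm (deriv (deriv G) z * h))"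
      unfolding f''_def by (auto simp: blinfun.bilinear_simps bounded_linear_Blinfun_apply[OF blm] bounded_linear_Blinfun_apply[OF blc] mul)
    ultimately show "(f' has_derivative blinfun_apply (f'' z)) (at z)" by simp
    show "blinfun_apply (blinfun_apply (f'' z) 1) 1 + blinfun_apply (blinfun_apply (f'' z) \<i>) \<i> = 0"
      unfolding app by (simp add: mult.assoc)
  qed
  then show ?thesis unfolding harmonic_disk_def using cont by blast
qed

section \<open>Lacunary test functions\<close>

lemma geometric_sum_le:
  fixes x :: real
  assumes "0 \<le> x" "x < 1"
  shows "(\<Sum>i<n. x ^ i) \<le> 1 / (1 - x)"
proof -
  have "(\<Sum>i<n. x ^ i) \<le> (\<Sum>i. x ^ i)"
    using assms by (intro sum_le_suminf summable_geometric) auto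
  then show ?thesis using assms by (simp add: suminf_geometric)
qed

lemma dyadic_scale:
  assumes "0 < d" "d \<le> (1::real)"
  obtains m :: nat where "2 powr - (real m + 1) < d" "d \<le> 2 powr - real m"
proof
  define m where "m = nat \<lfloor>- log 2 d\<rfloor>"
  have "log 2 d \<le> 0" using assms by simp
  then have m: "real m \<le> - log 2 d" "- log 2 d < real m + 1"
    unfolding m_def by linarith+
  have d: "d = 2 powr (log 2 d)" using assms by simp
  show "2 powr - (real m + 1) < d" using m by (subst d) (simp add: powr_less_mono)
  show "d \<le> 2 powr - real m" using m by (subst d) (simp add: powr_mono)
qed

text \<open>
  The term \<open>2^(-\<alpha> e)w^(2^e)\<close> varies by at most \<open>min(2\<cdot> 2^(-\<alpha> e), 2^((1-\<alpha>)e)|z-w|)\<close>. Its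
  derivative is largest, compared with that of the other terms, where \<open>1-|w|\<close> is about \<open>2^(-e)\<close>.
\<close>

definition lacunary_term :: "real \<Rightarrow> nat \<Rightarrow> complex \<Rightarrow> complex" where
  "lacunary_term \<alpha> e w = of_real (2 powr (- \<alpha> * real e)) * w ^ (2 ^ e)"

definition lacunary_term_deriv :: "real \<Rightarrow> nat \<Rightarrow> complex \<Rightarrow> complex" where
  "lacunary_term_deriv \<alpha> e w = of_real (2 powr ((1 - \<alpha>) * real e)) * w ^ (2 ^ e - 1)"

lemma lacunary_term_has_derivative:
  "(lacunary_term \<alpha> e has_field_derivative lacunary_term_deriv \<alpha> e w) (at w)"
proof -
  have "(lacunary_term \<alpha> e has_field_derivative of_real (2 powr (- \<alpha> * real e)) * (of_nat (2 ^ e) * w ^ (2 ^ e - 1))) (at w)"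
    unfolding lacunary_term_def by (auto intro!: derivative_eq_intros)
  moreover have "2 powr ((1 - \<alpha>) * real e) = 2 powr (- \<alpha> * real e) * 2 ^ e"
    by (simp add: powr_add[symmetric] powr_realpow[symmetric] algebra_simps)
  ultimately show ?thesis
    unfolding lacunary_term_deriv_def by (simp add: mult.assoc)
qed

lemma lacunary_term_diff_le:
  assumes z: "cmod z < 1" and w: "cmod w < 1"
  shows "cmod (lacunary_term \<alpha> e z - lacunary_term \<alpha> e w) \<le> 2 * 2 powr (- \<alpha> * real e)"
    and "cmod (lacunary_term \<alpha> e z - lacunary_term \<alpha> e w) \<le> 2 powr ((1 - \<alpha>) * real e) * cmod (z - w)"
proof -
  have eq: "cmod (lacunary_term \<alpha> e z - lacunary_term \<alpha> e w) = 2 powr (- \<alpha> * real e) * cmod (z ^ (2 ^ e) - w ^ (2 ^ e))"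
    by (simp add: lacunary_term_def norm_mult flip: right_diff_distrib)
  have "cmod (z ^ (2 ^ e) - w ^ (2 ^ e)) \<le> cmod (z ^ (2 ^ e)) + cmod (w ^ (2 ^ e))" by (rule norm_triangle_ineq4)
  also have "\<dots> \<le> 1 + 1" using z w by (intro add_mono) (auto simp: norm_power power_le_one)
  finally show "cmod (lacunary_term \<alpha> e z - lacunary_term \<alpha> e w) \<le> 2 * 2 powr (- \<alpha> * real e)"
    unfolding eq by (simp add: mult.commute mult_left_mono)
  have "cmod (z ^ (2 ^ e) - w ^ (2 ^ e)) \<le> real (2 ^ e) * cmod (z - w)"
    using z w by (intro norm_power_diff) auto
  then have "2 powr (- \<alpha> * real e) * cmod (z ^ (2 ^ e) - w ^ (2 ^ e)) \<le> 2 powr (- \<alpha> * real e) * (2 ^ e * cmod (z - w))"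
    by (intro mult_left_mono) auto
  also have "\<dots> = 2 powr ((1 - \<alpha>) * real e) * cmod (z - w)"
    by (simp add: powr_add[symmetric] powr_realpow[symmetric] algebra_simps)
  finally show "cmod (lacunary_term \<alpha> e z - lacunary_term \<alpha> e w) \<le> 2 powr ((1 - \<alpha>) * real e) * cmod (z - w)"
    unfolding eq .
qed

text \<open>
  If \<open>|z-w|\<close> has size \<open>2^(-m)\<close>, the terms with \<open>e\<le> m\<close> are bounded by their derivatives and those with
  \<open>e>m\<close> by their sizes; both bounds decay geometrically away from \<open>e=m\<close>, where they are comparable to
  \<open>|z-w|^\<alpha>\<close>.
\<close>

lemma lacunary_sum_diff_le:
  assumes \<alpha>: "0 < \<alpha>" "\<alpha> < 1" and z: "cmod z < 1" and w: "cmod w < 1"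
  shows "(\<Sum>e<n. cmod (lacunary_term \<alpha> e z - lacunary_term \<alpha> e w)) \<le>
    (1 / (1 - 2 powr - (1 - \<alpha>)) + 4 / (1 - 2 powr - \<alpha>)) * cmod (z - w) powr \<alpha>"
proof (cases "z = w")
  case False
  define x where "x = (2::real) powr - (1 - \<alpha>)"
  define y where "y = (2::real) powr - \<alpha>"
  define h where "h = cmod (z - w)"
  define B where "B = (\<lambda>e. cmod (lacunary_term \<alpha> e z - lacunary_term \<alpha> e w))"
  have x: "0 < x" "x < 1" and y: "0 < y" "y < 1"
    unfolding x_def y_def using \<alpha> by (auto simp: powr_less_one)
  have h: "0 < h" using False by (simp add: h_def)
  have xpow: "x ^ k = 2 powr (- (1 - \<alpha>) * real k)" and ypow: "y ^ k = 2 powr (- \<alpha> * real k)" for k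
    by (simp_all add: x_def y_def powr_realpow[symmetric] powr_powr)
  have B0: "0 \<le> B e" for e by (simp add: B_def)
  have B1: "B e \<le> 2 * y ^ e" for e unfolding B_def ypow using lacunary_term_diff_le(1)[OF z w] .
  have B2: "B e \<le> 2 powr ((1 - \<alpha>) * real e) * h" for e unfolding B_def h_def using lacunary_term_diff_le(2)[OF z w] .
  have "sum B {..<n} \<le> (1 / (1 - x) + 4 / (1 - y)) * h powr \<alpha>"
  proof (cases "h \<le> 1")
    case True
    obtain m where m: "2 powr - (real m + 1) < h" "h \<le> 2 powr - real m"
      using dyadic_scale[OF h True] .
    have low: "B e \<le> h powr \<alpha> * x ^ (m - e)" if "e \<le> m" for e
    proof -
      have "2 powr ((1 - \<alpha>) * real m) * h powr (1 - \<alpha>) \<le> 2 powr ((1 - \<alpha>) * real m) * (2 powr - real m) powr (1 - \<alpha>)"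
        using m h \<alpha> by (intro mult_left_mono powr_mono2) auto
      also have "\<dots> = 1" by (simp add: powr_powr powr_add[symmetric] algebra_simps)
      finally have *: "2 powr ((1 - \<alpha>) * real m) * h powr (1 - \<alpha>) \<le> 1" .
      have "2 powr ((1 - \<alpha>) * real e) * h = x ^ (m - e) * (2 powr ((1 - \<alpha>) * real m) * h powr (1 - \<alpha>)) * h powr \<alpha>"
      proof -
        have "2 powr ((1 - \<alpha>) * real e) = x ^ (m - e) * 2 powr ((1 - \<alpha>) * real m)"
          unfolding xpow powr_add[symmetric] using that by (simp add: of_nat_diff algebra_simps)
        moreover have "h = h powr (1 - \<alpha>) * h powr \<alpha>" using h by (simp add: powr_add[symmetric])
        ultimately show ?thesis by (metis mult.assoc)
      qed
      also have "\<dots> \<le> x ^ (m - e) * 1 * h powr \<alpha>"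
        using * x by (intro mult_right_mono mult_left_mono) auto
      finally show ?thesis using B2[of e] by (simp add: mult.commute)
    qed
    have high: "B (k + Suc m) \<le> 4 * h powr \<alpha> * y ^ k" for k
    proof -
      have "(2 powr - (real m + 1)) powr \<alpha> \<le> h powr \<alpha>" using m \<alpha> by (intro powr_mono2) auto
      then have "y ^ Suc m \<le> h powr \<alpha>" unfolding ypow powr_powr by (simp add: algebra_simps)
      then have "2 * (y ^ k * y ^ Suc m) \<le> 2 * (y ^ k * h powr \<alpha>)" using y by (intro mult_left_mono) auto
      also have "\<dots> \<le> 4 * (y ^ k * h powr \<alpha>)" using y by simp
      finally show ?thesis using B1[of "k + Suc m"] by (simp add: power_add mult_ac)
    qed
    have "sum B {..<n} \<le> sum B {..<Suc m + n}"
      using B0 by (intro sum_mono2) auto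
    also have "\<dots> = sum B {..<Suc m} + (\<Sum>k<n. B (k + Suc m))"
      by (induction n) (auto simp: add.commute)
    also have "\<dots> \<le> (\<Sum>e<Suc m. h powr \<alpha> * x ^ (Suc m - Suc e)) + (\<Sum>k<n. 4 * h powr \<alpha> * y ^ k)"
      using low high by (intro add_mono sum_mono) auto
    also have "\<dots> = h powr \<alpha> * (\<Sum>e<Suc m. x ^ e) + 4 * h powr \<alpha> * (\<Sum>k<n. y ^ k)"
      unfolding sum_distrib_left[symmetric] sum.nat_diff_reindex ..
    also have "\<dots> \<le> h powr \<alpha> * (1 / (1 - x)) + 4 * h powr \<alpha> * (1 / (1 - y))"
      using x y by (intro add_mono mult_left_mono geometric_sum_le) auto
    finally show ?thesis by (simp add: algebra_simps)
  next
    case False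
    then have h1: "1 \<le> h powr \<alpha>" using \<alpha> by (intro ge_one_powr_ge_zero) auto
    have "sum B {..<n} \<le> (\<Sum>e<n. 2 * y ^ e)" by (intro sum_mono B1)
    also have "\<dots> \<le> 2 * (1 / (1 - y))" using geometric_sum_le[of y n] y by (simp flip: sum_distrib_left)
    also have "\<dots> \<le> (1 / (1 - x) + 4 / (1 - y)) * 1"
    proof -
      have "2 * (1 / (1 - y)) \<le> 4 / (1 - y)" using y by (simp add: divide_right_mono)
      also have "\<dots> \<le> (1 / (1 - x) + 4 / (1 - y)) * 1" using x by simp
      finally show ?thesis .
    qed
    also have "\<dots> \<le> (1 / (1 - x) + 4 / (1 - y)) * h powr \<alpha>" using h1 x y by (intro mult_left_mono) auto
    finally show ?thesis .
  qed
  then show ?thesis by (simp add: B_def x_def y_def h_def)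
qed simp

text \<open>
  At distance more than \<open>2^(-(m+1))\<close> from the boundary \<open>|w|^(2^(m+l)-1) \<le> e^(-y)\<close> with \<open>y=2^(l-2)\<close>, and
  \<open>e^(-y)\<le> 2/y^2\<close> beats the growth of the coefficient \<open>2^((1-\<alpha>)l)\<close>.
\<close>

lemma lacunary_term_deriv_high:
  assumes \<alpha>: "0 < \<alpha>" "\<alpha> < 1" and w: "2 powr - (real m + 1) < 1 - cmod w" and l: "1 \<le> l"
  shows "cmod (lacunary_term_deriv \<alpha> (m + l) w) \<le> 2 powr ((1 - \<alpha>) * real m) * (32 * 2 powr (- (1 - \<alpha>) * real l))"
proof -
  define n where "n = (2::nat) ^ (m + l) - 1"
  define y where "y = (2::real) powr (real l - 2)"
  have n: "2 powr (real (m + l) - 1) \<le> real n"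
  proof -
    have "(2::nat) ^ (m + l - 1) * 2 = 2 ^ (m + l)" using l by (cases l) auto
    moreover have "(1::nat) \<le> 2 ^ (m + l - 1)" by simp
    ultimately have "(2::nat) ^ (m + l - 1) \<le> n" unfolding n_def by linarith
    then have "real (2 ^ (m + l - 1)) \<le> real n" by (rule of_nat_mono)
    moreover have "2 powr (real (m + l) - 1) = real (2 ^ (m + l - 1))"
      using l by (simp add: powr_realpow[symmetric] of_nat_diff)
    ultimately show ?thesis by simp
  qed
  have "cmod w \<le> 1 - 2 powr - (real m + 1)" using w by simp
  also have "\<dots> \<le> exp (- (2 powr - (real m + 1)))" using exp_ge_add_one_self[of "- (2 powr - (real m + 1))"] by simp
  finally have "cmod w ^ n \<le> exp (- (2 powr - (real m + 1))) ^ n" by (intro power_mono) auto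
  also have "\<dots> = exp (- (real n * 2 powr - (real m + 1)))" by (simp add: exp_of_nat_mult[symmetric])
  also have "\<dots> \<le> exp (- y)"
  proof -
    have "y = 2 powr (real (m + l) - 1) * 2 powr - (real m + 1)"
      by (simp add: y_def powr_add[symmetric])
    also have "\<dots> \<le> real n * 2 powr - (real m + 1)" using n by (intro mult_right_mono) auto
    finally show ?thesis by simp
  qed
  also have "\<dots> \<le> 2 / y\<^sup>2"
  proof -
    have y: "0 < y" by (simp add: y_def)
    have "y\<^sup>2 / 2 \<le> exp y" using exp_lower_Taylor_quadratic[of y] y by simp
    then have "1 / exp y \<le> 1 / (y\<^sup>2 / 2)" using y by (intro divide_left_mono) auto
    then show ?thesis by (simp add: exp_minus field_simps)
  qed
  also have "\<dots> = 32 * 2 powr (- 2 * real l)"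
  proof -
    have "y\<^sup>2 = 2 powr (2 * real l - 4)"
      unfolding y_def power2_eq_square powr_add[symmetric] by simp
    then have "2 / y\<^sup>2 = 2 * 2 powr (4 - 2 * real l)"
      using powr_minus_divide[of 2 "2 * real l - 4"] by simp
    also have "\<dots> = 32 * 2 powr (- 2 * real l)" by (simp add: powr_diff powr_minus_divide)
    finally show ?thesis .
  qed
  finally have wn: "cmod w ^ n \<le> 32 * 2 powr (- 2 * real l)" .
  have "cmod (lacunary_term_deriv \<alpha> (m + l) w) = 2 powr ((1 - \<alpha>) * real (m + l)) * cmod w ^ n"
    by (simp add: lacunary_term_deriv_def norm_mult norm_power n_def)
  also have "\<dots> \<le> 2 powr ((1 - \<alpha>) * real (m + l)) * (32 * 2 powr (- 2 * real l))"
    by (intro mult_left_mono wn) auto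
  also have "\<dots> = 32 * 2 powr ((1 - \<alpha>) * real (m + l) + - 2 * real l)"
    unfolding powr_add by simp
  also have "(1 - \<alpha>) * real (m + l) + - 2 * real l = (1 - \<alpha>) * real m + ((1 - \<alpha>) * real l - 2 * real l)"
    by (simp add: algebra_simps)
  also have "32 * 2 powr \<dots> = 2 powr ((1 - \<alpha>) * real m) * (32 * 2 powr ((1 - \<alpha>) * real l - 2 * real l))"
    unfolding powr_add by simp
  also have "\<dots> \<le> 2 powr ((1 - \<alpha>) * real m) * (32 * 2 powr (- (1 - \<alpha>) * real l))"
  proof (intro mult_left_mono powr_mono)
    have "real l * (2 * (1 - \<alpha>)) \<le> real l * 2" using \<alpha> by (intro mult_left_mono) auto
    then show "(1 - \<alpha>) * real l - 2 * real l \<le> - (1 - \<alpha>) * real l" by (simp add: algebra_simps)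
  qed auto
  finally show ?thesis .
qed

text \<open>
  For \<open>n=2^m\<close> and \<open>|w|\<ge> 1-1/n\<close> the power \<open>|w|^(n-1)\<close> is at least \<open>(1-1/n)^(n-1) \<ge> 1/e \<ge> 1/3\<close>.
\<close>

lemma lacunary_term_deriv_main:
  assumes "1 - cmod w \<le> 2 powr - real m" "cmod w < 1"
  shows "2 powr ((1 - \<alpha>) * real m) / 3 \<le> cmod (lacunary_term_deriv \<alpha> m w)"
proof -
  define n where "n = (2::nat) ^ m"
  have n: "1 \<le> n" by (simp add: n_def)
  have w: "1 - 1 / real n \<le> cmod w"
  proof -
    have "2 powr - real m = 1 / real n" by (simp add: n_def powr_minus_divide powr_realpow)
    then show ?thesis using assms by simp
  qed
  have "1 / 3 \<le> cmod w ^ (n - 1)"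
  proof (cases "n = 1")
    case False
    define k where "k = n - 1"
    have k: "0 < k" "n = Suc k" using n False by (auto simp: k_def)
    have "(1 + 1 / real k) ^ k \<le> exp (1 / real k) ^ k"
      using exp_ge_add_one_self[of "1 / real k"] by (intro power_mono) auto
    also have "\<dots> = exp 1" using k by (simp add: exp_of_nat_mult[symmetric])
    also have "\<dots> \<le> 3" by (rule exp_le)
    finally have "1 / 3 \<le> 1 / (1 + 1 / real k) ^ k"
      using k by (intro divide_left_mono) (auto simp: add_pos_nonneg zero_less_power)
    also have "\<dots> = (1 - 1 / real n) ^ k"
      using k by (simp add: power_one_over[symmetric] field_simps)
    also have "\<dots> \<le> cmod w ^ k" using w k by (intro power_mono) auto
    finally show ?thesis by (simp add: k_def)
  qed simp
  then have "2 powr ((1 - \<alpha>) * real m) * (1 / 3) \<le> 2 powr ((1 - \<alpha>) * real m) * cmod w ^ (n - 1)"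
    by (intro mult_left_mono) auto
  then show ?thesis by (simp add: lacunary_term_deriv_def norm_mult norm_power n_def)
qed

text \<open>
  The exponents are distributed over \<open>N\<close> residue classes, one series \<open>f\<^sub>i\<close> for each. At a point \<open>w\<close> with
  \<open>1-|w| \<approx> 2^(-m)\<close> the series that contains the exponent \<open>m\<close> has derivative about \<open>2^((1-\<alpha>)m)\<close>:
  its other exponents differ from \<open>m\<close> by multiples of \<open>N\<close>, and their contributions are geometric with
  ratio \<open>x=2^(-(1-\<alpha>)N)\<close>, negligible once \<open>N\<close> is large. Several functions are unavoidable: if one
  derivative \<open>f'\<close> satisfied such a lower bound everywhere, \<open>1/f'\<close> would be analytic and tend to \<open>0\<close> at the
  boundary, hence vanish identically.
\<close>

lemma lacunary_test_functions:
  assumes \<alpha>: "0 < \<alpha>" "\<alpha> < 1"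
  obtains N :: nat and f :: "nat \<Rightarrow> complex \<Rightarrow> complex" and M :: real where "0 < M"
    "\<And>i. f i holomorphic_on ball 0 1"
    "\<And>i z w. z \<in> ball 0 1 \<Longrightarrow> w \<in> ball 0 1 \<Longrightarrow> cmod (f i z - f i w) \<le> M * cmod (z - w) powr \<alpha>"
    "\<And>w. w \<in> ball 0 1 \<Longrightarrow> \<exists>i<N. (1 - cmod w) powr (\<alpha> - 1) / 8 \<le> cmod (deriv (f i) w)"
proof -
  define M where "M = 1 / (1 - 2 powr - (1 - \<alpha>)) + 4 / (1 - 2 powr - \<alpha>)"
  have x1: "2 powr - (1 - \<alpha>) < (1::real)" "2 powr - \<alpha> < (1::real)" using \<alpha> by (auto simp: powr_less_one)
  have M: "0 < M" unfolding M_def using x1 by (intro add_pos_pos) auto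
  \<comment> \<open>With \<open>x<1/1000\<close> the other terms add up to at most a quarter of the main term.\<close>
  obtain N0 :: nat where N0: "(2 powr - (1 - \<alpha>)) ^ N0 < (1 / 1000 :: real)"
    using real_arch_pow_inv[of "1/1000" "2 powr - (1 - \<alpha>)"] x1 by auto
  define N where "N = Suc N0"
  have Npos: "N \<noteq> 0" by (simp add: N_def)
  define x where "x = (2::real) powr (- (1 - \<alpha>) * real N)"
  have x: "0 < x" "x < 1 / 1000"
  proof -
    have "x = (2 powr - (1 - \<alpha>)) ^ N0 * 2 powr - (1 - \<alpha>)"
      by (simp add: x_def N_def powr_realpow[symmetric] powr_powr powr_add[symmetric] algebra_simps)
    also have "\<dots> \<le> (2 powr - (1 - \<alpha>)) ^ N0 * 1" using x1 by (intro mult_left_mono) auto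
    finally show "x < 1 / 1000" using N0 by simp
  qed (simp add: x_def)
  have xpow: "x ^ k = 2 powr (- (1 - \<alpha>) * real (k * N))" for k
    by (simp add: x_def powr_realpow[symmetric] powr_powr mult_ac)
  define e where "e = (\<lambda>i j. j * N + i :: nat)"
  have einj: "inj_on (e i) A" for i A by (auto simp: e_def inj_on_def Npos)
  have "\<exists>g g'. \<forall>w\<in>ball 0 1. (\<lambda>j. lacunary_term \<alpha> (e i j) w) sums g w \<and> (\<lambda>j. lacunary_term_deriv \<alpha> (e i j) w) sums g' w
      \<and> (g has_field_derivative g' w) (at w)" for i
  proof -
    have sm: "summable (\<lambda>j. (2 powr - \<alpha>) ^ j :: real)" using x1 by (intro summable_geometric) auto
    have le: "cmod (lacunary_term \<alpha> (e i j) w) \<le> (2 powr - \<alpha>) ^ j" if "w \<in> ball 0 1" for j w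
    proof -
      have "cmod (lacunary_term \<alpha> (e i j) w) \<le> 2 powr (- \<alpha> * real (e i j)) * 1"
        unfolding lacunary_term_def norm_mult norm_power using that by (intro mult_mono) (auto simp: power_le_one)
      also have "\<dots> \<le> 2 powr (- \<alpha> * real j)"
        using \<alpha> by (auto simp: e_def N_def)
      also have "\<dots> = (2 powr - \<alpha>) ^ j" by (simp add: powr_realpow[symmetric] powr_powr)
      finally show ?thesis .
    qed
    show ?thesis
    proof (rule series_and_derivative_comparison[OF open_ball sm,
          where f = "\<lambda>j. lacunary_term \<alpha> (e i j)" and f' = "\<lambda>j. lacunary_term_deriv \<alpha> (e i j)"])
      show "(lacunary_term \<alpha> (e i j) has_field_derivative lacunary_term_deriv \<alpha> (e i j) w) (at w)" for j w
        by (rule lacunary_term_has_derivative)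
      show "\<forall>\<^sub>F j in sequentially. \<forall>w\<in>ball 0 1. cmod (lacunary_term \<alpha> (e i j) w) \<le> (2 powr - \<alpha>) ^ j"
        using le by (intro always_eventually) blast
    qed blast
  qed
  then obtain f f' where
    f: "\<And>i w. w \<in> ball 0 1 \<Longrightarrow> (\<lambda>j. lacunary_term \<alpha> (e i j) w) sums f i w" and
    f': "\<And>i w. w \<in> ball 0 1 \<Longrightarrow> (\<lambda>j. lacunary_term_deriv \<alpha> (e i j) w) sums f' i w" and
    ff': "\<And>i w. w \<in> ball 0 1 \<Longrightarrow> (f i has_field_derivative f' i w) (at w)"
    by metis
  show ?thesis
  proof (rule that[of M f N])
    show "f i holomorphic_on ball 0 1" for i
      unfolding holomorphic_on_open[OF open_ball] using ff' by blast
    show "cmod (f i z - f i w) \<le> M * cmod (z - w) powr \<alpha>" if z: "z \<in> ball 0 1" and w: "w \<in> ball 0 1" for i z w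
    proof (rule LIMSEQ_le_const2)
      have "(\<lambda>n. \<Sum>j<n. lacunary_term \<alpha> (e i j) z - lacunary_term \<alpha> (e i j) w) \<longlonglongrightarrow> f i z - f i w"
        using sums_diff[OF f[OF z] f[OF w]] by (simp add: sums_def)
      then show "(\<lambda>n. cmod (\<Sum>j<n. lacunary_term \<alpha> (e i j) z - lacunary_term \<alpha> (e i j) w)) \<longlonglongrightarrow> cmod (f i z - f i w)"
        by (rule tendsto_norm)
      have "cmod (\<Sum>j<n. lacunary_term \<alpha> (e i j) z - lacunary_term \<alpha> (e i j) w) \<le> M * cmod (z - w) powr \<alpha>" for n
      proof -
        have "cmod (\<Sum>j<n. lacunary_term \<alpha> (e i j) z - lacunary_term \<alpha> (e i j) w) \<le>
            (\<Sum>j<n. cmod (lacunary_term \<alpha> (e i j) z - lacunary_term \<alpha> (e i j) w))" by (rule norm_sum)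
        also have "\<dots> = (\<Sum>k\<in>e i ` {..<n}. cmod (lacunary_term \<alpha> k z - lacunary_term \<alpha> k w))"
          by (subst sum.reindex[OF einj]) simp
        also have "\<dots> \<le> (\<Sum>k<Suc (e i n). cmod (lacunary_term \<alpha> k z - lacunary_term \<alpha> k w))"
          by (intro sum_mono2) (auto simp: e_def less_Suc_eq_le intro!: mult_le_mono1)
        also have "\<dots> \<le> M * cmod (z - w) powr \<alpha>"
          unfolding M_def using z w by (intro lacunary_sum_diff_le \<alpha>) auto
        finally show ?thesis .
      qed
      then show "\<exists>N. \<forall>n\<ge>N. cmod (\<Sum>j<n. lacunary_term \<alpha> (e i j) z - lacunary_term \<alpha> (e i j) w) \<le> M * cmod (z - w) powr \<alpha>"
        by blast
    qed
    show "\<exists>i<N. (1 - cmod w) powr (\<alpha> - 1) / 8 \<le> cmod (deriv (f i) w)" if w: "w \<in> ball 0 1" for w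
    proof -
      obtain m where m: "2 powr - (real m + 1) < 1 - cmod w" "1 - cmod w \<le> 2 powr - real m"
        using dyadic_scale[of "1 - cmod w"] w by auto
      define i where "i = m mod N"
      define k where "k = m div N"
      have mk: "m = e i k" by (simp add: e_def i_def k_def)
      define P where "P = (2::real) powr ((1 - \<alpha>) * real m)"
      have P: "0 < P" by (simp add: P_def)
      define t where "t = (\<lambda>j. lacunary_term_deriv \<alpha> (e i j) w)"
      have low: "cmod (t j) \<le> P * x ^ (k - j)" if j: "j < k" for j
      proof -
        have "cmod (t j) \<le> 2 powr ((1 - \<alpha>) * real (e i j)) * 1"
          unfolding t_def lacunary_term_deriv_def norm_mult norm_power using w by (intro mult_mono) (auto simp: power_le_one)
        also have "real (e i j) = real m - real ((k - j) * N)"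
          using j by (simp add: mk e_def of_nat_diff algebra_simps)
        also have "2 powr ((1 - \<alpha>) * (real m - real ((k - j) * N))) * 1 = P * x ^ (k - j)"
          unfolding P_def xpow powr_add[symmetric] by (simp add: algebra_simps)
        finally show ?thesis .
      qed
      have high: "norm (t (n + Suc k)) \<le> P * 32 * x * x ^ n" for n
      proof -
        have "e i (n + Suc k) = m + Suc n * N" by (simp add: mk e_def algebra_simps)
        then have "cmod (t (n + Suc k)) \<le> P * (32 * 2 powr (- (1 - \<alpha>) * real (Suc n * N)))"
          unfolding t_def P_def using lacunary_term_deriv_high[OF \<alpha> m(1), of "Suc n * N"] by (simp add: N_def)
        then show ?thesis unfolding xpow[symmetric] by (simp add: mult_ac)
      qed
      have tail: "(\<lambda>n. t (n + Suc k)) sums (f' i w - (\<Sum>j<Suc k. t j))"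
        using sums_split_initial_segment[OF f'[OF w, of i], of "Suc k"] by (simp add: t_def)
      have "(\<lambda>n. P * 32 * x * x ^ n) sums (P * 32 * x * (1 / (1 - x)))"
        using x by (intro sums_mult geometric_sums) auto
      then have "cmod (f' i w - (\<Sum>j<Suc k. t j)) \<le> P * 32 * x * (1 / (1 - x))"
        using high by (intro norm_sums_le[OF tail]) auto
      moreover have "cmod (\<Sum>j<k. t j) \<le> P * x * (1 / (1 - x))"
      proof -
        have "cmod (\<Sum>j<k. t j) \<le> (\<Sum>j<k. P * x ^ (k - j))" using low by (intro sum_norm_le) auto
        also have "\<dots> = (\<Sum>j<k. P * x * x ^ (k - Suc j))"
          by (intro sum.cong) (auto simp: Suc_diff_Suc[symmetric])
        also have "\<dots> = P * x * (\<Sum>j<k. x ^ j)" unfolding sum_distrib_left[symmetric] sum.nat_diff_reindex ..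
        also have "\<dots> \<le> P * x * (1 / (1 - x))" using x P by (intro mult_left_mono geometric_sum_le) auto
        finally show ?thesis .
      qed
      moreover have "P / 3 \<le> cmod (t k)"
        unfolding t_def P_def mk[symmetric] using lacunary_term_deriv_main[OF m(2)] w by simp
      moreover have "cmod (t k) \<le> cmod (f' i w) + cmod (f' i w - (\<Sum>j<Suc k. t j)) + cmod (\<Sum>j<k. t j)"
      proof -
        have "t k = f' i w - (f' i w - (\<Sum>j<Suc k. t j)) - (\<Sum>j<k. t j)" by simp
        then show ?thesis by (metis (no_types, lifting) add_right_mono norm_triangle_ineq4 order_trans)
      qed
      moreover have "P * 32 * x * (1 / (1 - x)) + P * x * (1 / (1 - x)) \<le> P / 12"
      proof -
        have "1 / (1 - x) \<le> 2" using x by (simp add: divide_le_eq)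
        then have "x * (1 / (1 - x)) \<le> (1 / 1000) * 2" using x by (intro mult_mono) auto
        then have "P * 33 * (x * (1 / (1 - x))) \<le> P * 33 * (1 / 1000 * 2)" using P by (intro mult_left_mono) auto
        then show ?thesis using P by (simp add: algebra_simps)
      qed
      ultimately have "P / 4 \<le> cmod (f' i w)" by argo
      moreover have "(1 - cmod w) powr (\<alpha> - 1) \<le> 2 * P"
      proof -
        have "(1 - cmod w) powr (\<alpha> - 1) \<le> (2 powr - (real m + 1)) powr (\<alpha> - 1)"
          using m \<alpha> by (intro powr_mono2') auto
        also have "\<dots> = 2 powr (1 - \<alpha>) * P" unfolding P_def powr_powr powr_add[symmetric] by (simp add: algebra_simps)
        also have "\<dots> \<le> 2 powr 1 * P" using \<alpha> P by (intro mult_right_mono powr_mono) auto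
        finally show ?thesis by simp
      qed
      moreover have "deriv (f i) w = f' i w" using ff'[OF w] by (rule DERIV_imp_deriv)
      moreover have "i < N" by (simp add: i_def N_def)
      ultimately show ?thesis by (intro exI[of _ i]) auto
    qed
  qed (rule M)
qed

section \<open>Composition operators and the growth of the derivative\<close>

definition weighted_deriv :: "real \<Rightarrow> (complex \<Rightarrow> complex) \<Rightarrow> complex \<Rightarrow> real" where
  "weighted_deriv \<alpha> \<phi> z = cmod (deriv \<phi> z) * dD (\<phi> z) powr (\<alpha> - 1)"

lemma Lp_diff_eq_circle_norm:
  "0 \<le> p \<Longrightarrow> Lp_diff (ennreal p) F z1 z2 = circle_norm p (\<lambda>\<eta>. cmod (F (cis \<eta> * z1) - F (cis \<eta> * z2)))"
  by (simp add: Lp_diff_def)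

lemma circle_norm_const:
  assumes "1 \<le> p" "0 \<le> a"
  shows "circle_norm p (\<lambda>_. a) \<le> ennreal (7 * a)"
proof -
  have "(\<integral>\<^sup>+\<theta>\<in>{0..2*pi}. ennreal (a powr p) \<partial>(lborel :: real measure)) = ennreal (a powr p) * ennreal (2 * pi)"
    by (subst nn_integral_cmult_indicator) auto
  also have "\<dots> = ennreal (a powr p * (2 * pi))" by (simp add: ennreal_mult)
  also have "\<dots> \<le> ennreal ((7 * a) powr p)"
  proof (rule ennreal_leI)
    have "2 * pi \<le> 7" using pi_approx by simp
    also have "\<dots> \<le> (7::real) powr p" using powr_mono[of 1 p 7] assms by simp
    finally have "a powr p * (2 * pi) \<le> a powr p * 7 powr p" by (intro mult_left_mono) auto
    also have "\<dots> = (7 * a) powr p" using assms by (simp add: powr_mult)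
    finally show "a powr p * (2 * pi) \<le> (7 * a) powr p" .
  qed
  finally show ?thesis using assms by (subst circle_norm_le_iff) auto
qed

text \<open>
  A function that is dominated at each point by one of finitely many functions has its \<open>p\<close>-th power
  dominated by the sum of theirs.
\<close>

lemma circle_norm_le_of_cover:
  assumes p: "1 \<le> p" and c: "0 \<le> c"
    and f: "\<And>i. i < N \<Longrightarrow> f i \<in> borel_measurable borel" "\<And>i. i < N \<Longrightarrow> circle_norm p (f i) \<le> ennreal c"
    and k: "\<And>\<theta>. 0 \<le> k \<theta> \<and> (\<exists>i<N. k \<theta> \<le> f i \<theta>)"
  shows "circle_norm p k \<le> ennreal (real N * c)"
proof -
  have N: "1 \<le> N" using k[of 0] by auto
  have "(\<integral>\<^sup>+\<theta>\<in>{0..2*pi}. ennreal (k \<theta> powr p) \<partial>lborel) \<le>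
      (\<integral>\<^sup>+\<theta>. (\<Sum>i<N. ennreal (f i \<theta> powr p) * indicator {0..2*pi} \<theta>) \<partial>lborel)"
  proof (rule nn_integral_mono)
    fix \<theta> :: real
    obtain i where i: "i < N" "k \<theta> \<le> f i \<theta>" using k by blast
    have "ennreal (k \<theta> powr p) * indicator {0..2*pi} \<theta> \<le> ennreal (f i \<theta> powr p) * indicator {0..2*pi} \<theta>"
      using i k[of \<theta>] p by (intro mult_right_mono ennreal_leI powr_mono2) auto
    also have "\<dots> \<le> (\<Sum>i<N. ennreal (f i \<theta> powr p) * indicator {0..2*pi} \<theta>)"
      using i by (intro member_le_sum) auto
    finally show "ennreal (k \<theta> powr p) * indicator {0..2*pi} \<theta> \<le> (\<Sum>i<N. ennreal (f i \<theta> powr p) * indicator {0..2*pi} \<theta>)" .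
  qed
  also have "\<dots> = (\<Sum>i<N. \<integral>\<^sup>+\<theta>\<in>{0..2*pi}. ennreal (f i \<theta> powr p) \<partial>lborel)"
    using f(1) by (intro nn_integral_sum) auto
  also have "\<dots> \<le> (\<Sum>i<N. ennreal (c powr p))"
    using f(2) p c by (intro sum_mono) (auto simp: circle_norm_le_iff)
  also have "\<dots> = ennreal (real N * c powr p)" by (simp add: ennreal_mult ennreal_of_nat_eq_real_of_nat)
  also have "\<dots> \<le> ennreal ((real N * c) powr p)"
  proof (rule ennreal_leI)
    have "real N \<le> real N powr p" using N p powr_mono[of 1 p "real N"] by simp
    then show "real N * c powr p \<le> (real N * c) powr p"
      using c by (simp add: powr_mult mult_right_mono)
  qed
  finally show ?thesis using p c by (subst circle_norm_le_iff) auto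
qed

text \<open>
  The converse direction of the theorem of Hardy and Littlewood, for holomorphic functions: Cauchy's
  formula on a circle of radius \<open>\<rho>=(1-|z|)/2\<close> writes \<open>\<rho> g'\<close> as a mean of differences of \<open>g\<close> over
  distance \<open>\<rho>\<close>, and Minkowski's inequality moves the norm inside.
\<close>

lemma circle_norm_deriv_le:
  assumes p: "1 \<le> p" and \<beta>: "0 < \<beta>" "\<beta> \<le> 1" and A: "0 < A" and g: "g holomorphic_on ball 0 1"
    and le: "\<And>z1 z2. z1 \<in> ball 0 1 \<Longrightarrow> z2 \<in> ball 0 1 \<Longrightarrow>
      circle_norm p (\<lambda>\<theta>. cmod (g (cis \<theta> * z1) - g (cis \<theta> * z2))) \<le> ennreal (A * cmod (z1 - z2) powr \<beta>)"
    and z: "z \<in> ball 0 1"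
  shows "circle_norm p (\<lambda>\<theta>. cmod (deriv g (cis \<theta> * z))) \<le> ennreal (2 * A * (1 - cmod z) powr (\<beta> - 1))"
proof -
  define \<rho> where "\<rho> = (1 - cmod z) / 2"
  have \<rho>: "0 < \<rho>" using z by (simp add: \<rho>_def)
  have zr: "cball z \<rho> \<subseteq> ball 0 1"
    unfolding \<rho>_def using z by (intro cball_half_distance_subset) simp
  have onb: "z + of_real \<rho> * cis \<tau> \<in> ball 0 1" for \<tau>
    by (rule subsetD[OF zr]) (use \<rho> in \<open>simp add: dist_norm norm_mult\<close>)
  have gc: "continuous_on (ball 0 1) g" using g by (rule holomorphic_on_imp_continuous_on)
  have rot: "cis \<theta> * w \<in> ball 0 1" if "w \<in> ball 0 1" for \<theta> w using that by (simp add: norm_mult)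
  have gf: "continuous_on X (\<lambda>x. g (h x))" if "continuous_on X h" "h ` X \<subseteq> ball 0 1" for X :: "'b::topological_space set" and h
    using continuous_on_compose2[OF gc that] .
  have "circle_norm p (\<lambda>\<theta>. cmod (deriv g (cis \<theta> * z))) \<le> ennreal (A * \<rho> powr (\<beta> - 1))"
  proof (rule circle_norm_integral_le[where S = "{0..2*pi}" and w = "\<lambda>_. 1 / (2 * pi * \<rho>) * (A * \<rho> powr \<beta>)"
        and G = "\<lambda>\<tau> \<theta>. 1 / (2 * pi * \<rho>) * cmod (g (cis \<theta> * (z + of_real \<rho> * cis \<tau>)) - g (cis \<theta> * z))"])
    show "continuous_on ({0..2*pi} \<times> UNIV) (\<lambda>(\<tau>, \<theta>). 1 / (2 * pi * \<rho>) * cmod (g (cis \<theta> * (z + of_real \<rho> * cis \<tau>)) - g (cis \<theta> * z)))"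
      unfolding case_prod_unfold using rot[OF onb] rot[OF z] by (intro continuous_intros gf) auto
    show "(\<integral>\<^sup>+\<tau>\<in>{0..2*pi}. ennreal (1 / (2 * pi * \<rho>) * (A * \<rho> powr \<beta>)) \<partial>(lborel :: real measure)) \<le> ennreal (A * \<rho> powr (\<beta> - 1))"
    proof -
      have "(\<integral>\<^sup>+\<tau>\<in>{0..2*pi}. ennreal (1 / (2 * pi * \<rho>) * (A * \<rho> powr \<beta>)) \<partial>(lborel :: real measure)) =
          ennreal (1 / (2 * pi * \<rho>) * (A * \<rho> powr \<beta>)) * ennreal (2 * pi)"
        by (subst nn_integral_cmult_indicator) auto
      also have "\<dots> = ennreal (1 / (2 * pi * \<rho>) * (A * \<rho> powr \<beta>) * (2 * pi))"
        using A \<rho> by (intro ennreal_mult[symmetric]) auto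
      also have "1 / (2 * pi * \<rho>) * (A * \<rho> powr \<beta>) * (2 * pi) = A * \<rho> powr (\<beta> - 1)"
        using \<rho> by (simp add: powr_diff)
      finally show ?thesis by simp
    qed
    show "circle_norm p (\<lambda>\<theta>. 1 / (2 * pi * \<rho>) * cmod (g (cis \<theta> * (z + of_real \<rho> * cis \<tau>)) - g (cis \<theta> * z)))
        \<le> ennreal (1 / (2 * pi * \<rho>) * (A * \<rho> powr \<beta>))" for \<tau>
    proof (rule circle_norm_cmult)
      show "circle_norm p (\<lambda>\<theta>. cmod (g (cis \<theta> * (z + of_real \<rho> * cis \<tau>)) - g (cis \<theta> * z))) \<le> ennreal (A * \<rho> powr \<beta>)"
        using le[OF onb z, of \<tau>] \<rho> by (simp add: norm_mult)
      show "(\<lambda>\<theta>. cmod (g (cis \<theta> * (z + of_real \<rho> * cis \<tau>)) - g (cis \<theta> * z))) \<in> borel_measurable borel"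
        using rot[OF onb] rot[OF z] by (intro borel_measurable_continuous_onI continuous_intros gf) auto
    qed (use p A \<rho> in auto)
    fix \<theta> :: real
    \<comment> \<open>Rotating the function instead of the point keeps the circle of integration fixed.\<close>
    define h where "h = (\<lambda>\<zeta>. g (cis \<theta> * \<zeta>))"
    have hol: "h holomorphic_on ball 0 1"
    proof -
      have "(\<lambda>\<zeta>. cis \<theta> * \<zeta>) ` ball 0 1 \<subseteq> ball 0 1" by (auto simp: norm_mult)
      moreover have "(\<lambda>\<zeta>. cis \<theta> * \<zeta>) holomorphic_on ball 0 1" by (intro holomorphic_intros)
      ultimately have "(g \<circ> (\<lambda>\<zeta>. cis \<theta> * \<zeta>)) holomorphic_on ball 0 1"
        using g by (intro holomorphic_on_compose_gen)
      then show ?thesis by (simp add: h_def o_def)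
    qed
    have h: "continuous_on (cball z \<rho>) h" "h holomorphic_on ball z \<rho>"
      using holomorphic_on_imp_continuous_on[OF hol] hol zr
        by (auto intro: continuous_on_subset holomorphic_on_subset[OF hol subset_trans[OF ball_subset_cball zr]])
    have "(g has_field_derivative deriv g (cis \<theta> * z)) (at (cis \<theta> * z))"
      using g rot[OF z] by (intro holomorphic_derivI) auto
    then have "(h has_field_derivative deriv g (cis \<theta> * z) * cis \<theta>) (at z)"
      unfolding h_def by (auto intro!: derivative_eq_intros DERIV_chain2[where g = "\<lambda>\<zeta>. cis \<theta> * \<zeta>"])
    then have dh: "deriv h z = deriv g (cis \<theta> * z) * cis \<theta>" by (rule DERIV_imp_deriv)
    have "((\<lambda>\<tau>. h (z + of_real \<rho> * cis \<tau>) * cis (- \<tau>) - h z * cnj (cis \<tau>)) has_integral of_real (2 * pi * \<rho>) * deriv h z - h z * cnj 0) {0..2*pi}"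
      by (intro has_integral_diff circle_has_integral(2)[OF h \<rho>] has_integral_mult_right cnj_has_integral cis_has_integral_0)
    then have I: "((\<lambda>\<tau>. (h (z + of_real \<rho> * cis \<tau>) - h z) * cis (- \<tau>)) has_integral of_real (2 * pi * \<rho>) * deriv h z) {0..2*pi}"
      by (simp add: cis_cnj left_diff_distrib)
    have hc: "continuous_on {0..2*pi} (\<lambda>\<tau>. cmod (h (z + of_real \<rho> * cis \<tau>) - h z))"
      unfolding h_def using rot[OF onb] rot[OF z] by (intro continuous_intros gf) auto
    have "cmod (integral {0..2*pi} (\<lambda>\<tau>. (h (z + of_real \<rho> * cis \<tau>) - h z) * cis (- \<tau>))) \<le>
        integral {0..2*pi} (\<lambda>\<tau>. cmod (h (z + of_real \<rho> * cis \<tau>) - h z))"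
      by (rule integral_norm_bound_integral[OF has_integral_integrable[OF I] integrable_continuous_interval[OF hc]])
         (simp add: norm_mult)
    then have "2 * pi * \<rho> * cmod (deriv g (cis \<theta> * z)) \<le> integral {0..2*pi} (\<lambda>\<tau>. cmod (h (z + of_real \<rho> * cis \<tau>) - h z))"
      unfolding integral_unique[OF I] dh using \<rho> by (simp add: norm_mult)
    then have "cmod (deriv g (cis \<theta> * z)) \<le> 1 / (2 * pi * \<rho>) * integral {0..2*pi} (\<lambda>\<tau>. cmod (h (z + of_real \<rho> * cis \<tau>) - h z))"
      using \<rho> by (simp add: field_simps)
    also have "\<dots> = integral {0..2*pi} (\<lambda>\<tau>. 1 / (2 * pi * \<rho>) * cmod (h (z + of_real \<rho> * cis \<tau>) - h z))"
      by (rule integral_mult_right[symmetric])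
    finally have "ennreal (cmod (deriv g (cis \<theta> * z))) \<le> ennreal \<dots>" by (rule ennreal_leI)
    also have "\<dots> = (\<integral>\<^sup>+\<tau>\<in>{0..2*pi}. ennreal (1 / (2 * pi * \<rho>) * cmod (h (z + of_real \<rho> * cis \<tau>) - h z)) \<partial>lborel)"
      using \<rho> by (intro nn_integral_continuous_interval[symmetric] continuous_on_mult_left hc) auto
    finally show "0 \<le> cmod (deriv g (cis \<theta> * z)) \<and> ennreal (cmod (deriv g (cis \<theta> * z))) \<le>
        (\<integral>\<^sup>+\<tau>\<in>{0..2*pi}. ennreal (1 / (2 * pi * \<rho>) * cmod (g (cis \<theta> * (z + of_real \<rho> * cis \<tau>)) - g (cis \<theta> * z))) \<partial>lborel)"
      unfolding h_def by simp
  qed (use p A \<rho> in auto)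
  also have "\<dots> \<le> ennreal (2 * A * (1 - cmod z) powr (\<beta> - 1))"
  proof (rule ennreal_leI)
    have "\<rho> powr (\<beta> - 1) = 2 powr (1 - \<beta>) * (1 - cmod z) powr (\<beta> - 1)"
      using z unfolding \<rho>_def by (simp add: powr_divide powr_diff)
    also have "\<dots> \<le> 2 powr 1 * (1 - cmod z) powr (\<beta> - 1)"
      using \<beta> by (intro mult_right_mono powr_mono) auto
    finally show "A * \<rho> powr (\<beta> - 1) \<le> 2 * A * (1 - cmod z) powr (\<beta> - 1)"
      using A by simp
  qed
  finally show ?thesis .
qed

text \<open>
  For \<open>\<alpha>=1\<close> the ratio of the geometric bounds is \<open>1\<close> and no term of a lacunary series dominates, but
  the identity already has derivative \<open>1\<close>.
\<close>

lemma bloch_test_functions: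
  assumes \<alpha>: "0 < \<alpha>" "\<alpha> \<le> 1"
  obtains N :: nat and f :: "nat \<Rightarrow> complex \<Rightarrow> complex" and M :: real where "0 < M"
    "\<And>i. f i holomorphic_on ball 0 1"
    "\<And>i z w. z \<in> ball 0 1 \<Longrightarrow> w \<in> ball 0 1 \<Longrightarrow> cmod (f i z - f i w) \<le> M * cmod (z - w) powr \<alpha>"
    "\<And>w. w \<in> ball 0 1 \<Longrightarrow> \<exists>i<N. (1 - cmod w) powr (\<alpha> - 1) / 8 \<le> cmod (deriv (f i) w)"
proof (cases "\<alpha> = 1")
  case True
  show ?thesis
    by (rule that[of 1 "\<lambda>_ w. w" 1]) (use True in auto)
next
  case False
  with \<alpha> have "0 < \<alpha>" "\<alpha> < 1" by auto
  then show ?thesis proof (rule lacunary_test_functions)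
    fix N :: nat and f :: "nat \<Rightarrow> complex \<Rightarrow> complex" and M :: real
    assume a: "0 < M" "\<And>i. f i holomorphic_on ball 0 1"
      "\<And>i z w. z \<in> ball 0 1 \<Longrightarrow> w \<in> ball 0 1 \<Longrightarrow> cmod (f i z - f i w) \<le> M * cmod (z - w) powr \<alpha>"
      "\<And>w. w \<in> ball 0 1 \<Longrightarrow> \<exists>i<N. (1 - cmod w) powr (\<alpha> - 1) / 8 \<le> cmod (deriv (f i) w)"
    show thesis by (rule that[where M = M and f = f and N = N]) (assumption | rule a)+
  qed
qed

lemma continuous_on_weighted_deriv:
  assumes "\<phi> holomorphic_on ball 0 1" "\<phi> ` ball 0 1 \<subseteq> ball 0 1"
  shows "continuous_on (ball 0 1) (weighted_deriv \<alpha> \<phi>)"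
proof -
  have "continuous_on (ball 0 1) \<phi>" "continuous_on (ball 0 1) (deriv \<phi>)"
    using assms by (auto intro: holomorphic_on_imp_continuous_on holomorphic_deriv)
  moreover have "dD (\<phi> z) \<noteq> 0" if "z \<in> ball 0 1" for z
    using assms(2) that by (fastforce simp: dD_def image_subset_iff)
  ultimately show ?thesis
    unfolding weighted_deriv_def dD_def by (intro continuous_intros continuous_on_powr) auto
qed

lemma weighted_deriv_nonneg: "0 \<le> weighted_deriv \<alpha> \<phi> z"
  by (simp add: weighted_deriv_def)

definition deriv_growth :: "real \<Rightarrow> real \<Rightarrow> real \<Rightarrow> (complex \<Rightarrow> complex) \<Rightarrow> bool" where
  "deriv_growth p \<alpha> \<beta> \<phi> \<longleftrightarrow> (\<exists>M>0. \<forall>z\<in>ball 0 1.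
     circle_norm p (\<lambda>\<theta>. weighted_deriv \<alpha> \<phi> (cis \<theta> * z)) \<le> ennreal (M * (1 - cmod z) powr (\<beta> - 1)))"

text \<open>
  Finitely many test functions give finitely many Lipschitz constants, whose sum serves for all of them;
  at each point one of the derivatives \<open>(f\<^sub>i\<circ>\<phi>)'\<close> dominates the weighted derivative
  of \<open>\<phi>\<close> up to the factor \<open>8\<close>.
\<close>

lemma composition_imp_deriv_growth:
  assumes p: "1 \<le> p" and \<alpha>: "0 < \<alpha>" "\<alpha> \<le> 1" and \<beta>: "0 < \<beta>" "\<beta> \<le> 1"
    and G1: "\<phi> \<in> comp_symbols (Lip_disk (pow_mod \<alpha>) \<infinity> (ball 0 1) \<inter> harmonic_disk)
               (Lip_disk (pow_mod \<beta>) (ennreal p) (ball 0 1) \<inter> harmonic_disk)"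
  shows "deriv_growth p \<alpha> \<beta> \<phi>"
proof -
  have \<phi>: "\<phi> holomorphic_on ball 0 1" "\<phi> ` ball 0 1 \<subseteq> ball 0 1"
    and comp: "\<And>f. f \<in> Lip_disk (pow_mod \<alpha>) \<infinity> (ball 0 1) \<inter> harmonic_disk \<Longrightarrow>
          comp_op \<phi> f \<in> Lip_disk (pow_mod \<beta>) (ennreal p) (ball 0 1)"
    using G1 unfolding comp_symbols_def by auto
  obtain N :: nat and f :: "nat \<Rightarrow> complex \<Rightarrow> complex" and M :: real where M: "0 < M" and f: "\<And>i. f i holomorphic_on ball 0 1"
    and fl: "\<And>i z w. z \<in> ball 0 1 \<Longrightarrow> w \<in> ball 0 1 \<Longrightarrow> cmod (f i z - f i w) \<le> M * cmod (z - w) powr \<alpha>"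
    and fd: "\<And>w. w \<in> ball 0 1 \<Longrightarrow> \<exists>i<N. (1 - cmod w) powr (\<alpha> - 1) / 8 \<le> cmod (deriv (f i) w)"
    proof (rule bloch_test_functions[OF \<alpha>])
    fix N :: nat and f :: "nat \<Rightarrow> complex \<Rightarrow> complex" and M :: real
    assume a: "0 < M" "\<And>i. f i holomorphic_on ball 0 1"
      "\<And>i z w. z \<in> ball 0 1 \<Longrightarrow> w \<in> ball 0 1 \<Longrightarrow> cmod (f i z - f i w) \<le> M * cmod (z - w) powr \<alpha>"
      "\<And>w. w \<in> ball 0 1 \<Longrightarrow> \<exists>i<N. (1 - cmod w) powr (\<alpha> - 1) / 8 \<le> cmod (deriv (f i) w)"
    show thesis by (rule that[where M = M and f = f and N = N]) (assumption | rule a)+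
  qed
  have "\<exists>A>0. \<forall>z1\<in>ball 0 1. \<forall>z2\<in>ball 0 1.
      circle_norm p (\<lambda>\<eta>. cmod (comp_op \<phi> (f i) (cis \<eta> * z1) - comp_op \<phi> (f i) (cis \<eta> * z2))) \<le> ennreal (A * cmod (z1 - z2) powr \<beta>)" for i
  proof -
    have "f i \<in> Lip_disk (pow_mod \<alpha>) \<infinity> (ball 0 1)"
      unfolding Lip_disk_def Lp_diff_def pow_mod_def using M fl[of _ _ i]
      by (auto intro!: exI[of _ M] ennreal_leI borel_measurable_continuous_on_restrict holomorphic_on_imp_continuous_on f)
    moreover have "f i \<in> harmonic_disk"
      by (rule harmonic_disk_holomorphic_sum[OF f[of i] holomorphic_on_const[of 0]]) simp
    ultimately have "comp_op \<phi> (f i) \<in> Lip_disk (pow_mod \<beta>) (ennreal p) (ball 0 1)" using comp by blast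
    then show ?thesis
      using p unfolding Lip_disk_def pow_mod_def by (simp add: Lp_diff_eq_circle_norm)
  qed
  then have "\<forall>i. \<exists>A>0. \<forall>z1\<in>ball 0 1. \<forall>z2\<in>ball 0 1.
      circle_norm p (\<lambda>\<eta>. cmod (comp_op \<phi> (f i) (cis \<eta> * z1) - comp_op \<phi> (f i) (cis \<eta> * z2))) \<le> ennreal (A * cmod (z1 - z2) powr \<beta>)"
    by (rule allI)
  from choice[OF this] obtain A where A': "\<forall>i. 0 < A i \<and> (\<forall>z1\<in>ball 0 1. \<forall>z2\<in>ball 0 1.
      circle_norm p (\<lambda>\<eta>. cmod (comp_op \<phi> (f i) (cis \<eta> * z1) - comp_op \<phi> (f i) (cis \<eta> * z2))) \<le> ennreal (A i * cmod (z1 - z2) powr \<beta>))" ..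
  then have A: "\<And>i. 0 < A i"
    and lip: "\<And>i z1 z2. z1 \<in> ball 0 1 \<Longrightarrow> z2 \<in> ball 0 1 \<Longrightarrow>
      circle_norm p (\<lambda>\<eta>. cmod (comp_op \<phi> (f i) (cis \<eta> * z1) - comp_op \<phi> (f i) (cis \<eta> * z2))) \<le> ennreal (A i * cmod (z1 - z2) powr \<beta>)"
    by auto
  define B where "B = (\<Sum>i<N. A i)"
  have AB: "A i \<le> B" if "i < N" for i
    unfolding B_def using that A by (intro member_le_sum) (auto intro: less_imp_le)
  have N: "0 < N" using fd[of 0] by auto
  have B: "0 < B" using AB[OF N] A[of 0] by linarith
  have holc: "comp_op \<phi> (f i) holomorphic_on ball 0 1" for i
    unfolding comp_op_def using holomorphic_on_compose_gen[OF \<phi>(1) f[of i] \<phi>(2)] by (simp add: o_def)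
  have der: "deriv (comp_op \<phi> (f i)) z = deriv (f i) (\<phi> z) * deriv \<phi> z" if "z \<in> ball 0 1" for i z
    unfolding comp_op_def
    by (rule DERIV_imp_deriv, rule DERIV_chain2[where f = "f i" and g = \<phi>])
       (use that \<phi> in \<open>auto intro!: holomorphic_derivI[OF f] holomorphic_derivI[OF \<phi>(1)]\<close>)
  show ?thesis
    unfolding deriv_growth_def
  proof (intro exI[of _ "real N * (8 * (2 * B))"] conjI ballI)
    show "0 < real N * (8 * (2 * B))" using N B by simp
    fix z :: complex assume z: "z \<in> ball 0 1"
    have rz: "cis \<theta> * z \<in> ball 0 1" for \<theta> using z by (simp add: norm_mult)
    have dc: "continuous_on UNIV (\<lambda>\<theta>. cmod (deriv (comp_op \<phi> (f i)) (cis \<theta> * z)))" for i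
      using rz by (intro continuous_intros continuous_on_compose2[OF holomorphic_on_imp_continuous_on[OF holomorphic_deriv[OF holc open_ball]]]) auto
    have "circle_norm p (\<lambda>\<theta>. weighted_deriv \<alpha> \<phi> (cis \<theta> * z)) \<le> ennreal (real N * (8 * (2 * B * (1 - cmod z) powr (\<beta> - 1))))"
    proof (rule circle_norm_le_of_cover[OF p, where f = "\<lambda>i \<theta>. 8 * cmod (deriv (comp_op \<phi> (f i)) (cis \<theta> * z))"])
      show "(\<lambda>\<theta>. 8 * cmod (deriv (comp_op \<phi> (f i)) (cis \<theta> * z))) \<in> borel_measurable borel" for i
        by (intro borel_measurable_continuous_onI continuous_intros dc)
      show "circle_norm p (\<lambda>\<theta>. 8 * cmod (deriv (comp_op \<phi> (f i)) (cis \<theta> * z))) \<le> ennreal (8 * (2 * B * (1 - cmod z) powr (\<beta> - 1)))"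
        if i: "i < N" for i
      proof (rule circle_norm_cmult)
        have "circle_norm p (\<lambda>\<theta>. cmod (deriv (comp_op \<phi> (f i)) (cis \<theta> * z))) \<le> ennreal (2 * A i * (1 - cmod z) powr (\<beta> - 1))"
          by (rule circle_norm_deriv_le[OF p \<beta> A holc lip z])
        also have "\<dots> \<le> ennreal (2 * B * (1 - cmod z) powr (\<beta> - 1))"
          using AB[OF i] by (intro ennreal_leI mult_right_mono) auto
        finally show "circle_norm p (\<lambda>\<theta>. cmod (deriv (comp_op \<phi> (f i)) (cis \<theta> * z))) \<le> ennreal (2 * B * (1 - cmod z) powr (\<beta> - 1))" .
      qed (use p B dc in \<open>auto intro: borel_measurable_continuous_onI\<close>)
      show "0 \<le> weighted_deriv \<alpha> \<phi> (cis \<theta> * z) \<and> (\<exists>i<N. weighted_deriv \<alpha> \<phi> (cis \<theta> * z) \<le> 8 * cmod (deriv (comp_op \<phi> (f i)) (cis \<theta> * z)))" for \<theta>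
      proof -
        have "\<phi> (cis \<theta> * z) \<in> ball 0 1" using \<phi>(2) rz[of \<theta>] by blast
        then obtain i where i: "i < N" "(1 - cmod (\<phi> (cis \<theta> * z))) powr (\<alpha> - 1) / 8 \<le> cmod (deriv (f i) (\<phi> (cis \<theta> * z)))"
          using fd by blast
        have "cmod (deriv \<phi> (cis \<theta> * z)) * ((1 - cmod (\<phi> (cis \<theta> * z))) powr (\<alpha> - 1) / 8) \<le>
            cmod (deriv \<phi> (cis \<theta> * z)) * cmod (deriv (f i) (\<phi> (cis \<theta> * z)))"
          using i(2) by (intro mult_left_mono) auto
        then have "weighted_deriv \<alpha> \<phi> (cis \<theta> * z) \<le> 8 * cmod (deriv (comp_op \<phi> (f i)) (cis \<theta> * z))"
          unfolding der[OF rz] by (simp add: weighted_deriv_def dD_def norm_mult mult.commute)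
        then show ?thesis using i(1) weighted_deriv_nonneg by blast
      qed
    qed (use B in auto)
    then show "circle_norm p (\<lambda>\<theta>. weighted_deriv \<alpha> \<phi> (cis \<theta> * z)) \<le> ennreal (real N * (8 * (2 * B)) * (1 - cmod z) powr (\<beta> - 1))"
      by (simp add: mult.assoc)
  qed
qed

text \<open>
  The oscillation of \<open>F+cnj G\<close> on the circle of radius \<open>\<rho>=(1-|w|)/2\<close> about \<open>w\<close> is at most
  \<open>M\<rho>^\<alpha>\<close>, and it controls \<open>\<rho>|F'(w)|\<close>.
\<close>

lemma harmonic_lipschitz_deriv_le:
  assumes \<alpha>: "0 < \<alpha>" "\<alpha> \<le> 1" and M: "0 < M"
    and F: "F holomorphic_on ball 0 1" and G: "G holomorphic_on ball 0 1"
    and lip: "\<And>z w. z \<in> ball 0 1 \<Longrightarrow> w \<in> ball 0 1 \<Longrightarrow> cmod ((F z + cnj (G z)) - (F w + cnj (G w))) \<le> M * cmod (z - w) powr \<alpha>"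
    and w: "w \<in> ball 0 1"
  shows "cmod (deriv F w) \<le> 2 * M * (1 - cmod w) powr (\<alpha> - 1)"
proof -
  define \<rho> where "\<rho> = (1 - cmod w) / 2"
  have \<rho>: "0 < \<rho>" using w by (simp add: \<rho>_def)
  have wr: "cball w \<rho> \<subseteq> ball 0 1"
    unfolding \<rho>_def using w by (intro cball_half_distance_subset) simp
  then have br: "ball w \<rho> \<subseteq> ball 0 1" using ball_subset_cball by blast
  have "\<rho> * cmod (deriv F w) \<le> M * \<rho> powr \<alpha>"
  proof (rule harmonic_deriv_bound[where c = "F w + cnj (G w)" and G = G])
    fix z assume z: "z \<in> sphere w \<rho>"
    then have "cmod (z - w) = \<rho>" "z \<in> ball 0 1" using wr by (auto simp: dist_norm norm_minus_commute)
    then show "cmod (F z + cnj (G z) - (F w + cnj (G w))) \<le> M * \<rho> powr \<alpha>" using lip[OF _ w, of z] by simp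
  qed (use F G wr br \<rho> in \<open>auto intro: holomorphic_on_subset continuous_on_subset[OF holomorphic_on_imp_continuous_on]\<close>)
  then have "cmod (deriv F w) \<le> M * \<rho> powr (\<alpha> - 1)"
    using \<rho> by (simp add: powr_diff field_simps)
  also have "\<rho> powr (\<alpha> - 1) = 2 powr (1 - \<alpha>) * (1 - cmod w) powr (\<alpha> - 1)"
    using w unfolding \<rho>_def by (simp add: powr_divide powr_diff)
  also have "M * (2 powr (1 - \<alpha>) * (1 - cmod w) powr (\<alpha> - 1)) \<le> M * (2 powr 1 * (1 - cmod w) powr (\<alpha> - 1))"
    using \<alpha> M by (intro mult_left_mono mult_right_mono powr_mono) auto
  finally show ?thesis by simp
qed

text \<open>
  With \<open>f=F+cnj G\<close> the composition is \<open>F\<circ>\<phi>+cnj (G\<circ>\<phi>)\<close>, whose derivatives are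
  bounded by a multiple of \<open>|\<phi>'| d(\<phi>)^(\<alpha>-1)\<close>, so the theorem of Hardy and Littlewood
  applies.
\<close>

lemma deriv_growth_imp_composition:
  assumes p: "1 \<le> p" and \<alpha>: "0 < \<alpha>" "\<alpha> \<le> 1" and \<beta>: "0 < \<beta>" "\<beta> \<le> 1"
    and \<phi>: "\<phi> holomorphic_on ball 0 1" "\<phi> ` ball 0 1 \<subseteq> ball 0 1"
    and G2: "deriv_growth p \<alpha> \<beta> \<phi>"
  shows "\<phi> \<in> comp_symbols (Lip_disk (pow_mod \<alpha>) \<infinity> (ball 0 1) \<inter> harmonic_disk)
               (Lip_disk (pow_mod \<beta>) (ennreal p) (ball 0 1) \<inter> harmonic_disk)"
proof -
  obtain M where M: "0 < M" and KM: "\<And>z. z \<in> ball 0 1 \<Longrightarrow>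
      circle_norm p (\<lambda>\<theta>. weighted_deriv \<alpha> \<phi> (cis \<theta> * z)) \<le> ennreal (M * (1 - cmod z) powr (\<beta> - 1))"
    using G2 unfolding deriv_growth_def by blast
  have "comp_op \<phi> f \<in> Lip_disk (pow_mod \<beta>) (ennreal p) (ball 0 1) \<inter> harmonic_disk"
    if f: "f \<in> Lip_disk (pow_mod \<alpha>) \<infinity> (ball 0 1)" "f \<in> harmonic_disk" for f
  proof -
    obtain L where L: "0 < L" and Lb: "\<And>z w. z \<in> ball 0 1 \<Longrightarrow> w \<in> ball 0 1 \<Longrightarrow> cmod (f z - f w) \<le> L * cmod (z - w) powr \<alpha>"
      using f(1) unfolding Lip_disk_def Lp_diff_def pow_mod_def by auto
    obtain F G where F: "F holomorphic_on ball 0 1" and G: "G holomorphic_on ball 0 1"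
      and fFG: "\<And>z. z \<in> ball 0 1 \<Longrightarrow> f z = F z + cnj (G z)"
      by (rule harmonic_disk_decompose[OF f(2)]) (rule that; blast)
    have F': "cmod (deriv F w) \<le> 2 * L * (1 - cmod w) powr (\<alpha> - 1)" if "w \<in> ball 0 1" for w
      using Lb fFG by (intro harmonic_lipschitz_deriv_le[OF \<alpha> L F G _ that]) auto
    have G': "cmod (deriv G w) \<le> 2 * L * (1 - cmod w) powr (\<alpha> - 1)" if "w \<in> ball 0 1" for w
    proof (rule harmonic_lipschitz_deriv_le[OF \<alpha> L G F _ that])
      fix z w :: complex assume zw: "z \<in> ball 0 1" "w \<in> ball 0 1"
      have "(G z + cnj (F z)) - (G w + cnj (F w)) = cnj (f z - f w)" using zw by (simp add: fFG)
      then show "cmod ((G z + cnj (F z)) - (G w + cnj (F w))) \<le> L * cmod (z - w) powr \<alpha>"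
        using Lb[OF zw] by (metis complex_mod_cnj)
    qed
    have hc: "(\<lambda>z. H (\<phi> z)) holomorphic_on ball 0 1" if "H holomorphic_on ball 0 1" for H
      using holomorphic_on_compose_gen[OF \<phi>(1) that \<phi>(2)] by (simp add: o_def)
    have der: "deriv (\<lambda>z. H (\<phi> z)) z = deriv H (\<phi> z) * deriv \<phi> z" if "H holomorphic_on ball 0 1" "z \<in> ball 0 1" for H z
      by (rule DERIV_imp_deriv, rule DERIV_chain2[where f = H and g = \<phi>])
         (use that \<phi> in \<open>auto intro!: holomorphic_derivI[OF that(1)] holomorphic_derivI[OF \<phi>(1)]\<close>)
    have cf: "comp_op \<phi> f z = F (\<phi> z) + cnj (G (\<phi> z))" if "z \<in> ball 0 1" for z
      unfolding comp_op_def using fFG \<phi>(2) that by blast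
    have harm: "comp_op \<phi> f \<in> harmonic_disk"
      by (rule harmonic_disk_holomorphic_sum[OF hc[OF F] hc[OF G] cf])
    have cont: "continuous_on (ball 0 1) (comp_op \<phi> f)"
    proof -
      have "continuous_on (ball 0 1) (\<lambda>z. F (\<phi> z) + cnj (G (\<phi> z)))"
        by (intro continuous_intros holomorphic_on_imp_continuous_on hc F G)
      then show ?thesis by (subst continuous_on_cong[OF refl cf])
    qed
    have path: "cmod (comp_op \<phi> f a - comp_op \<phi> f b) \<le> (4 * L) * cmod (b - a) * integral {0..1} (\<lambda>t. weighted_deriv \<alpha> \<phi> (a + of_real t * (b - a)))"
      if "a \<in> ball 0 1" "b \<in> ball 0 1" for a b
    proof (rule harmonic_diff_le_integral[OF hc[OF F] hc[OF G] cf continuous_on_weighted_deriv[OF \<phi>] _ that])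
      fix z :: complex assume z: "z \<in> ball 0 1"
      then have \<phi>z: "\<phi> z \<in> ball 0 1" using \<phi>(2) by blast
      have "cmod (deriv F (\<phi> z)) + cmod (deriv G (\<phi> z)) \<le> 4 * L * (1 - cmod (\<phi> z)) powr (\<alpha> - 1)"
        using F'[OF \<phi>z] G'[OF \<phi>z] by simp
      then have "(cmod (deriv F (\<phi> z)) + cmod (deriv G (\<phi> z))) * cmod (deriv \<phi> z) \<le> 4 * L * (1 - cmod (\<phi> z)) powr (\<alpha> - 1) * cmod (deriv \<phi> z)"
        by (rule mult_right_mono) simp
      then show "cmod (deriv (\<lambda>z. F (\<phi> z)) z) + cmod (deriv (\<lambda>z. G (\<phi> z)) z) \<le> 4 * L * weighted_deriv \<alpha> \<phi> z"
        unfolding der[OF F z] der[OF G z] by (simp add: norm_mult weighted_deriv_def dD_def algebra_simps)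
    qed
    have "circle_norm p (\<lambda>\<theta>. cmod (comp_op \<phi> f (cis \<theta> * z1) - comp_op \<phi> f (cis \<theta> * z2))) \<le> ennreal (48 * (4 * L) * M / \<beta> * cmod (z1 - z2) powr \<beta>)"
      if "z1 \<in> ball 0 1" "z2 \<in> ball 0 1" for z1 z2
      by (rule hardy_littlewood_disk[OF p \<beta> _ continuous_on_weighted_deriv[OF \<phi>] weighted_deriv_nonneg KM M cont path that])
         (use L in auto)
    then have "comp_op \<phi> f \<in> Lip_disk (pow_mod \<beta>) (ennreal p) (ball 0 1)"
      unfolding Lip_disk_def using p L M \<beta> borel_measurable_continuous_on_restrict[OF cont]
      by (auto simp: Lp_diff_eq_circle_norm pow_mod_def intro!: exI[of _ "48 * (4 * L) * M / \<beta>"])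
    then show ?thesis using harm by simp
  qed
  then show ?thesis unfolding comp_symbols_def using \<phi> by blast
qed

section \<open>Symbols that are continuous up to the boundary\<close>

lemma continuous_on_dist_power:
  assumes "0 < \<alpha>" "continuous_on (cball 0 1) \<phi>" "\<phi> ` cball 0 1 \<subseteq> cball 0 1"
  shows "continuous_on (cball 0 1) (\<lambda>z. dD (\<phi> z) powr \<alpha>)"
  unfolding dD_def using assms
  by (intro continuous_on_powr' continuous_intros) (auto simp: image_subset_iff)

lemma image_cball_subset:
  assumes "continuous_on (cball 0 1) \<phi>" "\<phi> ` ball 0 1 \<subseteq> ball (0::complex) 1"
  shows "\<phi> ` cball (0::complex) 1 \<subseteq> cball 0 1"
proof -
  have "\<phi> ` closure (ball 0 1) \<subseteq> cball 0 1"
    using assms by (intro image_closure_subset) (auto simp: image_subset_iff intro: less_imp_le)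
  then show ?thesis by simp
qed

lemma deriv_growth_imp_lipschitz_closed:
  assumes p: "1 \<le> p" and \<alpha>: "0 < \<alpha>" "\<alpha> \<le> 1" and \<beta>: "0 < \<beta>" "\<beta> \<le> 1"
    and \<phi>: "\<phi> holomorphic_on ball 0 1" "\<phi> ` ball 0 1 \<subseteq> ball 0 1" and cont: "continuous_on (cball 0 1) \<phi>"
    and G2: "deriv_growth p \<alpha> \<beta> \<phi>"
  shows "(\<lambda>z. complex_of_real (dD (\<phi> z) powr \<alpha>)) \<in> Lip_disk (pow_mod \<beta>) (ennreal p) (cball 0 1)"
proof -
  let ?U = "\<lambda>z. complex_of_real (dD (\<phi> z) powr \<alpha>)"
  obtain M where M: "0 < M" and KM: "\<And>z. z \<in> ball 0 1 \<Longrightarrow>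
      circle_norm p (\<lambda>\<theta>. weighted_deriv \<alpha> \<phi> (cis \<theta> * z)) \<le> ennreal (M * (1 - cmod z) powr (\<beta> - 1))"
    using G2 unfolding deriv_growth_def by blast
  have Uc: "continuous_on (cball 0 1) ?U"
    by (intro continuous_intros continuous_on_dist_power \<alpha> cont image_cball_subset \<phi>)
  have path: "cmod (?U a - ?U b) \<le> 1 * cmod (b - a) * integral {0..1} (\<lambda>t. weighted_deriv \<alpha> \<phi> (a + of_real t * (b - a)))"
    if "a \<in> ball 0 1" "b \<in> ball 0 1" for a b
    using dist_power_diff_le_integral[OF \<alpha> \<phi> that]
    by (simp add: weighted_deriv_def flip: of_real_diff)
  have open_disk: "circle_norm p (\<lambda>\<theta>. cmod (?U (cis \<theta> * z1) - ?U (cis \<theta> * z2))) \<le> ennreal (48 * 1 * M / \<beta> * cmod (z1 - z2) powr \<beta>)"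
    if "z1 \<in> ball 0 1" "z2 \<in> ball 0 1" for z1 z2
    by (rule hardy_littlewood_disk[OF p \<beta> zero_less_one continuous_on_weighted_deriv[OF \<phi>] weighted_deriv_nonneg KM M
          continuous_on_subset[OF Uc ball_subset_cball] path that])
  have "circle_norm p (\<lambda>\<theta>. cmod (?U (cis \<theta> * z1) - ?U (cis \<theta> * z2))) \<le> ennreal (48 * 1 * M / \<beta> * cmod (z1 - z2) powr \<beta>)"
    if "z1 \<in> cball 0 1" "z2 \<in> cball 0 1" for z1 z2
    by (rule circle_norm_le_closed_disk[OF p \<beta>(1) _ Uc open_disk that]) (use M \<beta> in auto)
  then show ?thesis
    unfolding Lip_disk_def using p M \<beta> borel_measurable_continuous_on_restrict[OF Uc]
    by (auto simp: Lp_diff_eq_circle_norm pow_mod_def intro!: exI[of _ "48 * 1 * M / \<beta>"])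
qed

text \<open>
  Superharmonicity of the power of the distance. At \<open>w\<^sub>0=\<phi>(z)\<close> the concave function
  \<open>w \<mapsto> (1-|w|)^\<alpha>\<close> has a supporting affine function; composed with \<open>\<phi>\<close> and integrated against
  the Poisson kernel the affine function reproduces its value at \<open>w\<^sub>0\<close>, because \<open>\<phi>=P[\<phi>]\<close>.
\<close>

lemma poisson_integral_le_dist_power:
  assumes \<alpha>: "0 < \<alpha>" "\<alpha> \<le> 1"
    and \<phi>: "\<phi> holomorphic_on ball 0 1" "\<phi> ` ball 0 1 \<subseteq> ball 0 1" and cont: "continuous_on (cball 0 1) \<phi>"
    and z: "cmod z < 1"
  shows "poisson_integral (\<lambda>z. dD (\<phi> z) powr \<alpha>) z \<le> dD (\<phi> z) powr \<alpha>"
proof -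
  let ?u = "\<lambda>z. dD (\<phi> z) powr \<alpha>"
  \<comment> \<open>The direction of the supporting functional; it is \<open>0\<close> if \<open>\<phi>(z)=0\<close>, where the maximum is
    attained.\<close>
  define v where "v = sgn (\<phi> z)"
  define s where "s = 1 - cmod (\<phi> z)"
  have \<phi>z: "cmod (\<phi> z) < 1" using \<phi>(2) z by (auto simp: image_subset_iff)
  have s: "0 < s" using \<phi>z by (simp add: s_def)
  have v1: "cmod v \<le> 1" by (simp add: v_def norm_sgn)
  have vz: "Re (cnj v * \<phi> z) = cmod (\<phi> z)"
  proof (cases "\<phi> z = 0")
    case False
    have "cnj v * \<phi> z = of_real ((cmod (\<phi> z))\<^sup>2) / of_real (cmod (\<phi> z))"
      unfolding complex_norm_square by (simp add: v_def sgn_eq mult.commute)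
    also have "\<dots> = of_real (cmod (\<phi> z))" using False by (simp add: power2_eq_square)
    finally show ?thesis by simp
  qed (simp add: v_def)
  have \<phi>c: "\<phi> ` cball 0 1 \<subseteq> cball 0 1" by (rule image_cball_subset[OF cont \<phi>(2)])
  have uc: "continuous_on UNIV (\<lambda>\<tau>. ?u (cis \<tau>))"
    by (rule continuous_on_compose2[OF continuous_on_dist_power[OF \<alpha>(1) cont \<phi>c]]) (auto intro!: continuous_intros)
  define R where "R = (\<lambda>\<tau>. s powr \<alpha> + \<alpha> * s powr (\<alpha> - 1) * (cmod (\<phi> z) - Re (cnj v * \<phi> (cis \<tau>))))"
  have uR: "?u (cis \<tau>) \<le> R \<tau>" for \<tau>
  proof -
    have "cmod (\<phi> (cis \<tau>)) \<le> 1" using \<phi>c by (auto simp: image_subset_iff)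
    then have "?u (cis \<tau>) \<le> s powr \<alpha> + \<alpha> * s powr (\<alpha> - 1) * ((1 - cmod (\<phi> (cis \<tau>))) - s)"
      unfolding dD_def using \<alpha> s by (intro powr_concave_tangent) auto
    also have "\<dots> \<le> R \<tau>" unfolding R_def
    proof (intro add_left_mono mult_left_mono)
      have "Re (cnj v * \<phi> (cis \<tau>)) \<le> cmod (cnj v * \<phi> (cis \<tau>))" by (rule complex_Re_le_cmod)
      also have "\<dots> \<le> 1 * cmod (\<phi> (cis \<tau>))" unfolding norm_mult complex_mod_cnj by (intro mult_right_mono v1) auto
      finally show "1 - cmod (\<phi> (cis \<tau>)) - s \<le> cmod (\<phi> z) - Re (cnj v * \<phi> (cis \<tau>))" by (simp add: s_def)
    qed (use \<alpha> in auto)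
    finally show ?thesis .
  qed
  have bl: "bounded_linear (\<lambda>x. Re (cnj v * x))"
    using bounded_linear_compose[OF bounded_linear_Re bounded_linear_mult_right] by blast
  have "((\<lambda>\<tau>. poisson_kernel z \<tau> * Re (cnj v * \<phi> (cis \<tau>))) has_integral 2 * pi * cmod (\<phi> z)) {0..2*pi}"
  proof -
    have e: "Re (cnj v * (a *\<^sub>R x)) = a * Re (cnj v * x)" for a x by (simp add: algebra_simps)
    show ?thesis
      using has_integral_linear[OF poisson_formula[OF cont \<phi>(1) z] bl]
      unfolding o_def scaleR_conv_of_real[symmetric] e vz .
  qed
  then have "((\<lambda>\<tau>. (s powr \<alpha> + \<alpha> * s powr (\<alpha> - 1) * cmod (\<phi> z)) * poisson_kernel z \<tau> - \<alpha> * s powr (\<alpha> - 1) * (poisson_kernel z \<tau> * Re (cnj v * \<phi> (cis \<tau>)))) has_integral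
      (s powr \<alpha> + \<alpha> * s powr (\<alpha> - 1) * cmod (\<phi> z)) * (2 * pi) - \<alpha> * s powr (\<alpha> - 1) * (2 * pi * cmod (\<phi> z))) {0..2*pi}"
    by (intro has_integral_diff has_integral_mult_right poisson_kernel_has_integral z)
  then have IR: "((\<lambda>\<tau>. poisson_kernel z \<tau> * R \<tau>) has_integral s powr \<alpha> * (2 * pi)) {0..2*pi}"
    by (simp add: R_def algebra_simps)
  have "integral {0..2*pi} (\<lambda>\<tau>. poisson_kernel z \<tau> * ?u (cis \<tau>)) \<le> integral {0..2*pi} (\<lambda>\<tau>. poisson_kernel z \<tau> * R \<tau>)"
  proof (rule integral_le)
    show "(\<lambda>\<tau>. poisson_kernel z \<tau> * ?u (cis \<tau>)) integrable_on {0..2*pi}"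
      by (intro integrable_continuous_interval continuous_intros z continuous_on_subset[OF uc]) auto
  qed (use IR uR poisson_kernel_nonneg[OF z] in \<open>auto intro: mult_left_mono has_integral_integrable\<close>)
  then show ?thesis
    unfolding poisson_integral_eq[OF uc z] integral_unique[OF IR] by (simp add: s_def dD_def pos_divide_le_eq)
qed

text \<open>
  The rotated form is a parameter integral of a jointly continuous function.
\<close>

lemma poisson_osc_measurable:
  fixes U :: "complex \<Rightarrow> real"
  assumes U: "continuous_on UNIV (\<lambda>\<tau>. U (cis \<tau>))" and r: "0 < r" "r < 1" and c: "continuous_on UNIV c"
  shows "(\<lambda>\<theta>. poisson_osc U (of_real r * cis \<theta>) (c \<theta>)) \<in> borel_measurable borel"
proof -
  have rz: "cmod (of_real r) < 1" using r by simp
  have Uf: "continuous_on A (\<lambda>x. U (cis (g x)))" if "continuous_on A g" for A :: "'b::topological_space set" and g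
    using continuous_on_compose2[OF U that] by auto
  have pf: "continuous_on A (\<lambda>x. poisson_kernel (of_real r) (g x))" if "continuous_on A g" for A :: "'b::topological_space set" and g
    using continuous_on_compose2[OF continuous_on_poisson_kernel[OF rz, of UNIV] that] by auto
  have cf: "continuous_on A (\<lambda>x. c (g x))" if "continuous_on A g" for A :: "'b::topological_space set" and g
    using continuous_on_compose2[OF c that] by auto
  let ?F = "\<lambda>x. poisson_kernel (of_real r) (snd x) / (2 * pi) * \<bar>U (cis (fst x) * cis (snd x)) - c (fst x)\<bar>"
  have "continuous_on UNIV ?F"
    unfolding cis_mult by (intro continuous_intros Uf pf cf) auto
  then have "?F \<in> borel_measurable (borel \<Otimes>\<^sub>M borel)"
    unfolding borel_prod by (rule borel_measurable_continuous_onI)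
  then have [measurable]: "?F \<in> borel_measurable (borel \<Otimes>\<^sub>M lborel)"
    by (simp cong: measurable_cong_sets sets_pair_measure_cong)
  have "(\<lambda>\<theta>. \<integral>\<^sup>+\<tau>. ennreal (?F (\<theta>, \<tau>)) * indicator {0..2*pi} \<tau> \<partial>lborel) \<in> borel_measurable borel"
    by measurable
  then have "(\<lambda>\<theta>. enn2real (\<integral>\<^sup>+\<tau>. ennreal (?F (\<theta>, \<tau>)) * indicator {0..2*pi} \<tau> \<partial>lborel)) \<in> borel_measurable borel"
    by measurable
  moreover have "enn2real (\<integral>\<^sup>+\<tau>. ennreal (?F (\<theta>, \<tau>)) * indicator {0..2*pi} \<tau> \<partial>lborel) = poisson_osc U (of_real r * cis \<theta>) (c \<theta>)" for \<theta>
  proof -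
    have "cmod (of_real r * cis \<theta>) < 1" using r by (simp add: norm_mult)
    then show ?thesis
      by (simp only: fst_conv snd_conv poisson_osc_eq_rotated[OF U r, symmetric] enn2real_ennreal poisson_osc_nonneg[OF U])
  qed
  ultimately show ?thesis by simp
qed

text \<open>
  The tangent inequality turns a drop of at most \<open>B\<close> of the power into a drop of at most
  \<open>B d^(1-\<alpha>)/\<alpha>\<close> of the distance itself, which is the growth of \<open>|\<phi>|\<close> on the circle; the
  factor \<open>d^(1-\<alpha>)\<close> is cancelled by the weight.
\<close>

lemma weighted_deriv_le_drop:
  assumes \<alpha>: "0 < \<alpha>" "\<alpha> \<le> 1"
    and \<phi>: "\<phi> holomorphic_on ball 0 1" "\<phi> ` ball 0 1 \<subseteq> ball 0 1"
    and \<rho>: "0 < \<rho>" "cball z \<rho> \<subseteq> ball 0 1"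
    and B: "\<And>w. w \<in> sphere z \<rho> \<Longrightarrow> dD (\<phi> z) powr \<alpha> - dD (\<phi> w) powr \<alpha> \<le> B"
  shows "\<rho> * weighted_deriv \<alpha> \<phi> z \<le> 2 * B / \<alpha>"
proof -
  define a where "a = dD (\<phi> z)"
  have zb: "z \<in> ball 0 1" using \<rho> by (auto simp: subset_iff)
  have d: "0 < dD (\<phi> w)" if "w \<in> ball 0 1" for w
    using \<phi>(2) that by (auto simp: dD_def image_subset_iff)
  have a: "0 < a" unfolding a_def by (rule d[OF zb])
  have aa: "a powr (1 - \<alpha>) * a powr (\<alpha> - 1) = 1" using a by (simp flip: powr_add)
  have "\<rho> * cmod (deriv \<phi> z) \<le> 2 * (B / \<alpha> * a powr (1 - \<alpha>))"
  proof (rule deriv_bound_of_modulus_growth)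
    show "continuous_on (cball z \<rho>) \<phi>"
      using holomorphic_on_imp_continuous_on[OF \<phi>(1)] \<rho>(2) by (rule continuous_on_subset)
    show "\<phi> holomorphic_on ball z \<rho>"
      by (rule holomorphic_on_subset[OF \<phi>(1) subset_trans[OF ball_subset_cball \<rho>(2)]])
    fix w assume w: "w \<in> sphere z \<rho>"
    then have "w \<in> ball 0 1" using \<rho>(2) sphere_cball by blast
    then have b: "0 < dD (\<phi> w)" by (rule d)
    have "dD (\<phi> w) powr \<alpha> \<le> a powr \<alpha> + \<alpha> * a powr (\<alpha> - 1) * (dD (\<phi> w) - a)"
      using powr_concave_tangent[OF \<alpha> a] b by simp
    then have "\<alpha> * a powr (\<alpha> - 1) * (a - dD (\<phi> w)) \<le> B"
      using B[OF w] unfolding a_def[symmetric] by (simp add: algebra_simps)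
    then have "a powr (1 - \<alpha>) / \<alpha> * (\<alpha> * a powr (\<alpha> - 1) * (a - dD (\<phi> w))) \<le> a powr (1 - \<alpha>) / \<alpha> * B"
      using \<alpha> by (intro mult_left_mono) auto
    also have "a powr (1 - \<alpha>) / \<alpha> * (\<alpha> * a powr (\<alpha> - 1) * (a - dD (\<phi> w))) = (a powr (1 - \<alpha>) * a powr (\<alpha> - 1)) * (a - dD (\<phi> w))"
      using \<alpha> by simp
    finally have "a - dD (\<phi> w) \<le> a powr (1 - \<alpha>) / \<alpha> * B" by (simp add: aa)
    then show "cmod (\<phi> w) \<le> cmod (\<phi> z) + B / \<alpha> * a powr (1 - \<alpha>)"
      by (simp add: a_def dD_def mult.commute)
  qed (rule \<rho>)
  then have "\<rho> * cmod (deriv \<phi> z) * a powr (\<alpha> - 1) \<le> 2 * (B / \<alpha> * a powr (1 - \<alpha>)) * a powr (\<alpha> - 1)"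
    by (rule mult_right_mono) simp
  also have "\<dots> = 2 * (B / \<alpha>) * (a powr (1 - \<alpha>) * a powr (\<alpha> - 1))" by simp
  also have "\<dots> = 2 * B / \<alpha>" by (simp add: aa)
  finally show ?thesis by (simp add: weighted_deriv_def a_def mult.assoc)
qed

lemma lip_circle_imp_circle_norm:
  fixes u :: "complex \<Rightarrow> real"
  assumes p: "1 \<le> p" and "(\<lambda>z. complex_of_real (u z)) \<in> Lip_circle (pow_mod \<beta>) (ennreal p)"
  shows "\<exists>M>0. \<forall>\<tau>. circle_norm p (\<lambda>\<eta>. \<bar>u (cis \<eta> * cis \<tau>) - u (cis \<eta>)\<bar>) \<le> ennreal (M * cmod (cis \<tau> - 1) powr \<beta>)"
proof -
  obtain M where M: "0 < M" and lip: "\<And>x y. cmod x = 1 \<Longrightarrow> cmod y = 1 \<Longrightarrow>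
      circle_norm p (\<lambda>\<eta>. cmod (complex_of_real (u (cis \<eta> * x)) - complex_of_real (u (cis \<eta> * y)))) \<le> ennreal (M * cmod (x - y) powr \<beta>)"
    using assms(2) p unfolding Lip_circle_def pow_mod_def by (auto simp: Lp_diff_eq_circle_norm)
  show ?thesis
  proof (intro exI[of _ M] conjI allI M)
    show "circle_norm p (\<lambda>\<eta>. \<bar>u (cis \<eta> * cis \<tau>) - u (cis \<eta>)\<bar>) \<le> ennreal (M * cmod (cis \<tau> - 1) powr \<beta>)" for \<tau>
      using lip[of "cis \<tau>" 1] by (simp flip: of_real_diff)
  qed
qed

text \<open>
  Continuity up to the boundary gives \<open>u\<close> pointwise boundary values, and \<open>\<beta><1\<close> makes the Poisson
  average of \<open>|e^(i\<tau>)-1|^\<beta>\<close> of order \<open>(1-r)^\<beta>\<close>.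
\<close>

locale continuous_symbol =
  fixes p \<alpha> \<beta> :: real and \<phi> :: "complex \<Rightarrow> complex"
  assumes p: "1 \<le> p" and \<alpha>: "0 < \<alpha>" "\<alpha> \<le> 1" and \<beta>: "0 < \<beta>" "\<beta> < 1"
    and holomorphic: "\<phi> holomorphic_on ball 0 1" and self_map: "\<phi> ` ball 0 1 \<subseteq> ball 0 1"
    and continuous: "continuous_on (cball 0 1) \<phi>"
begin

definition u :: "complex \<Rightarrow> real" where
  "u z = dD (\<phi> z) powr \<alpha>"

lemma u_continuous: "continuous_on (cball 0 1) u"
  unfolding u_def by (rule continuous_on_dist_power[OF \<alpha>(1) continuous image_cball_subset[OF continuous self_map]])

lemma u_bounds:
  assumes "cmod z \<le> 1"
  shows "0 \<le> u z" "u z \<le> 1"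
proof -
  have "cmod (\<phi> z) \<le> 1"
    using image_cball_subset[OF continuous self_map] assms by (auto simp: image_subset_iff)
  then show "0 \<le> u z" "u z \<le> 1" using \<alpha> by (auto simp: u_def dD_def powr_le_one_le intro: powr_le1)
qed

lemma u_continuous_scaled:
  assumes "0 \<le> r" "r \<le> 1"
  shows "continuous_on UNIV (\<lambda>\<theta>. u (of_real r * cis \<theta>))"
  by (rule continuous_on_compose2[OF u_continuous]) (use assms in \<open>auto intro!: continuous_intros simp: norm_mult\<close>)

lemma u_circle: "continuous_on UNIV (\<lambda>\<theta>. u (cis \<theta>))"
  using u_continuous_scaled[of 1] by simp

lemma poisson_le_u: "cmod z < 1 \<Longrightarrow> poisson_integral u z \<le> u z"
  using poisson_integral_le_dist_power[OF \<alpha> holomorphic self_map continuous] unfolding u_def .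

lemma poisson_u_measurable:
  assumes "0 < r" "r < 1"
  shows "(\<lambda>\<theta>. poisson_integral u (of_real r * cis \<theta>)) \<in> borel_measurable borel"
proof -
  have "poisson_integral u (of_real r * cis \<theta>) = poisson_osc u (of_real r * cis \<theta>) 0" for \<theta>
    using assms u_bounds(1) by (subst poisson_integral_eq[OF u_circle]) (auto simp: poisson_osc_def norm_mult)
  then show ?thesis using poisson_osc_measurable[OF u_circle assms, of "\<lambda>_. 0"] by simp
qed

lemma poisson_osc_self:
  assumes "cmod z < 1"
  shows "\<bar>poisson_integral u z - c\<bar> \<le> poisson_osc u z c"
  using poisson_osc_bound[OF u_circle assms assms, of 1 c] by simp

lemma closed_lipschitz_imp_one_sided:
  assumes "(\<lambda>z. complex_of_real (u z)) \<in> Lip_disk (pow_mod \<beta>) (ennreal p) (cball 0 1)"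
  shows "(\<lambda>z. complex_of_real (u z)) \<in> Lip_circle (pow_mod \<beta>) (ennreal p)"
    and "\<exists>M>0. \<forall>r\<in>{0<..<1}. circle_norm p (\<lambda>\<theta>. max 0 (u (of_real r * cis \<theta>) - u (cis \<theta>))) \<le> ennreal (M * (1 - r) powr \<beta>)"
proof -
  obtain M where M: "0 < M" and lip: "\<And>x y. cmod x \<le> 1 \<Longrightarrow> cmod y \<le> 1 \<Longrightarrow>
      circle_norm p (\<lambda>\<eta>. cmod (complex_of_real (u (cis \<eta> * x)) - complex_of_real (u (cis \<eta> * y)))) \<le> ennreal (M * cmod (x - y) powr \<beta>)"
    using assms p unfolding Lip_disk_def pow_mod_def by (auto simp: Lp_diff_eq_circle_norm)
  have "(\<lambda>\<theta>. complex_of_real (u (cis \<theta>))) \<in> borel_measurable borel"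
    by (intro borel_measurable_continuous_onI continuous_intros u_circle)
  then have "(\<lambda>\<theta>. complex_of_real (u (cis \<theta>))) \<in> borel_measurable (lebesgue_on {0..2*pi})"
    by (intro measurable_restrict_space1 measurable_completion) simp
  moreover have "circle_norm p (\<lambda>\<theta>. cmod (complex_of_real (u (cis \<theta>)))) \<le> ennreal (7 * 1)"
    using u_bounds p by (intro circle_norm_mono[OF circle_norm_const]) auto
  ultimately have "(\<lambda>z. complex_of_real (u z)) \<in> Lp_circle (ennreal p)"
    unfolding Lp_circle_def using p by (auto intro: le_less_trans)
  then show "(\<lambda>z. complex_of_real (u z)) \<in> Lip_circle (pow_mod \<beta>) (ennreal p)"
    unfolding Lip_circle_def pow_mod_def using p M lip by (auto simp: Lp_diff_eq_circle_norm intro!: exI[of _ M])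
  show "\<exists>M>0. \<forall>r\<in>{0<..<1}. circle_norm p (\<lambda>\<theta>. max 0 (u (of_real r * cis \<theta>) - u (cis \<theta>))) \<le> ennreal (M * (1 - r) powr \<beta>)"
  proof (intro exI[of _ M] conjI ballI M)
    fix r :: real assume r: "r \<in> {0<..<1}"
    have "cmod (of_real r - 1) = 1 - r" using r by (metis abs_minus_commute abs_of_pos diff_gt_0_iff_gt greaterThanLessThan_iff norm_of_real of_real_1 of_real_diff)
    then have "circle_norm p (\<lambda>\<eta>. cmod (complex_of_real (u (cis \<eta> * of_real r)) - complex_of_real (u (cis \<eta> * 1)))) \<le> ennreal (M * (1 - r) powr \<beta>)"
      using lip[of "of_real r" 1] r by simp
    then show "circle_norm p (\<lambda>\<theta>. max 0 (u (of_real r * cis \<theta>) - u (cis \<theta>))) \<le> ennreal (M * (1 - r) powr \<beta>)"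
      by (rule circle_norm_mono) (use p M r in \<open>auto simp: mult.commute simp flip: of_real_diff\<close>)
  qed
qed

lemma circle_norm_osc:
  assumes "(\<lambda>z. complex_of_real (u z)) \<in> Lip_circle (pow_mod \<beta>) (ennreal p)"
  shows "\<exists>C>0. \<forall>r. 0 < r \<longrightarrow> r < 1 \<longrightarrow>
    circle_norm p (\<lambda>\<theta>. poisson_osc u (of_real r * cis \<theta>) (u (cis \<theta>))) \<le> ennreal (C * (1 - r) powr \<beta>)"
proof -
  obtain M where M: "0 < M" and lip:
    "\<And>\<tau>. circle_norm p (\<lambda>\<eta>. \<bar>u (cis \<eta> * cis \<tau>) - u (cis \<eta>)\<bar>) \<le> ennreal (M * cmod (cis \<tau> - 1) powr \<beta>)"
    using lip_circle_imp_circle_norm[OF p assms] by blast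
  show ?thesis
    using circle_norm_poisson_osc[OF p \<beta> _ _ M u_circle lip] M \<beta>
    by (intro exI[of _ "M * (192 / (1 - \<beta>))"]) simp
qed

lemma one_sided_imp_poisson_gap:
  assumes lip: "(\<lambda>z. complex_of_real (u z)) \<in> Lip_circle (pow_mod \<beta>) (ennreal p)"
    and "\<exists>M>0. \<forall>r\<in>{0<..<1}. circle_norm p (\<lambda>\<theta>. max 0 (u (of_real r * cis \<theta>) - u (cis \<theta>))) \<le> ennreal (M * (1 - r) powr \<beta>)"
  shows "\<exists>M>0. \<forall>r\<in>{0<..<1}. circle_norm p (\<lambda>\<theta>. u (of_real r * cis \<theta>) - poisson_integral u (of_real r * cis \<theta>)) \<le> ennreal (M * (1 - r) powr \<beta>)"
proof -
  obtain M where M: "0 < M" and one: "\<And>r. 0 < r \<Longrightarrow> r < 1 \<Longrightarrow>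
      circle_norm p (\<lambda>\<theta>. max 0 (u (of_real r * cis \<theta>) - u (cis \<theta>))) \<le> ennreal (M * (1 - r) powr \<beta>)"
    using assms(2) by auto
  obtain C where C: "0 < C" and osc: "\<And>r. 0 < r \<Longrightarrow> r < 1 \<Longrightarrow>
      circle_norm p (\<lambda>\<theta>. poisson_osc u (of_real r * cis \<theta>) (u (cis \<theta>))) \<le> ennreal (C * (1 - r) powr \<beta>)"
    using circle_norm_osc[OF lip] by blast
  show ?thesis
  proof (intro exI[of _ "4 * (M + C)"] conjI ballI)
    show "0 < 4 * (M + C)" using M C by simp
    fix r :: real assume "r \<in> {0<..<1}"
    then have r: "0 < r" "r < 1" by auto
    have rz: "cmod (of_real r * cis \<theta>) < 1" for \<theta> using r by (simp add: norm_mult)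
    have "circle_norm p (\<lambda>\<theta>. max 0 (u (of_real r * cis \<theta>) - u (cis \<theta>)) + poisson_osc u (of_real r * cis \<theta>) (u (cis \<theta>)))
        \<le> ennreal (4 * (M * (1 - r) powr \<beta> + C * (1 - r) powr \<beta>))"
    proof (rule circle_norm_add[OF one[OF r] osc[OF r] p])
      show "(\<lambda>\<theta>. max 0 (u (of_real r * cis \<theta>) - u (cis \<theta>))) \<in> borel_measurable borel"
        using r by (intro borel_measurable_continuous_onI continuous_intros u_continuous_scaled u_circle) auto
    qed (use M C poisson_osc_measurable[OF u_circle r u_circle] poisson_osc_nonneg[OF u_circle rz] in auto)
    then have "circle_norm p (\<lambda>\<theta>. u (of_real r * cis \<theta>) - poisson_integral u (of_real r * cis \<theta>))
        \<le> ennreal (4 * (M * (1 - r) powr \<beta> + C * (1 - r) powr \<beta>))"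
    proof (rule circle_norm_mono)
      fix \<theta> :: real
      have "u (cis \<theta>) - poisson_integral u (of_real r * cis \<theta>) \<le> poisson_osc u (of_real r * cis \<theta>) (u (cis \<theta>))"
        using poisson_osc_self[OF rz, of \<theta> "u (cis \<theta>)"] by linarith
      then show "0 \<le> u (of_real r * cis \<theta>) - poisson_integral u (of_real r * cis \<theta>) \<and>
          u (of_real r * cis \<theta>) - poisson_integral u (of_real r * cis \<theta>) \<le>
          max 0 (u (of_real r * cis \<theta>) - u (cis \<theta>)) + poisson_osc u (of_real r * cis \<theta>) (u (cis \<theta>))"
        using poisson_le_u[OF rz] by auto
    qed (use p M C in auto)
    then show "circle_norm p (\<lambda>\<theta>. u (of_real r * cis \<theta>) - poisson_integral u (of_real r * cis \<theta>)) \<le> ennreal (4 * (M + C) * (1 - r) powr \<beta>)"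
      by (simp add: algebra_simps)
  qed
qed

text \<open>
  For \<open>w\<close> on the circle of radius \<open>(1-|z|)/2\<close> about \<open>z\<close>,
  \<open>u(z)-u(w) \<le> (u(z)-P[u](z)) + |P[u](z)-c| + |c-P[u](w)|\<close>, because \<open>u(w)\<ge> P[u](w)\<close>. The last two
  terms are at most \<open>1\<close> and, by Harnack's inequality, \<open>12\<close> times the mean oscillation about \<open>c\<close>.
\<close>

lemma weighted_deriv_le_gap:
  assumes z: "cmod z < 1"
  shows "(1 - cmod z) * weighted_deriv \<alpha> \<phi> z \<le> 4 / \<alpha> * ((u z - poisson_integral u z) + 13 * poisson_osc u z c)"
proof -
  define \<rho> where "\<rho> = (1 - cmod z) / 2"
  have \<rho>: "0 < \<rho>" using z by (simp add: \<rho>_def)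
  have sub: "cball z \<rho> \<subseteq> ball 0 1"
    unfolding \<rho>_def by (rule cball_half_distance_subset[OF z])
  have near: "cmod w < 1" "cmod (w - z) \<le> (1 - cmod z) / 2" if "w \<in> cball z \<rho>" for w
    using that subsetD[OF sub that] by (simp_all add: \<rho>_def dist_norm norm_minus_commute)
  have "\<rho> * weighted_deriv \<alpha> \<phi> z \<le> 2 * ((u z - poisson_integral u z) + 13 * poisson_osc u z c) / \<alpha>"
  proof (rule weighted_deriv_le_drop[OF \<alpha> holomorphic self_map \<rho> sub])
    fix w assume "w \<in> sphere z \<rho>"
    then have w: "w \<in> cball z \<rho>" by simp
    have "\<bar>poisson_integral u w - c\<bar> \<le> 12 * poisson_osc u z c"
      by (rule poisson_osc_bound[OF u_circle z near(1)[OF w] poisson_kernel_harnack[OF z near(2)[OF w]]])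
    moreover have "\<bar>poisson_integral u z - c\<bar> \<le> poisson_osc u z c" by (rule poisson_osc_self[OF z])
    moreover have "poisson_integral u w \<le> u w" by (rule poisson_le_u[OF near(1)[OF w]])
    ultimately show "dD (\<phi> z) powr \<alpha> - dD (\<phi> w) powr \<alpha> \<le> (u z - poisson_integral u z) + 13 * poisson_osc u z c"
      unfolding u_def[symmetric] by linarith
  qed
  then show ?thesis by (simp add: \<rho>_def)
qed

text \<open>
  The pointwise bound is used with \<open>c=u(e^(i\<theta>))\<close>, so that the \<open>L^p\<close> estimate of the mean oscillation
  applies. It controls circles of positive radius about the origin; the centre itself costs the extra
  constant.
\<close>

lemma poisson_gap_imp_deriv_growth:
  assumes lip: "(\<lambda>z. complex_of_real (u z)) \<in> Lip_circle (pow_mod \<beta>) (ennreal p)"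
    and "\<exists>M>0. \<forall>r\<in>{0<..<1}. circle_norm p (\<lambda>\<theta>. u (of_real r * cis \<theta>) - poisson_integral u (of_real r * cis \<theta>)) \<le> ennreal (M * (1 - r) powr \<beta>)"
  shows "deriv_growth p \<alpha> \<beta> \<phi>"
proof -
  let ?K = "weighted_deriv \<alpha> \<phi>"
  obtain M where M: "0 < M" and gap: "\<And>r. 0 < r \<Longrightarrow> r < 1 \<Longrightarrow>
      circle_norm p (\<lambda>\<theta>. u (of_real r * cis \<theta>) - poisson_integral u (of_real r * cis \<theta>)) \<le> ennreal (M * (1 - r) powr \<beta>)"
    using assms(2) by auto
  obtain C where C: "0 < C" and osc: "\<And>r. 0 < r \<Longrightarrow> r < 1 \<Longrightarrow>
      circle_norm p (\<lambda>\<theta>. poisson_osc u (of_real r * cis \<theta>) (u (cis \<theta>))) \<le> ennreal (C * (1 - r) powr \<beta>)"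
    using circle_norm_osc[OF lip] by blast
  define A where "A = 4 / \<alpha> * (4 * (M + 13 * C))"
  have A: "0 < A" using \<alpha> M C by (simp add: A_def)
  have Kc: "continuous_on (ball 0 1) ?K" by (rule continuous_on_weighted_deriv[OF holomorphic self_map])
  have radial: "circle_norm p (\<lambda>\<theta>. ?K (of_real r * cis \<theta>)) \<le> ennreal (A * (1 - r) powr (\<beta> - 1))" if r: "0 < r" "r < 1" for r
  proof -
    have rz: "cmod (of_real r * cis \<theta>) = r" "cmod (of_real r * cis \<theta>) < 1" for \<theta> using r by (simp_all add: norm_mult)
    let ?f = "\<lambda>\<theta>. u (of_real r * cis \<theta>) - poisson_integral u (of_real r * cis \<theta>)"
    let ?g = "\<lambda>\<theta>. 13 * poisson_osc u (of_real r * cis \<theta>) (u (cis \<theta>))"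
    have gm: "?g \<in> borel_measurable borel" and fm: "?f \<in> borel_measurable borel"
      using poisson_osc_measurable[OF u_circle r u_circle] poisson_u_measurable[OF r]
        borel_measurable_continuous_onI[OF u_continuous_scaled[of r]] r by auto
    have nn: "0 \<le> ?f \<theta>" "0 \<le> ?g \<theta>" for \<theta>
      using poisson_le_u[OF rz(2)] poisson_osc_nonneg[OF u_circle rz(2)] by auto
    have g: "circle_norm p ?g \<le> ennreal (13 * (C * (1 - r) powr \<beta>))"
      using osc[OF r] p C poisson_osc_measurable[OF u_circle r u_circle] poisson_osc_nonneg[OF u_circle rz(2)]
      by (intro circle_norm_cmult) auto
    have "circle_norm p (\<lambda>\<theta>. ?f \<theta> + ?g \<theta>) \<le> ennreal (4 * (M * (1 - r) powr \<beta> + 13 * (C * (1 - r) powr \<beta>)))"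
      by (rule circle_norm_add[OF gap[OF r] g p]) (use M C fm gm nn in auto)
    then have "circle_norm p (\<lambda>\<theta>. 4 / (\<alpha> * (1 - r)) * (?f \<theta> + ?g \<theta>)) \<le>
        ennreal (4 / (\<alpha> * (1 - r)) * (4 * (M * (1 - r) powr \<beta> + 13 * (C * (1 - r) powr \<beta>))))"
    proof (rule circle_norm_cmult)
      show "(\<lambda>\<theta>. ?f \<theta> + ?g \<theta>) \<in> borel_measurable borel" using fm gm by (rule borel_measurable_add)
      show "0 \<le> ?f \<theta> + ?g \<theta>" for \<theta> using nn[of \<theta>] by linarith
    qed (use p M C \<alpha> r in auto)
    also have "4 / (\<alpha> * (1 - r)) * (4 * (M * (1 - r) powr \<beta> + 13 * (C * (1 - r) powr \<beta>))) = A * (1 - r) powr (\<beta> - 1)"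
      using r by (simp add: A_def powr_diff field_simps)
    finally have bound: "circle_norm p (\<lambda>\<theta>. 4 / (\<alpha> * (1 - r)) * (?f \<theta> + ?g \<theta>)) \<le> ennreal (A * (1 - r) powr (\<beta> - 1))" .
    show ?thesis
    proof (rule circle_norm_mono[OF bound])
      fix \<theta> :: real
      have "(1 - r) * ?K (of_real r * cis \<theta>) \<le> 4 / \<alpha> * (?f \<theta> + ?g \<theta>)"
        using weighted_deriv_le_gap[OF rz(2), of \<theta> "u (cis \<theta>)"] unfolding rz(1) .
      then have "?K (of_real r * cis \<theta>) \<le> 4 / \<alpha> * (?f \<theta> + ?g \<theta>) / (1 - r)"
        using r by (subst pos_le_divide_eq) (auto simp: mult.commute)
      then show "0 \<le> ?K (of_real r * cis \<theta>) \<and> ?K (of_real r * cis \<theta>) \<le> 4 / (\<alpha> * (1 - r)) * (?f \<theta> + ?g \<theta>)"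
        using weighted_deriv_nonneg by simp
    qed (use p A in auto)
  qed
  show ?thesis
    unfolding deriv_growth_def
  proof (intro exI[of _ "A + 7 * ?K 0"] conjI ballI)
    show "0 < A + 7 * ?K 0" using A weighted_deriv_nonneg[of \<alpha> \<phi> 0] by linarith
    fix z :: complex assume z: "z \<in> ball 0 1"
    show "circle_norm p (\<lambda>\<theta>. ?K (cis \<theta> * z)) \<le> ennreal ((A + 7 * ?K 0) * (1 - cmod z) powr (\<beta> - 1))"
    proof (cases "z = 0")
      case True
      have "circle_norm p (\<lambda>\<theta>. ?K 0) \<le> ennreal (7 * ?K 0)" by (rule circle_norm_const[OF p weighted_deriv_nonneg])
      also have "\<dots> \<le> ennreal (A + 7 * ?K 0)" using A by (intro ennreal_leI) simp
      finally show ?thesis using True by simp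
    next
      case False
      \<comment> \<open>A circle through \<open>z\<close> has the same mean as the one through \<open>|z|\<close>.\<close>
      define r where "r = cmod z"
      have r: "0 < r" "r < 1" using False z by (auto simp: r_def)
      have zr: "z = of_real r * cis (Arg z)" by (simp add: r_def rcis_cmod_Arg flip: rcis_def)
      have "continuous_on UNIV (\<lambda>\<theta>. ?K (of_real r * cis \<theta>))"
        by (rule continuous_on_compose2[OF Kc]) (use r in \<open>auto intro!: continuous_intros simp: norm_mult\<close>)
      then have "(\<lambda>\<theta>. ?K (of_real r * cis \<theta>)) \<in> borel_measurable borel" by (rule borel_measurable_continuous_onI)
      then have "circle_norm p (\<lambda>\<theta>. ?K (of_real r * (cis (Arg z) * cis \<theta>))) \<le> ennreal (A * (1 - r) powr (\<beta> - 1))"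
        using radial[OF r] p A by (subst circle_norm_rotate[where g = "\<lambda>\<zeta>. ?K (of_real r * \<zeta>)"]) auto
      also have "(\<lambda>\<theta>. ?K (of_real r * (cis (Arg z) * cis \<theta>))) = (\<lambda>\<theta>. ?K (cis \<theta> * z))"
        by (subst (2) zr) (simp add: mult_ac)
      also have "ennreal (A * (1 - r) powr (\<beta> - 1)) \<le> ennreal ((A + 7 * ?K 0) * (1 - cmod z) powr (\<beta> - 1))"
        unfolding r_def by (intro ennreal_leI mult_right_mono) (auto simp: weighted_deriv_nonneg)
      finally show ?thesis .
    qed
  qed
qed

end

theorem corollary2p13:
  fixes p \<alpha> \<beta> :: real and \<phi> :: "complex \<Rightarrow> complex"
  assumes "1 \<le> p"
    and "0 < \<alpha>" "\<alpha> \<le> 1"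
    and "0 < \<beta>" "\<beta> \<le> 1"
    and "\<phi> holomorphic_on ball 0 1"
    and "\<phi> ` ball 0 1 \<subseteq> ball 0 1"
  shows
   "let
      G1 = \<phi> \<in> comp_symbols
                 (Lip_disk (pow_mod \<alpha>) \<infinity> (ball 0 1) \<inter> harmonic_disk)
                 (Lip_disk (pow_mod \<beta>) (ennreal p) (ball 0 1) \<inter> harmonic_disk);
      G2 = (\<exists>M>0. \<forall>z\<in>ball 0 1.
              circle_norm p (\<lambda>\<theta>. cmod (deriv \<phi> (z * cis \<theta>)) * dD (\<phi> (z * cis \<theta>)) powr (\<alpha> - 1))
                \<le> ennreal (M * dD z powr (\<beta> - 1)));
      d\<alpha> = (\<lambda>z. dD (\<phi> z) powr \<alpha>);
      G3 = (\<lambda>z. complex_of_real (d\<alpha> z)) \<in> Lip_disk (pow_mod \<beta>) (ennreal p) (cball 0 1);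
      G4 = ((\<lambda>z. complex_of_real (d\<alpha> z)) \<in> Lip_circle (pow_mod \<beta>) (ennreal p) \<and>
            (\<exists>M>0. \<forall>r\<in>{0<..<1}.
              circle_norm p (\<lambda>\<theta>. max 0 (d\<alpha> (of_real r * cis \<theta>) - d\<alpha> (cis \<theta>)))
                \<le> ennreal (M * dD (of_real r) powr \<beta>)));
      G5 = ((\<lambda>z. complex_of_real (d\<alpha> z)) \<in> Lip_circle (pow_mod \<beta>) (ennreal p) \<and>
            (\<exists>M>0. \<forall>r\<in>{0<..<1}.
              circle_norm p
                 (\<lambda>\<theta>. d\<alpha> (of_real r * cis \<theta>) - poisson_integral d\<alpha> (of_real r * cis \<theta>))
                \<le> ennreal (M * dD (of_real r) powr \<beta>)))
    in
      (G1 \<longleftrightarrow> G2) \<and>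
      (continuous_on (cball 0 1) \<phi> \<and> \<beta> \<noteq> 1 \<longrightarrow>
         (G1 \<longleftrightarrow> G3) \<and> (G1 \<longleftrightarrow> G4) \<and> (G1 \<longleftrightarrow> G5))"
proof -
  define G1 where "G1 \<longleftrightarrow> \<phi> \<in> comp_symbols
                 (Lip_disk (pow_mod \<alpha>) \<infinity> (ball 0 1) \<inter> harmonic_disk)
                 (Lip_disk (pow_mod \<beta>) (ennreal p) (ball 0 1) \<inter> harmonic_disk)"
  define G2 where "G2 \<longleftrightarrow> (\<exists>M>0. \<forall>z\<in>ball 0 1.
              circle_norm p (\<lambda>\<theta>. cmod (deriv \<phi> (z * cis \<theta>)) * dD (\<phi> (z * cis \<theta>)) powr (\<alpha> - 1))
                \<le> ennreal (M * dD z powr (\<beta> - 1)))"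
  define d\<alpha> where "d\<alpha> = (\<lambda>z. dD (\<phi> z) powr \<alpha>)"
  define G3 where "G3 \<longleftrightarrow> (\<lambda>z. complex_of_real (d\<alpha> z)) \<in> Lip_disk (pow_mod \<beta>) (ennreal p) (cball 0 1)"
  define G4 where "G4 \<longleftrightarrow> ((\<lambda>z. complex_of_real (d\<alpha> z)) \<in> Lip_circle (pow_mod \<beta>) (ennreal p) \<and>
            (\<exists>M>0. \<forall>r\<in>{0<..<1}.
              circle_norm p (\<lambda>\<theta>. max 0 (d\<alpha> (of_real r * cis \<theta>) - d\<alpha> (cis \<theta>)))
                \<le> ennreal (M * dD (of_real r) powr \<beta>)))"
  define G5 where "G5 \<longleftrightarrow> ((\<lambda>z. complex_of_real (d\<alpha> z)) \<in> Lip_circle (pow_mod \<beta>) (ennreal p) \<and>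
            (\<exists>M>0. \<forall>r\<in>{0<..<1}.
              circle_norm p
                 (\<lambda>\<theta>. d\<alpha> (of_real r * cis \<theta>) - poisson_integral d\<alpha> (of_real r * cis \<theta>))
                \<le> ennreal (M * dD (of_real r) powr \<beta>)))"
  have G2_iff: "G2 \<longleftrightarrow> deriv_growth p \<alpha> \<beta> \<phi>"
    by (simp add: G2_def deriv_growth_def weighted_deriv_def dD_def mult.commute)
  have G12: "G1 \<longleftrightarrow> G2"
    using composition_imp_deriv_growth[OF assms(1-5)] deriv_growth_imp_composition[OF assms]
    unfolding G1_def G2_iff by blast
  have "(G1 \<longleftrightarrow> G3) \<and> (G1 \<longleftrightarrow> G4) \<and> (G1 \<longleftrightarrow> G5)" if "continuous_on (cball 0 1) \<phi>" "\<beta> \<noteq> 1"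
  proof -
    interpret continuous_symbol p \<alpha> \<beta> \<phi>
      using assms that by unfold_locales auto
    have u: "u = d\<alpha>" by (rule ext) (simp add: u_def d\<alpha>_def)
    have dr: "dD (of_real r) = 1 - r" if "r \<in> {0<..<1}" for r using that by (simp add: dD_def)
    have "G2 \<Longrightarrow> G3"
      using deriv_growth_imp_lipschitz_closed[OF assms that(1)] unfolding G2_iff G3_def d\<alpha>_def .
    moreover have "G3 \<Longrightarrow> G4"
      using closed_lipschitz_imp_one_sided unfolding G3_def G4_def u by (simp add: dr)
    moreover have "G4 \<Longrightarrow> G5"
      using one_sided_imp_poisson_gap unfolding G4_def G5_def u by (simp add: dr)
    moreover have "G5 \<Longrightarrow> G2"
      using poisson_gap_imp_deriv_growth unfolding G5_def G2_iff u by (simp add: dr)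
    ultimately show ?thesis using G12 by blast
  qed
  with G12 have "(G1 \<longleftrightarrow> G2) \<and> (continuous_on (cball 0 1) \<phi> \<and> \<beta> \<noteq> 1 \<longrightarrow>
         (G1 \<longleftrightarrow> G3) \<and> (G1 \<longleftrightarrow> G4) \<and> (G1 \<longleftrightarrow> G5))" by blast
  then show ?thesis
    unfolding Let_def G1_def G2_def G3_def G4_def G5_def d\<alpha>_def .
qed

end
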